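(* Let $n_1,n_2,m_1,m_2$ be nonzero integers and $\pi=\langle a,b\mid a^{n_1}b^{m_1}a^{n_2}b^{m_2}\rangle$. If $m_1+m_2=\pm1$ or $n_1+n_2=\pm1$, then $(M_i^\circ)_{\mathbb{Q}}=\emptyset$ for $i=1,\dots,8$ and $\dim(M_i^\circ)_{\mathbb{Q}}\le 0$ for $i=9,10$. Let $s=n_1-n_2$ and $t=m_1-m_2$, and let $\zeta_{2s},\zeta_t\in\overline{\mathbb{Q}}\setminus\{\pm1\}$ be not necessarily primitive $2s$-th and $t$-th roots of unity respectively. If moreover $$z=\frac{\zeta_{2s}^{n_1+1}-\zeta_{2s}^{-(n_1+1)}}{\zeta_{2s}^{n_1}-\zeta_{2s}^{-n_1}}\cdot\frac{\zeta_t^{m_1-1}-\zeta_t^{-(m_1-1)}}{\zeta_t^{m_1}-\zeta_t^{-m_1}}+\frac{\zeta_t^{m_1+1}-\zeta_t^{-(m_1+1)}}{\zeta_t^{m_1}-\zeta_t^{-m_1}}\cdot\frac{\zeta_{2s}^{n_1-1}-\zeta_{2s}^{-(n_1-1)}}{\zeta_{2s}^{n_1}-\zeta_{2s}^{-n_1}}$$ (assumed to be defined, i.e. with nonzero denominators) is not an algebraic integer, then there is a closed immersion $$\mathrm{Spec}(\mathbb{Z}[\zeta_{2s},\zeta_t,z])\hookrightarrow M_9^\circ$$ such that the fiber over $\mathbb{Q}$ lies in $M^{\mathrm{irr}}(\pi,\mathrm{SL}_2)_{\mathbb{Q}}$. Furthermore, $(M_9^\circ)_{\mathbb{Q}}$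 is covered by the union of these inclusions over all choices of $\zeta_{2s}$ and $\zeta_t$. Hence $M_9^\circ$ has a $\overline{\mathbb{Z}}_\ell$-point over exactly those primes $\ell$ for which $v_\ell(z)\ge 0$ for some $\ell$-adic valuation $v_\ell$ and some such $z$. Swapping the roles of $n$ and $m$ (i.e. exchanging $(n_1,n_2)$ with $(m_1,m_2)$), the same statement holds for $M_{10}^\circ$. Hence $\pi$ is weakly integral for $(2,1)$ at exactly this set of primes $\ell$.
   Context: Weak integrality: $\pi$ is weakly integral for $(2,1)$ at a prime $\ell$ if there is an absolutely irreducible representation $\pi\to\mathrm{GL}_2(\overline{\mathbb{Z}}_\ell)$ with trivial determinant, where $\overline{\mathbb{Z}}_\ell$ is the integral closure of $\mathbb{Z}_\ell$ in $\overline{\mathbb{Q}}_\ell$. The empty scheme has dimension $-\infty$. Character varieties: $\mathrm{Hom}_{\mathrm{gp}}(\pi,\mathrm{SL}_2)$ is the affine $\mathbb{Z}$-scheme representing $A\mapsto\mathrm{Hom}(\pi,\mathrm{SL}_2(A))$, and $M(\pi,\mathrm{SL}_2)$ is its GIT quotient by conjugation. $M^{\mathrm{irr}}(\pi,\mathrm{SL}_2)$ is the GIT quotient of the subscheme of representations irreducible at each geometric point; $M^{\mathrm{gen.irr}}(\pi,\mathrm{SL}_2)$ is the scheme-theoretic image of $M^{\mathrm{irr}}(\pi,\mathrm{SL}_2)_{\mathbb{Q}}\to M(\pi,\mathrm{SL}_2)$. For the free group $F_2=\langle a,b\rangle$ one has $M(F_2,\mathrm{SL}_2)\cong\mathbb{A}^3_{x,y,z}$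 over $\mathbb{Z}$, with $x=\mathrm{tr}\,\rho(a)$, $y=\mathrm{tr}\,\rho(b)$, $z=\mathrm{tr}\,\rho(ab)$; the surjection $F_2\to\pi$ makes $M(\pi,\mathrm{SL}_2)$, and hence $M^{\mathrm{gen.irr}}(\pi,\mathrm{SL}_2)$, a closed subscheme of $\mathbb{A}^3_{x,y,z}$. Polynomials: $c_n(t),d_n(t)\in\mathbb{Z}[t]$ for $n\in\mathbb{Z}$ are defined by $c_0=0$, $d_0=1$, $c_{n+1}=tc_n+d_n$, $d_{n+1}=-c_n$. The subschemes: write $C_i=c_{n_i}(x)$, $D_i=d_{n_i}(x)$, $E_i=c_{m_i}(y)$, $F_i=d_{m_i}(y)$ for $i=1,2$, and define ideals of $\mathbb{Z}[x,y,z]$: $\wp_1^{e}=(C_1,C_2,D_1+1,D_2+1,E_1+E_2,yE_1+F_1-F_2)$, $\wp_2^{e}=(C_1,C_2,D_1+1,D_2-1,E_1-E_2,yE_1+F_1+F_2)$, $\wp_3^{e}=(C_1,C_2,D_1-1,D_2-1,E_1+E_2,yE_1+F_1-F_2)$, $\wp_4^{e}=(C_1,C_2,D_1-1,D_2+1,E_1-E_2,yE_1+F_1+F_2)$, $\wp_5^{e}=(E_1,E_2,F_1+1,F_2+1,C_1+C_2,xC_1+D_1-D_2)$, $\wp_6^{e}=(E_1,E_2,F_1+1,F_2-1,C_1-C_2,xC_1+D_1+D_2)$, $\wp_7^{e}=(E_1,E_2,F_1-1,F_2-1,C_1+C_2,xC_1+D_1-D_2)$, $\wp_8^{e}=(E_1,E_2,F_1-1,F_2+1,C_1-C_2,xC_1+D_1+D_2)$,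 $\wp_9^{e}=(C_1+C_2,D_1+D_2,E_1-E_2,F_1-F_2,\ zC_1E_1+xC_1F_1+yD_1E_1+2D_1F_1)$, $\wp_{10}^{e}=(C_1-C_2,D_1-D_2,E_1+E_2,F_1+F_2,\ zC_1E_1+xC_1F_1+yD_1E_1+2D_1F_1)$. Put $M_i=V(\wp_i^{e})\subset\mathbb{A}^3_{x,y,z}$ and $M_i^\circ=M_i\cap M^{\mathrm{gen.irr}}(\pi,\mathrm{SL}_2)$.
   Formalization: The closed immersion is of Spec Z[ζ+1/ζ, ζ_t+1/ζ_t, z]; Spec Z[ζ,ζ_t,z] only maps finitely. ζ_{2s}^s≠1 is required. t≠0 is assumed for M_9, s≠0 for M_10, both for π. "These inclusions" and "such z" range over all choices giving an immersion with Q-fiber in M^irr. *)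

theory Defs
  imports
    "HOL-Analysis.Analysis"
    "HOL-Library.Poly_Mapping"
    "HOL-Algebra.Algebraic_Closure_Type"
    "HOL-Algebra.Generated_Rings"
    "Berlekamp_Zassenhaus.Finite_Field"
begin

type_synonym 'v zpoly = "('v \<Rightarrow>\<^sub>0 nat) \<Rightarrow>\<^sub>0 int"

definition Var :: "'v \<Rightarrow> 'v zpoly" where
  "Var v = Poly_Mapping.single (Poly_Mapping.single v 1) 1"

definition eval :: "('v \<Rightarrow> 'a::comm_ring_1) \<Rightarrow> 'v zpoly \<Rightarrow> 'a" where
  "eval p f = (\<Sum>m\<in>Poly_Mapping.keys f. of_int (Poly_Mapping.lookup f m) *
                 (\<Prod>v\<in>Poly_Mapping.keys m. p v ^ Poly_Mapping.lookup m v))"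

abbreviation ideal_gen :: "'a::comm_ring_1 set \<Rightarrow> 'a set" where
  "ideal_gen S \<equiv> genideal ring_of_type_algebra S"

definition ker_eval :: "('v \<Rightarrow> 'a::comm_ring_1) \<Rightarrow> 'v zpoly set" where
  "ker_eval p = {f. eval p f = 0}"

text \<open>
  A closed subscheme \<open>V(I)\<close> of affine space over the integers is represented by its ideal \<open>I\<close>.
  The points of \<open>V(I)\<^sub>\<rat>\<close> are the primes that contain \<open>I\<close> and no nonzero integer; these
  are the primes of the localisation of the coordinate ring at the nonzero integers, with the
  same inclusions.
\<close>

definition fibre_Q :: "'v zpoly set \<Rightarrow> 'v zpoly set set" where
  "fibre_Q I = {P. primeideal P ring_of_type_algebra \<and> I \<subseteq> P \<and>
                   (\<forall>k::int. k \<noteq> 0 \<longrightarrow> of_int k \<notin> P)}"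

text \<open>The supremum of the empty set is \<open>-\<infinity>\<close>.\<close>

definition dim_Q :: "'v zpoly set \<Rightarrow> ereal" where
  "dim_Q I = Sup {ereal (real n) | n. \<exists>C :: nat \<Rightarrow> 'v zpoly set.
                    (\<forall>i\<le>n. C i \<in> fibre_Q I) \<and> (\<forall>i<n. C i \<subset> C (Suc i))}"

definition int_adjoin :: "complex set \<Rightarrow> complex set" where
  "int_adjoin S = generate_ring ring_of_type_algebra S"

text \<open>
  For a subring \<open>B\<close> of the complex numbers, a morphism from \<open>Spec B\<close> to \<open>V(I)\<close> is given by a
  point \<open>p\<close> with coordinates in \<open>B\<close> that annihilates \<open>I\<close>. It is a closed immersion when the
  coordinates generate \<open>B\<close>.
\<close>

definition Spec_morphism :: "complex set \<Rightarrow> 'v zpoly set \<Rightarrow> ('v \<Rightarrow> complex) \<Rightarrow> bool" where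
  "Spec_morphism B I p \<longleftrightarrow> range p \<subseteq> B \<and> I \<subseteq> ker_eval p"

definition Spec_closed_immersion :: "complex set \<Rightarrow> 'v zpoly set \<Rightarrow> ('v \<Rightarrow> complex) \<Rightarrow> bool" where
  "Spec_closed_immersion B I p \<longleftrightarrow> Spec_morphism B I p \<and> range (eval p) = B"

definition Spec_finite_morphism :: "complex set \<Rightarrow> 'v zpoly set \<Rightarrow> ('v \<Rightarrow> complex) \<Rightarrow> bool" where
  "Spec_finite_morphism B I p \<longleftrightarrow> Spec_morphism B I p \<and>
     (\<exists>S. finite S \<and> S \<subseteq> B \<and> B = {\<Sum>s\<in>S. eval p (a s) * s | a. True})"

datatype gen = Ga | Gb

text \<open>A letter \<open>(g, True)\<close> stands for \<open>g\<close> and \<open>(g, False)\<close> for the inverse of \<open>g\<close>.\<close>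

type_synonym word = "(gen \<times> bool) list"

definition gen_pow :: "gen \<Rightarrow> int \<Rightarrow> word" where
  "gen_pow g k = replicate (nat \<bar>k\<bar>) (g, k \<ge> 0)"

definition relator :: "int \<Rightarrow> int \<Rightarrow> int \<Rightarrow> int \<Rightarrow> word" where
  "relator n1 n2 m1 m2 = gen_pow Ga n1 @ gen_pow Gb m1 @ gen_pow Ga n2 @ gen_pow Gb m2"

inductive word_eq :: "word \<Rightarrow> word \<Rightarrow> word \<Rightarrow> bool" for r :: word where
  refl: "word_eq r u u"
| sym: "word_eq r u v \<Longrightarrow> word_eq r v u"
| trans: "word_eq r u v \<Longrightarrow> word_eq r v w \<Longrightarrow> word_eq r u w"
| cancel: "word_eq r (u @ [(g, e), (g, \<not> e)] @ v) (u @ v)"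
| relator: "word_eq r (u @ r @ v) (u @ v)"

definition word_class :: "word \<Rightarrow> word \<Rightarrow> word set" where
  "word_class r w = {u. word_eq r w u}"

definition pres_group :: "word \<Rightarrow> word set monoid" where
  "pres_group r = \<lparr> carrier = range (word_class r),
                    monoid.mult = (\<lambda>S T. \<Union>u\<in>S. \<Union>v\<in>T. word_class r (u @ v)),
                    one = word_class r [] \<rparr>"

definition SL2 :: "('a::comm_ring_1 ^ 2 ^ 2) monoid" where
  "SL2 = \<lparr> carrier = {M. det M = 1}, monoid.mult = (**), one = mat 1 \<rparr>"

definition GL2_over :: "'a::comm_ring_1 set \<Rightarrow> ('a ^ 2 ^ 2) monoid" where
  "GL2_over B = \<lparr> carrier = {M. (\<forall>i j. M $ i $ j \<in> B) \<and> (\<exists>u\<in>B. det M * u = 1)},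
                  monoid.mult = (**), one = mat 1 \<rparr>"

text \<open>Only used over algebraically closed fields, where it means absolute irreducibility.\<close>

definition irreducible_rep :: "'g monoid \<Rightarrow> ('g \<Rightarrow> 'k::field ^ 2 ^ 2) \<Rightarrow> bool" where
  "irreducible_rep G \<rho> \<longleftrightarrow>
     (\<forall>W. vec.subspace W \<and> (\<forall>g\<in>carrier G. \<forall>w\<in>W. \<rho> g *v w \<in> W) \<longrightarrow> W = {0} \<or> W = UNIV)"

definition irr_SL2_reps :: "word \<Rightarrow> (word set \<Rightarrow> complex ^ 2 ^ 2) set" where
  "irr_SL2_reps r = {\<rho> \<in> hom (pres_group r) SL2. irreducible_rep (pres_group r) \<rho>}"

definition adj2 :: "'a::comm_ring_1 ^ 2 ^ 2 \<Rightarrow> 'a ^ 2 ^ 2" where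
  "adj2 M = vector [vector [M $ 2 $ 2, - M $ 1 $ 2], vector [- M $ 2 $ 1, M $ 1 $ 1]]"

fun word_mat :: "(gen \<Rightarrow> 'a::comm_ring_1 ^ 2 ^ 2) \<Rightarrow> word \<Rightarrow> 'a ^ 2 ^ 2" where
  "word_mat M [] = mat 1"
| "word_mat M ((g, e) # w) = (if e then M g else adj2 (M g)) ** word_mat M w"

text \<open>
  The scheme of homomorphisms to \<open>SL\<^sub>2\<close> is \<open>V(hom_ideal r)\<close> in the affine space
  of pairs of matrices: both matrices have determinant 1 (so the inverse is the adjugate) and
  satisfy the relation.
\<close>

type_synonym matvar = "gen \<times> 2 \<times> 2"

definition generic_mat :: "gen \<Rightarrow> (matvar zpoly) ^ 2 ^ 2" where
  "generic_mat g = (\<chi> i j. Var (g, i, j))"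

definition hom_ideal :: "word \<Rightarrow> matvar zpoly set" where
  "hom_ideal r = ideal_gen
     ({det (generic_mat g) - 1 | g. True} \<union>
      {word_mat generic_mat r $ i $ j - mat 1 $ i $ j | i j. True})"

datatype xyz = Vx | Vy | Vz

definition trace_coords :: "(gen \<Rightarrow> 'a::comm_ring_1 ^ 2 ^ 2) \<Rightarrow> xyz \<Rightarrow> 'a" where
  "trace_coords M v = (case v of Vx \<Rightarrow> trace (M Ga) | Vy \<Rightarrow> trace (M Gb) | Vz \<Rightarrow> trace (M Ga ** M Gb))"

definition rep_mats :: "word \<Rightarrow> (word set \<Rightarrow> 'a ^ 2 ^ 2) \<Rightarrow> gen \<Rightarrow> 'a ^ 2 ^ 2" where
  "rep_mats r \<rho> g = \<rho> (word_class r [(g, True)])"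

text \<open>
  The ideal of \<open>M\<^sup>g\<^sup>e\<^sup>n\<^sup>.\<^sup>i\<^sup>r\<^sup>r\<close> in \<open>\<int>[x,y,z]\<close>. The scheme-theoretic image of
  \<open>M\<^sup>i\<^sup>r\<^sup>r\<^sub>\<rat>\<close> is cut out by the kernel of the map from \<open>\<int>[x,y,z]\<close> to the global functions on
  \<open>M\<^sup>i\<^sup>r\<^sup>r\<^sub>\<rat>\<close>, and these are the conjugation-invariant functions on the open subscheme
  \<open>Hom\<^sup>i\<^sup>r\<^sup>r\<^sub>\<rat>\<close>. So \<open>f\<close> is in the ideal iff its pullback to \<open>Hom\<^sup>i\<^sup>r\<^sup>r\<^sub>\<rat>\<close> is zero, that is,
  iff it is zero in the local ring at each point. The local ring at the image of a complex point \<open>\<rho>\<close>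
  inverts all \<open>g\<close> with \<open>g(\<rho>) \<noteq> 0\<close>, in particular all nonzero integers. All points of
  \<open>Hom\<^sub>\<rat>\<close> are images of complex points, because their residue fields are countable
  of characteristic 0.
\<close>

definition gen_irr_ideal :: "word \<Rightarrow> xyz zpoly set" where
  "gen_irr_ideal r = {f. \<forall>\<rho>\<in>irr_SL2_reps r. \<exists>g.
      eval (\<lambda>(s, i, j). rep_mats r \<rho> s $ i $ j) g \<noteq> 0 \<and>
      g * eval (trace_coords generic_mat) f \<in> hom_ideal r}"

text \<open>
  The points of \<open>M\<^sup>i\<^sup>r\<^sup>r\<^sub>\<rat>\<close> in the affine space with coordinates \<open>x,y,z\<close>: the quotient map
  from \<open>Hom\<^sup>i\<^sup>r\<^sup>r\<^sub>\<rat>\<close> is surjective.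
\<close>

definition M_irr_Q :: "word \<Rightarrow> xyz zpoly set set" where
  "M_irr_Q r = {ker_eval (trace_coords (rep_mats r \<rho>)) | \<rho>. \<rho> \<in> irr_SL2_reps r}"

text \<open>
  The pair of values at \<open>t\<close> of \<open>c\<^sub>n\<close> and \<open>d\<^sub>n\<close>, obtained by iterating the recursion
  forwards or backwards.
\<close>

definition cd :: "int \<Rightarrow> 'a::comm_ring_1 \<Rightarrow> 'a \<times> 'a" where
  "cd n t = (if n \<ge> 0 then ((\<lambda>(c, d). (t * c + d, - c)) ^^ nat n) (0, 1)
             else ((\<lambda>(c, d). (- d, c + t * d)) ^^ nat (- n)) (0, 1))"

definition cpol :: "int \<Rightarrow> 'a::comm_ring_1 \<Rightarrow> 'a" where "cpol n t = fst (cd n t)"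
definition dpol :: "int \<Rightarrow> 'a::comm_ring_1 \<Rightarrow> 'a" where "dpol n t = snd (cd n t)"

lemma cpol_0: "cpol 0 t = 0" and dpol_0: "dpol 0 t = 1"
  by (simp_all add: cpol_def dpol_def cd_def)

lemma cd_Suc: "cd (n + 1) t = (\<lambda>(c, d). (t * c + d, - c)) (cd n t)"
proof (cases "n \<ge> 0")
  case True
  then show ?thesis by (simp add: cd_def nat_add_distrib)
next
  case False
  define k where "k = nat (- (n + 1))"
  have n: "nat (- n) = Suc k" "nat (-1 - n) = k" "n + 1 = - int k"
    using False by (auto simp: k_def)
  have "cd (n + 1) t = ((\<lambda>(c, d). (- d, c + t * d)) ^^ k) (0, 1)"
    using False by (cases "k = 0") (auto simp: cd_def n)
  moreover have "cd n t = (\<lambda>(c, d). (- d, c + t * d)) (((\<lambda>(c, d). (- d, c + t * d)) ^^ k) (0, 1))"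
    using False by (simp add: cd_def n)
  ultimately show ?thesis by (simp add: case_prod_unfold)
qed

lemma cpol_rec: "cpol (n + 1) t = t * cpol n t + dpol n t"
  and dpol_rec: "dpol (n + 1) t = - cpol n t"
  by (simp_all add: cpol_def dpol_def cd_Suc case_prod_unfold)

text \<open>Only meaningful for \<open>1 \<le> i \<le> 10\<close>.\<close>

definition wp_gens :: "int \<Rightarrow> int \<Rightarrow> int \<Rightarrow> int \<Rightarrow> nat \<Rightarrow> xyz zpoly set" where
  "wp_gens n1 n2 m1 m2 i =
    (let x = Var Vx; y = Var Vy; z = Var Vz;
         C1 = cpol n1 x; C2 = cpol n2 x; D1 = dpol n1 x; D2 = dpol n2 x;
         E1 = cpol m1 y; E2 = cpol m2 y; F1 = dpol m1 y; F2 = dpol m2 y;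
         T = z * C1 * E1 + x * C1 * F1 + y * D1 * E1 + 2 * D1 * F1
     in [{C1, C2, D1 + 1, D2 + 1, E1 + E2, y * E1 + F1 - F2},
         {C1, C2, D1 + 1, D2 - 1, E1 - E2, y * E1 + F1 + F2},
         {C1, C2, D1 - 1, D2 - 1, E1 + E2, y * E1 + F1 - F2},
         {C1, C2, D1 - 1, D2 + 1, E1 - E2, y * E1 + F1 + F2},
         {E1, E2, F1 + 1, F2 + 1, C1 + C2, x * C1 + D1 - D2},
         {E1, E2, F1 + 1, F2 - 1, C1 - C2, x * C1 + D1 + D2},
         {E1, E2, F1 - 1, F2 - 1, C1 + C2, x * C1 + D1 - D2},
         {E1, E2, F1 - 1, F2 + 1, C1 - C2, x * C1 + D1 + D2},
         {C1 + C2, D1 + D2, E1 - E2, F1 - F2, T},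
         {C1 - C2, D1 - D2, E1 + E2, F1 + F2, T}] ! (i - 1))"

text \<open>The intersection of closed subschemes corresponds to the sum of their ideals.\<close>

definition M_circ :: "int \<Rightarrow> int \<Rightarrow> int \<Rightarrow> int \<Rightarrow> nat \<Rightarrow> xyz zpoly set" where
  "M_circ n1 n2 m1 m2 i =
     ideal_gen (wp_gens n1 n2 m1 m2 i \<union> gen_irr_ideal (relator n1 n2 m1 m2))"

text \<open>
  Writing \<open>s = n1 - n2\<close> and \<open>t = m1 - m2\<close>: \<open>\<zeta>\<close> is a \<open>2s\<close>-th root of unity with
  \<open>\<zeta>\<^sup>s = -1\<close> (not \<open>\<zeta>\<^sup>s = 1\<close>: on \<open>M\<^sub>9\<close> the \<open>n1\<close>-th and \<open>n2\<close>-th powers of the first matrix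
  are negatives of each other), \<open>\<eta>\<close> is a \<open>t\<close>-th root of unity, and the denominators of
  \<open>z_value\<close> do not vanish.
\<close>

definition root_choice :: "int \<Rightarrow> int \<Rightarrow> int \<Rightarrow> int \<Rightarrow> complex \<Rightarrow> complex \<Rightarrow> bool" where
  "root_choice n1 n2 m1 m2 \<zeta> \<eta> \<longleftrightarrow>
     \<zeta> powi (2 * (n1 - n2)) = 1 \<and> \<zeta> powi (n1 - n2) \<noteq> 1 \<and> \<eta> powi (m1 - m2) = 1 \<and>
     \<zeta> \<notin> {1, -1} \<and> \<eta> \<notin> {1, -1} \<and>
     \<zeta> powi n1 - \<zeta> powi (- n1) \<noteq> 0 \<and> \<eta> powi m1 - \<eta> powi (- m1) \<noteq> 0"

definition z_value :: "int \<Rightarrow> int \<Rightarrow> complex \<Rightarrow> complex \<Rightarrow> complex" where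
  "z_value n1 m1 \<zeta> \<eta> =
     (\<zeta> powi (n1 + 1) - \<zeta> powi (- (n1 + 1))) / (\<zeta> powi n1 - \<zeta> powi (- n1)) *
     ((\<eta> powi (m1 - 1) - \<eta> powi (- (m1 - 1))) / (\<eta> powi m1 - \<eta> powi (- m1))) +
     (\<eta> powi (m1 + 1) - \<eta> powi (- (m1 + 1))) / (\<eta> powi m1 - \<eta> powi (- m1)) *
     ((\<zeta> powi (n1 - 1) - \<zeta> powi (- (n1 - 1))) / (\<zeta> powi n1 - \<zeta> powi (- n1)))"

definition trace_point :: "complex \<Rightarrow> complex \<Rightarrow> complex \<Rightarrow> xyz \<Rightarrow> complex" where
  "trace_point \<zeta> \<eta> z v = (case v of Vx \<Rightarrow> \<zeta> + inverse \<zeta> | Vy \<Rightarrow> \<eta> + inverse \<eta> | Vz \<Rightarrow> z)"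

text \<open>
  The point \<open>(\<zeta> + \<zeta>\<^sup>-\<^sup>1, \<eta> + \<eta>\<^sup>-\<^sup>1, z)\<close> defines a finite morphism from
  \<open>Spec \<int>[\<zeta>, \<eta>, z]\<close> to \<open>V(I)\<close> and a closed immersion of the spectrum of the subring generated
  by its coordinates. These have the same image. The larger ring itself is not generated by the
  coordinates: they are real, and \<open>\<zeta>\<close> is not.
\<close>

definition root_immersion ::
    "word \<Rightarrow> xyz zpoly set \<Rightarrow> complex \<Rightarrow> complex \<Rightarrow> complex \<Rightarrow> bool" where
  "root_immersion r I \<zeta> \<eta> z \<longleftrightarrow>
     Spec_finite_morphism (int_adjoin {\<zeta>, \<eta>, z}) I (trace_point \<zeta> \<eta> z) \<and>
     Spec_closed_immersion (int_adjoin {\<zeta> + inverse \<zeta>, \<eta> + inverse \<eta>, z}) I (trace_point \<zeta> \<eta> z) \<and>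
     fibre_Q (ker_eval (trace_point \<zeta> \<eta> z)) \<subseteq> M_irr_Q r"

definition immersions_9 :: "int \<Rightarrow> int \<Rightarrow> int \<Rightarrow> int \<Rightarrow> (complex \<times> complex) set" where
  "immersions_9 n1 n2 m1 m2 = {(\<zeta>, \<eta>). root_choice n1 n2 m1 m2 \<zeta> \<eta> \<and>
     root_immersion (relator n1 n2 m1 m2) (M_circ n1 n2 m1 m2 9) \<zeta> \<eta> (z_value n1 m1 \<zeta> \<eta>)}"

text \<open>
  After exchanging \<open>n\<close> and \<open>m\<close>, the \<open>2t\<close>-th root of unity \<open>\<eta>\<close> belongs to the
  second generator and the \<open>s\<close>-th root of unity \<open>\<zeta>\<close> to the first.
\<close>

definition immersions_10 :: "int \<Rightarrow> int \<Rightarrow> int \<Rightarrow> int \<Rightarrow> (complex \<times> complex) set" where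
  "immersions_10 n1 n2 m1 m2 = {(\<zeta>, \<eta>). root_choice m1 m2 n1 n2 \<eta> \<zeta> \<and>
     root_immersion (relator n1 n2 m1 m2) (M_circ n1 n2 m1 m2 10) \<zeta> \<eta> (z_value m1 n1 \<eta> \<zeta>)}"

text \<open>
  The prime \<open>\<ell>\<close> is the cardinality of a type. The \<open>\<ell>\<close>-adic integers are the coherent
  sequences of residues modulo \<open>\<ell>\<^sup>k\<close>.
\<close>

typedef ('p::prime_card) adic_int =
  "{f :: nat \<Rightarrow> int. \<forall>k. f k = f (Suc k) mod int CARD('p) ^ k}"
  by (rule exI[of _ "\<lambda>_. 0"]) simp

setup_lifting type_definition_adic_int

lemma mod_power_Suc_mod: "(a::int) mod q ^ Suc k mod q ^ k = a mod q ^ k"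
  by (rule mod_mod_cancel) simp

lemma coherent_ops:
  fixes a b c d q :: int
  assumes "a = c mod q ^ k" "b = d mod q ^ k"
  shows "(a + b) mod q ^ k = (c + d) mod q ^ Suc k mod q ^ k"
    and "(a - b) mod q ^ k = (c - d) mod q ^ Suc k mod q ^ k"
    and "(a * b) mod q ^ k = (c * d) mod q ^ Suc k mod q ^ k"
    and "(- a) mod q ^ k = (- c) mod q ^ Suc k mod q ^ k"
    and "a mod q ^ k = a"
  unfolding assms mod_power_Suc_mod by (simp_all only: mod_simps mod_mod_trivial)

instantiation adic_int :: (prime_card) comm_ring
begin

lift_definition zero_adic_int :: "'a adic_int" is "\<lambda>_. 0" by simp

lift_definition plus_adic_int :: "'a adic_int \<Rightarrow> 'a adic_int \<Rightarrow> 'a adic_int"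
  is "\<lambda>f g k. (f k + g k) mod int CARD('a) ^ k"
  by (rule coherent_ops(1); blast)

lift_definition uminus_adic_int :: "'a adic_int \<Rightarrow> 'a adic_int"
  is "\<lambda>f k. (- f k) mod int CARD('a) ^ k"
  by (rule coherent_ops(4); blast)

lift_definition minus_adic_int :: "'a adic_int \<Rightarrow> 'a adic_int \<Rightarrow> 'a adic_int"
  is "\<lambda>f g k. (f k - g k) mod int CARD('a) ^ k"
  by (rule coherent_ops(2); blast)

lift_definition times_adic_int :: "'a adic_int \<Rightarrow> 'a adic_int \<Rightarrow> 'a adic_int"
  is "\<lambda>f g k. (f k * g k) mod int CARD('a) ^ k"
  by (rule coherent_ops(3); blast)

instance
proof
  fix a b c :: "'a adic_int"
  show "a * b * c = a * (b * c)"
    by transfer (simp (no_asm) add: mod_simps mult.assoc)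
  show "a * b = b * a"
    by transfer (simp (no_asm) add: mult.commute)
  show "a + b + c = a + (b + c)"
    by transfer (simp (no_asm) add: mod_simps add.assoc)
  show "a + b = b + a"
    by transfer (simp (no_asm) add: add.commute)
  show "0 + a = a"
  proof transfer
    fix f :: "nat \<Rightarrow> int" assume "\<forall>k. f k = f (Suc k) mod int CARD('a) ^ k"
    then have "f k mod int CARD('a) ^ k = f k" for k
      by (intro coherent_ops(5)) (erule spec)+
    then show "(\<lambda>k. (0 + f k) mod int CARD('a) ^ k) = f" by simp
  qed
  show "- a + a = 0"
    by transfer (simp (no_asm) add: mod_simps)
  show "a - b = a + - b"
    by transfer (simp (no_asm) add: mod_simps)
  show "(a + b) * c = a * c + b * c"
    by transfer (simp (no_asm) add: mod_simps distrib_right)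
qed

end

lemma adic_prime: "Factorial_Ring.prime (int CARD('a::prime_card))"
  using prime_card[where 'a = 'a] by simp

lemma adic_mod_mono:
  assumes "\<forall>k. f k = f (Suc k) mod (q::int) ^ k"
  shows "f (k + j) mod q ^ k = f k"
proof (induction j)
  case 0
  show ?case by (metis add.right_neutral assms mod_mod_trivial)
next
  case (Suc j)
  have "q ^ k dvd q ^ (k + j)" by (simp add: le_imp_power_dvd)
  then have "f (k + Suc j) mod q ^ (k + j) mod q ^ k = f (k + Suc j) mod q ^ k"
    by (rule mod_mod_cancel)
  then show ?case using Suc assms by (metis add_Suc_right)
qed

instantiation adic_int :: (prime_card) idom
begin

lift_definition one_adic_int :: "'a adic_int" is "\<lambda>k. 1 mod int CARD('a) ^ k"
  by (simp only: mod_power_Suc_mod simp_thms)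

instance
proof
  fix a b :: "'a adic_int"
  show "1 * a = a"
  proof transfer
    fix f :: "nat \<Rightarrow> int" assume "\<forall>k. f k = f (Suc k) mod int CARD('a) ^ k"
    then have "f k mod int CARD('a) ^ k = f k" for k
      by (intro coherent_ops(5)) (erule spec)+
    then show "(\<lambda>k. (1 mod int CARD('a) ^ k * f k) mod int CARD('a) ^ k) = f"
      by (simp add: mod_simps)
  qed
  show "(0::'a adic_int) \<noteq> 1"
  proof transfer
    have "int CARD('a) > 1" using adic_prime[where 'a = 'a] prime_gt_1_int by blast
    then show "(\<lambda>_. 0) \<noteq> (\<lambda>k. 1 mod int CARD('a) ^ k)"
      by (auto simp: fun_eq_iff intro!: exI[of _ 1])
  qed
  show "a \<noteq> 0 \<Longrightarrow> b \<noteq> 0 \<Longrightarrow> a * b \<noteq> 0"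
  proof transfer
    fix f g :: "nat \<Rightarrow> int"
    define q where "q = int CARD('a)"
    assume f: "\<forall>k. f k = f (Suc k) mod int CARD('a) ^ k" and f0: "f \<noteq> (\<lambda>_. 0)"
      and g: "\<forall>k. g k = g (Suc k) mod int CARD('a) ^ k" and g0: "g \<noteq> (\<lambda>_. 0)"
    obtain i j where ij: "f i \<noteq> 0" "g j \<noteq> 0" using f0 g0 by (auto simp: fun_eq_iff)
    have q: "Factorial_Ring.prime q" unfolding q_def by (rule adic_prime)
    have "\<not> q ^ i dvd f (i + j)" "\<not> q ^ j dvd g (i + j)"
      using ij adic_mod_mono[OF f, of i j] adic_mod_mono[OF g, of j i]
      by (auto simp: q_def dvd_eq_mod_eq_0 add.commute)
    then have nz: "f (i + j) \<noteq> 0" "g (i + j) \<noteq> 0"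
      and m: "multiplicity q (f (i + j)) < i" "multiplicity q (g (i + j)) < j"
      using multiplicity_dvd' by (force, force, (meson not_le)+)
    have "multiplicity q (f (i + j) * g (i + j)) < i + j"
      using m nz q by (subst prime_elem_multiplicity_mult_distrib) (auto intro: prime_imp_prime_elem)
    then have "\<not> q ^ (i + j) dvd f (i + j) * g (i + j)"
      using nz q by (subst power_dvd_iff_le_multiplicity) (auto simp: not_prime_unit)
    then show "(\<lambda>k. f k * g k mod int CARD('a) ^ k) \<noteq> (\<lambda>_. 0)"
      by (auto simp: fun_eq_iff q_def dvd_eq_mod_eq_0)
  qed
qed

end

type_synonym 'p adic_closure = "'p adic_int fract alg_closure"

definition adic_embed :: "'p::prime_card adic_int \<Rightarrow> 'p adic_closure" where
  "adic_embed a = to_ac (Fract a 1)"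

definition adic_integers :: "'p::prime_card adic_closure set" where
  "adic_integers = {u. \<exists>f :: 'p adic_int poly. Polynomial.lead_coeff f = 1 \<and> poly (map_poly adic_embed f) u = 0}"

definition has_adic_integral_point :: "'p::prime_card itself \<Rightarrow> 'v zpoly set \<Rightarrow> bool" where
  "has_adic_integral_point _ I \<longleftrightarrow>
     (\<exists>p :: 'v \<Rightarrow> 'p adic_closure. range p \<subseteq> adic_integers \<and> I \<subseteq> ker_eval p)"

definition weakly_integral_2_1 :: "'p::prime_card itself \<Rightarrow> 'g monoid \<Rightarrow> bool" where
  "weakly_integral_2_1 _ G \<longleftrightarrow>
     (\<exists>\<rho> \<in> hom G (GL2_over (adic_integers :: 'p adic_closure set)).
        (\<forall>g\<in>carrier G. det (\<rho> g) = 1) \<and> irreducible_rep G \<rho>)"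

text \<open>Normalised valuations on the field of algebraic numbers; values elsewhere are irrelevant.\<close>

definition adic_valuation :: "nat \<Rightarrow> (complex \<Rightarrow> ereal) \<Rightarrow> bool" where
  "adic_valuation l v \<longleftrightarrow>
     (\<forall>u. algebraic u \<longrightarrow> v u \<noteq> -\<infinity> \<and> (v u = \<infinity> \<longleftrightarrow> u = 0)) \<and>
     (\<forall>u w. algebraic u \<and> algebraic w \<longrightarrow>
        v (u * w) = v u + v w \<and> v (u + w) \<ge> min (v u) (v w)) \<and>
     v (of_nat l) = 1"

end

theory Submission
  imports "Jordan_Normal_Form.Char_Poly" "Subresultants.Subresultant_Gcd" Defs
begin

text \<open>
  Let \<open>A\<close> and \<open>B\<close> be the images of the generators under a representation with determinant 1 over an
  algebraically closed field of characteristic 0, and \<open>x, y, z\<close> the traces of \<open>A\<close>, \<open>B\<close>, \<open>AB\<close>. The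
  representation is irreducible iff \<open>det (AB - BA) = 4 + xyz - x\<^sup>2 - y\<^sup>2 - z\<^sup>2\<close> is nonzero, and then
  \<open>1, A, B, AB\<close> are linearly independent. By Cayley-Hamilton the relation, written as an equation
  between \<open>A\<^bsup>n1\<^esup> B\<^bsup>m1\<^esup>\<close> and the inverse of \<open>A\<^bsup>n2\<^esup> B\<^bsup>m2\<^esup>\<close>, is a linear relation between these four matrices, so its
  coefficients, which are polynomials in \<open>x, y, z\<close>, vanish. Since one of \<open>n1 + n2\<close> and \<open>m1 + m2\<close> is
  \<open>\<plusminus>1\<close>, they leave two possibilities, for \<open>e = 1\<close> and \<open>e = -1\<close>: \<open>A\<^bsup>n1\<^esup> = -e A\<^bsup>n2\<^esup>\<close>, \<open>B\<^bsup>m1\<^esup> = e B\<^bsup>m2\<^esup>\<close>, and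
  \<open>A\<^bsup>n1\<^esup> B\<^bsup>m1\<^esup>\<close> has trace 0 (\<open>relation_types\<close>). These are the families \<open>M\<^sub>9\<close> and \<open>M\<^sub>1\<^sub>0\<close>; in each of the other
  eight, \<open>A\<^bsup>n1+n2\<^esup>\<close> and \<open>B\<^bsup>m1+m2\<^esup>\<close> would both be central (\<open>fibre_1_to_8_empty\<close>).

  In a family, the eigenvalues \<open>\<zeta>\<close> of \<open>A\<close> and \<open>\<eta>\<close> of \<open>B\<close> are roots of unity, and the trace condition is
  linear in \<open>z\<close> with solution \<open>z_value\<close>. So over the rationals there are finitely many points, all
  algebraic (\<open>prime_is_type_point\<close>). Some of them may be reducible. The equations of the family hold not
  only at the irreducible representations but in their local rings, and the finitely many points
  are isolated; so a suitable polynomial separates each reducible point from the closure of the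
  irreducible ones (\<open>gen_irr_excludes_reducible\<close>). The irreducible points come from explicit
  triangular matrices (\<open>irreducible_point_immersion\<close>), and a point whose \<open>z\<close> is not an algebraic integer is
  irreducible, because \<open>z\<close> is \<open>\<zeta>\<eta> + 1/(\<zeta>\<eta>)\<close> or \<open>\<zeta>/\<eta> + \<eta>/\<zeta>\<close> at the reducible ones (\<open>nonintegral_irreducible\<close>).

  An \<open>l\<close>-adic valuation with \<open>v z \<ge> 0\<close> exists iff \<open>l\<close> is not a unit in \<open>\<int>[z]\<close> (\<open>adic_valuation_iff\<close>). In that
  case Hensel's lemma provides a conjugate of \<open>z\<close> that is integral over the \<open>l\<close>-adic integers, and the
  other coordinates of the conjugate point are sums of roots of unity (\<open>conjugate_integral_point\<close>).
  Conversely an integral point satisfies the same equations as some \<open>(x, y, z)\<close>, and would make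
  \<open>1/l\<close> integral if \<open>l\<close> were a unit in \<open>\<int>[z]\<close> (\<open>adic_points_iff\<close>). An integral point lifts to an integral
  representation, because the triangular matrices have entries in the ring generated by \<open>z\<close> and by the
  eigenvalues and their inverses, which are integral over the traces (\<open>weakly_integral_iff\<close>).
\<close>

no_notation Matrix.vec_index (infixl \<open>$\<close> 100)
no_notation fps_nth (infixl \<open>$\<close> 75)

section \<open>Evaluation of integer polynomials\<close>

definition monomial_at :: "('v \<Rightarrow> 'a::comm_ring_1) \<Rightarrow> ('v \<Rightarrow>\<^sub>0 nat) \<Rightarrow> 'a" where
  "monomial_at p m = (\<Prod>v\<in>Poly_Mapping.keys m. p v ^ Poly_Mapping.lookup m v)"

lemma monomial_at_superset:
  "finite S \<Longrightarrow> Poly_Mapping.keys m \<subseteq> S \<Longrightarrow> monomial_at p m = (\<Prod>v\<in>S. p v ^ Poly_Mapping.lookup m v)"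
  unfolding monomial_at_def
  by (rule prod.mono_neutral_left) (auto simp: in_keys_iff)

lemma monomial_at_0: "monomial_at p 0 = 1"
  by (simp add: monomial_at_def)

lemma monomial_at_add: "monomial_at p (m + n) = monomial_at p m * monomial_at p n"
proof -
  define S where "S = Poly_Mapping.keys m \<union> Poly_Mapping.keys n"
  have "Poly_Mapping.keys (m + n) \<subseteq> S" unfolding S_def by (rule keys_add)
  then show ?thesis
    using monomial_at_superset[of S "m + n" p] monomial_at_superset[of S m p]
      monomial_at_superset[of S n p]
    by (auto simp: S_def lookup_add power_add prod.distrib)
qed

lemma eval_superset:
  "finite S \<Longrightarrow> Poly_Mapping.keys f \<subseteq> S \<Longrightarrow>
     eval p f = (\<Sum>m\<in>S. of_int (Poly_Mapping.lookup f m) * monomial_at p m)"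
  unfolding eval_def monomial_at_def
  by (rule sum.mono_neutral_left) (auto simp: in_keys_iff)

lemma eval_add: "eval p (f + g) = eval p f + eval p g"
proof -
  define S where "S = Poly_Mapping.keys f \<union> Poly_Mapping.keys g"
  have "Poly_Mapping.keys (f + g) \<subseteq> S" unfolding S_def by (rule keys_add)
  then show ?thesis
    using eval_superset[of S "f + g" p] eval_superset[of S f p] eval_superset[of S g p]
    by (auto simp: S_def lookup_add sum.distrib distrib_right)
qed

lemma eval_0: "eval p 0 = 0"
  by (simp add: eval_def)

lemma eval_single: "eval p (Poly_Mapping.single m c) = of_int c * monomial_at p m"
  by (subst eval_superset[of "{m}"]) (auto simp: keys_single)

lemma poly_mapping_sum_singles:
  "f = (\<Sum>m\<in>Poly_Mapping.keys f. Poly_Mapping.single m (Poly_Mapping.lookup f m))"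
  by (rule poly_mapping_eqI) (auto simp: lookup_sum lookup_single when_def in_keys_iff)

lemma eval_sum: "eval p (sum F A) = (\<Sum>a\<in>A. eval p (F a))"
  by (induction A rule: infinite_finite_induct) (auto simp: eval_0 eval_add)

lemma eval_mult: "eval p (f * g) = eval p f * eval p g"
proof -
  have "f * g = (\<Sum>m\<in>Poly_Mapping.keys f. \<Sum>n\<in>Poly_Mapping.keys g.
      Poly_Mapping.single (m + n) (Poly_Mapping.lookup f m * Poly_Mapping.lookup g n))"
    by (subst (1) poly_mapping_sum_singles[of f], subst (1) poly_mapping_sum_singles[of g])
      (simp add: sum_product mult_single)
  moreover have "eval p f = (\<Sum>m\<in>Poly_Mapping.keys f. of_int (Poly_Mapping.lookup f m) * monomial_at p m)"
    "eval p g = (\<Sum>m\<in>Poly_Mapping.keys g. of_int (Poly_Mapping.lookup g m) * monomial_at p m)"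
    by (auto simp: eval_def monomial_at_def)
  ultimately show ?thesis
    by (simp add: eval_sum eval_single sum_product monomial_at_add mult_ac)
qed

lemma eval_1: "eval p 1 = 1"
  using eval_single[of p 0 1] by (simp add: monomial_at_0)

interpretation eval_hom: comm_ring_hom "eval p"
  by unfold_locales (auto simp: eval_0 eval_1 eval_add eval_mult)

lemma eval_Var: "eval p (Var v) = p v"
  by (simp add: Var_def eval_single monomial_at_def keys_single)

text \<open>Evaluating at the variables themselves is the identity, so a polynomial is built from
  integers and variables by the ring operations.\<close>

lemma eval_Var_id: "eval Var f = f"
proof -
  have pow: "(Var v :: 'a zpoly) ^ k = Poly_Mapping.single (Poly_Mapping.single v k) 1" for v k
    by (induction k) (auto simp: Var_def mult_single single_add[symmetric])
  have m: "monomial_at Var m = Poly_Mapping.single m (1::int)" for m :: "'a \<Rightarrow>\<^sub>0 nat"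
  proof -
    have "(\<Prod>v\<in>S. (Var v :: 'a zpoly) ^ Poly_Mapping.lookup m v) =
       Poly_Mapping.single (\<Sum>v\<in>S. Poly_Mapping.single v (Poly_Mapping.lookup m v)) 1" if "finite S" for S
      using that by (induction S) (auto simp: pow mult_single)
    then show ?thesis
      by (simp add: monomial_at_def poly_mapping_sum_singles[symmetric])
  qed
  have "of_int c = (Poly_Mapping.single 0 c :: 'a zpoly)" for c
    by (subst single_of_int[symmetric]) simp
  then have "of_int c * Poly_Mapping.single m (1::int) = Poly_Mapping.single m c" for c and m :: "'a \<Rightarrow>\<^sub>0 nat"
    by (simp add: mult_single del: single_of_int)
  then have "eval Var f = (\<Sum>m\<in>Poly_Mapping.keys f. Poly_Mapping.single m (Poly_Mapping.lookup f m))"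
    by (simp add: eval_superset[OF finite_keys order_refl] m)
  then show ?thesis by (simp add: poly_mapping_sum_singles[symmetric])
qed

lemma (in comm_ring_hom) hom_monomial_at: "hom (monomial_at p m) = monomial_at (\<lambda>v. hom (p v)) m"
  by (simp add: monomial_at_def hom_prod hom_power)

lemma (in comm_ring_hom) hom_eval: "hom (eval p f) = eval (\<lambda>v. hom (p v)) f"
  by (simp add: eval_superset[OF finite_keys order_refl] hom_sum hom_mult hom_monomial_at hom_of_int)

lemma zpoly_induct [case_names int Var add mult]:
  assumes int: "\<And>k. P (of_int k)" and Var: "\<And>v. P (Var v)"
    and add: "\<And>f g. P f \<Longrightarrow> P g \<Longrightarrow> P (f + g)" and mult: "\<And>f g. P f \<Longrightarrow> P g \<Longrightarrow> P (f * g)"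
  shows "P f"
proof -
  have pow: "P (Var v ^ k)" for v k
    by (induction k) (use int[of 1] Var mult in auto)
  have "P (\<Prod>v\<in>S. Var v ^ Poly_Mapping.lookup m v)" for m S
    by (induction S rule: infinite_finite_induct) (use int[of 1] pow mult in auto)
  then have "P (of_int c * monomial_at Var m)" for c m
    unfolding monomial_at_def by (intro mult int)
  then have "P (\<Sum>m\<in>S. of_int (c m) * monomial_at Var m)" for c and S
    by (induction S rule: infinite_finite_induct) (use int[of 0] add in auto)
  then have "P (eval Var f)" by (simp add: eval_superset[OF finite_keys order_refl])
  then show ?thesis by (simp add: eval_Var_id)
qed

section \<open>Ideals\<close>

definition is_ideal :: "'a::comm_ring_1 set \<Rightarrow> bool" where
  "is_ideal I \<longleftrightarrow> 0 \<in> I \<and> (\<forall>a\<in>I. \<forall>b\<in>I. a + b \<in> I) \<and> (\<forall>a\<in>I. \<forall>r. r * a \<in> I)"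

definition is_prime :: "'a::comm_ring_1 set \<Rightarrow> bool" where
  "is_prime P \<longleftrightarrow> is_ideal P \<and> 1 \<notin> P \<and> (\<forall>a b. a * b \<in> P \<longrightarrow> a \<in> P \<or> b \<in> P)"

lemma is_idealD:
  assumes "is_ideal I"
  shows ideal_zero: "0 \<in> I" and ideal_add: "a \<in> I \<Longrightarrow> b \<in> I \<Longrightarrow> a + b \<in> I"
    and ideal_mult_l: "a \<in> I \<Longrightarrow> r * a \<in> I" and ideal_mult_r: "a \<in> I \<Longrightarrow> a * r \<in> I"
    and ideal_uminus: "a \<in> I \<Longrightarrow> - a \<in> I" and ideal_diff: "a \<in> I \<Longrightarrow> b \<in> I \<Longrightarrow> a - b \<in> I"
proof -
  show 0: "0 \<in> I" and add: "a \<in> I \<Longrightarrow> b \<in> I \<Longrightarrow> a + b \<in> I" and m: "a \<in> I \<Longrightarrow> r * a \<in> I" for a b r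
    using assms by (auto simp: is_ideal_def)
  show "a \<in> I \<Longrightarrow> a * r \<in> I" for a r using m by (simp add: mult.commute)
  show um: "a \<in> I \<Longrightarrow> - a \<in> I" for a using m[of a "-1"] by simp
  show "a \<in> I \<Longrightarrow> b \<in> I \<Longrightarrow> a - b \<in> I" using add[of a "-b"] um[of b] by simp
qed

lemma ideal_sum: "is_ideal I \<Longrightarrow> (\<And>i. i \<in> A \<Longrightarrow> f i \<in> I) \<Longrightarrow> sum f A \<in> I"
  by (induction A rule: infinite_finite_induct) (auto intro: ideal_add ideal_zero)

lemma ideal_iff: "ideal I (ring_of_type_algebra :: 'a::comm_ring_1 ring) \<longleftrightarrow> is_ideal I"
proof
  assume "ideal I (ring_of_type_algebra :: 'a ring)"
  then interpret ideal I "ring_of_type_algebra :: 'a ring" .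
  show "is_ideal I"
    using additive_subgroup.zero_closed[OF additive_subgroup_axioms]
      additive_subgroup.a_closed[OF additive_subgroup_axioms] I_l_closed
    by (auto simp: is_ideal_def ring_of_type_algebra_def)
next
  assume I: "is_ideal I"
  have inv: "inv\<^bsub>add_monoid (ring_of_type_algebra :: 'a ring)\<^esub> a = - a" for a :: 'a
  proof -
    interpret ring "ring_of_type_algebra :: 'a ring" by (rule ring_from_type_algebra)
    show ?thesis
      unfolding a_inv_def[symmetric]
      by (rule minus_equality) (auto simp: ring_of_type_algebra_def)
  qed
  have "subgroup I (add_monoid (ring_of_type_algebra :: 'a ring))"
    by (rule subgroup.intro)
      (use I in \<open>auto simp: ring_of_type_algebra_def inv[unfolded ring_of_type_algebra_def, simplified]
        intro: ideal_add ideal_zero ideal_uminus\<close>)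
  then show "ideal I (ring_of_type_algebra :: 'a ring)"
    by (intro idealI ring_from_type_algebra)
      (use I in \<open>auto simp: ring_of_type_algebra_def intro: ideal_mult_l ideal_mult_r\<close>)
qed

lemma primeideal_iff: "primeideal P (ring_of_type_algebra :: 'a::comm_ring_1 ring) \<longleftrightarrow> is_prime P"
proof -
  have c: "carrier (ring_of_type_algebra :: 'a ring) = UNIV" "mult (ring_of_type_algebra :: 'a ring) = (*)"
    by (auto simp: ring_of_type_algebra_def)
  have u: "UNIV \<noteq> P \<longleftrightarrow> 1 \<notin> P" if "is_ideal P" for P :: "'a set"
    using ideal_mult_l[OF that, of 1] by auto
  show ?thesis
    unfolding primeideal_def primeideal_axioms_def is_prime_def ideal_iff c
    using u[of P] by (auto simp: cring_from_type_algebra simp del: UNIV_eq_I)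
qed

lemma ideal_gen_is_ideal: "is_ideal (ideal_gen S)"
  by (subst ideal_iff[symmetric], rule ring.genideal_ideal[OF ring_from_type_algebra])
    (simp add: ring_of_type_algebra_def)

lemma ideal_gen_superset: "S \<subseteq> ideal_gen (S :: 'a::comm_ring_1 set)"
  by (rule ring.genideal_self[OF ring_from_type_algebra]) (simp add: ring_of_type_algebra_def)

lemma ideal_gen_subset_iff: "is_ideal I \<Longrightarrow> ideal_gen S \<subseteq> I \<longleftrightarrow> S \<subseteq> I"
proof
  assume "is_ideal I" "S \<subseteq> I"
  then show "ideal_gen S \<subseteq> I"
    by (intro ring.genideal_minimal[OF ring_from_type_algebra]) (simp_all add: ideal_iff)
qed (use ideal_gen_superset in blast)

lemma is_primeD:
  assumes "is_prime P"
  shows prime_ideal: "is_ideal P" and prime_one: "1 \<notin> P"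
    and prime_mult: "a * b \<in> P \<longleftrightarrow> a \<in> P \<or> b \<in> P" and prime_power: "a ^ k \<in> P \<Longrightarrow> a \<in> P"
proof -
  show I: "is_ideal P" and 1: "1 \<notin> P" using assms by (auto simp: is_prime_def)
  show m: "a * b \<in> P \<longleftrightarrow> a \<in> P \<or> b \<in> P" for a b
    using assms ideal_mult_l[OF I] ideal_mult_r[OF I] by (auto simp: is_prime_def)
  show "a ^ k \<in> P \<Longrightarrow> a \<in> P" by (induction k) (auto simp: m 1)
qed

lemma prime_prod: "is_prime P \<Longrightarrow> (\<Prod>i\<in>A. f i) \<in> P \<Longrightarrow> \<exists>i\<in>A. f i \<in> P"
  by (induction A rule: infinite_finite_induct) (auto simp: prime_one prime_mult)

lemma is_ideal_vimage:
  assumes "comm_ring_hom \<phi>" "is_ideal I"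
  shows "is_ideal {f. \<phi> f \<in> I}"
proof -
  interpret comm_ring_hom \<phi> by fact
  show ?thesis using assms(2) by (auto simp: is_ideal_def hom_add hom_mult)
qed

lemma ker_eval_ideal: "is_ideal (ker_eval p)"
  by (auto simp: is_ideal_def ker_eval_def eval_hom.hom_zero eval_hom.hom_add eval_hom.hom_mult)

lemma ker_eval_prime: "is_prime (ker_eval (p :: 'v \<Rightarrow> 'a::idom))"
  by (auto simp: is_prime_def ker_eval_ideal) (auto simp: ker_eval_def eval_hom.hom_one eval_hom.hom_mult)

lemma fibre_Q_iff: "P \<in> fibre_Q I \<longleftrightarrow> is_prime P \<and> I \<subseteq> P \<and> (\<forall>k::int. k \<noteq> 0 \<longrightarrow> of_int k \<notin> P)"
  by (auto simp: fibre_Q_def primeideal_iff)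

lemma ker_eval_fibre: "I \<subseteq> ker_eval p \<Longrightarrow> ker_eval (p :: 'v \<Rightarrow> 'a::field_char_0) \<in> fibre_Q I"
  by (auto simp: fibre_Q_iff ker_eval_prime) (auto simp: ker_eval_def eval_hom.hom_of_int)

section \<open>The polynomials c and d\<close>

lemma cpol_rec': "cpol (n - 1) t = - dpol n t" and dpol_rec': "dpol (n - 1) t = cpol n t + t * dpol n t"
  using cpol_rec[of "n - 1" t] dpol_rec[of "n - 1" t] by (auto simp: algebra_simps)

lemma cpol_1: "cpol 1 t = 1" and dpol_1: "dpol 1 t = 0"
  using cpol_rec[of 0 t] dpol_rec[of 0 t] by (auto simp: cpol_0 dpol_0)

lemma cpol_m1: "cpol (-1) t = -1" and dpol_m1: "dpol (-1) t = t"
  using cpol_rec'[of 0 t] dpol_rec'[of 0 t] by (auto simp: cpol_0 dpol_0)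

lemma cd_add:
  "cpol (m + k) t = t * cpol m t * cpol k t + cpol m t * dpol k t + dpol m t * cpol k t \<and>
   dpol (m + k) t = dpol m t * dpol k t - cpol m t * cpol k t"
proof (induction k rule: int_induct[where k = 0])
  case base
  show ?case by (simp add: cpol_0 dpol_0)
next
  case (step1 k)
  show ?case
    by (simp only: add.assoc[symmetric] cpol_rec dpol_rec step1.IH[THEN conjunct1] step1.IH[THEN conjunct2])
      (simp add: algebra_simps)
next
  case (step2 k)
  have "m + (k - 1) = m + k - 1" by simp
  then show ?case
    by (simp only: cpol_rec' dpol_rec' step2.IH[THEN conjunct1] step2.IH[THEN conjunct2])
      (simp add: algebra_simps)
qed

lemmas cpol_add = cd_add[THEN conjunct1] and dpol_add = cd_add[THEN conjunct2]

lemma cd_uminus: "cpol (- n) t = - cpol n t \<and> dpol (- n) t = t * cpol n t + dpol n t"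
proof (induction n rule: int_induct[where k = 0])
  case base
  show ?case by (simp add: cpol_0 dpol_0)
next
  case (step1 n)
  have "- (n + 1) = - n - 1" by simp
  then show ?case using step1.IH by (simp only: cpol_rec dpol_rec cpol_rec' dpol_rec') (auto simp: algebra_simps)
next
  case (step2 n)
  have "- (n - 1) = - n + 1" by simp
  then show ?case using step2.IH by (simp only: cpol_rec dpol_rec cpol_rec' dpol_rec') (auto simp: algebra_simps)
qed

lemmas cpol_uminus = cd_uminus[THEN conjunct1] and dpol_uminus = cd_uminus[THEN conjunct2]

text \<open>If \<open>A\<close> has trace \<open>t\<close> and determinant 1, then \<open>A\<^sup>n = c\<^sub>n(t) A + d\<^sub>n(t)\<close>, and \<open>c\<^sup>2 + t c d + d\<^sup>2\<close> is the
  determinant of \<open>c A + d\<close>. In particular \<open>c\<^sub>n\<close> and \<open>d\<^sub>n\<close> have no common zero in any nonzero ring.\<close>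

lemma cd_norm: "cpol n t ^ 2 + t * cpol n t * dpol n t + dpol n t ^ 2 = 1"
  using dpol_add[of n "- n" t] by (simp add: cpol_uminus dpol_uminus dpol_0 power2_eq_square algebra_simps)

lemma cpol_diff: "cpol (m - k) t = cpol m t * dpol k t - dpol m t * cpol k t"
  and dpol_diff: "dpol (m - k) t = dpol m t * (t * cpol k t + dpol k t) + cpol m t * cpol k t"
  using cpol_add[of m "-k" t] dpol_add[of m "-k" t]
  by (simp_all add: cpol_uminus dpol_uminus algebra_simps)

lemma (in comm_ring_hom) hom_cd: "hom (cpol n t) = cpol n (hom t) \<and> hom (dpol n t) = dpol n (hom t)"
proof (induction n rule: int_induct[where k = 0])
  case base
  show ?case by (simp add: cpol_0 dpol_0)
qed (auto simp: cpol_rec dpol_rec cpol_rec' dpol_rec' hom_add hom_mult hom_uminus)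

lemmas (in comm_ring_hom) hom_cpol = hom_cd[THEN conjunct1] and hom_dpol = hom_cd[THEN conjunct2]

text \<open>The formula \<open>A\<^sup>n = c\<^sub>n(t) A + d\<^sub>n(t)\<close> applied to an eigenvector of \<open>A\<close>; the eigenvalues are \<open>u\<close> and \<open>1/u\<close>.\<close>

lemma powi_cd:
  fixes u :: "'a::field"
  assumes "u \<noteq> 0"
  shows "u powi n = cpol n (u + inverse u) * u + dpol n (u + inverse u)"
proof (induction n rule: int_induct[where k = 0])
  case base
  show ?case by (simp add: cpol_0 dpol_0)
next
  case (step1 n)
  show ?case using assms
    unfolding cpol_rec dpol_rec by (simp add: power_int_add step1.IH algebra_simps)
next
  case (step2 n)
  show ?case using assms
    by (simp add: power_int_diff step2.IH cpol_rec' dpol_rec' field_simps)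
qed

lemma cpol_powi:
  fixes u :: "'a::field"
  assumes "u \<noteq> 0"
  shows "cpol n (u + inverse u) * (u - inverse u) = u powi n - u powi (- n)"
  using powi_cd[OF assms, of n] powi_cd[of "inverse u" n] assms
  by (simp add: power_int_minus power_int_inverse algebra_simps)

section \<open>The types of the relation\<close>

text \<open>The trace of \<open>A\<^sup>n B\<^sup>m\<close>, for matrices of determinant 1 with traces \<open>x = tr A\<close>, \<open>y = tr B\<close>, \<open>z = tr AB\<close>.\<close>

definition rel_poly :: "int \<Rightarrow> int \<Rightarrow> 'a::comm_ring_1 \<Rightarrow> 'a \<Rightarrow> 'a \<Rightarrow> 'a" where
  "rel_poly n m x y z = z * cpol n x * cpol m y + x * cpol n x * dpol m y + y * dpol n x * cpol m y
     + 2 * dpol n x * dpol m y"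

text \<open>The equations say that \<open>A\<^bsup>n1\<^esup> = -e A\<^bsup>n2\<^esup>\<close>, \<open>B\<^bsup>m1\<^esup> = e B\<^bsup>m2\<^esup>\<close>, and \<open>A\<^bsup>n1\<^esup> B\<^bsup>m1\<^esup>\<close> has trace 0. The sign
  \<open>e\<close> is 1 for the ninth family and -1 for the tenth.\<close>

definition type_eqs :: "int \<Rightarrow> int \<Rightarrow> int \<Rightarrow> int \<Rightarrow> int \<Rightarrow> 'a::comm_ring_1 \<Rightarrow> 'a \<Rightarrow> 'a \<Rightarrow> 'a set" where
  "type_eqs n1 n2 m1 m2 e x y z =
    {cpol n1 x + of_int e * cpol n2 x, dpol n1 x + of_int e * dpol n2 x,
     cpol m1 y - of_int e * cpol m2 y, dpol m1 y - of_int e * dpol m2 y, rel_poly n1 m1 x y z}"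

lemma wp_gens_9: "wp_gens n1 n2 m1 m2 9 = type_eqs n1 n2 m1 m2 1 (Var Vx) (Var Vy) (Var Vz)"
  and wp_gens_10: "wp_gens n1 n2 m1 m2 10 = type_eqs n1 n2 m1 m2 (-1) (Var Vx) (Var Vy) (Var Vz)"
  by (simp_all add: wp_gens_def type_eqs_def rel_poly_def Let_def)

lemma (in comm_ring_hom) hom_rel_poly: "hom (rel_poly n m x y z) = rel_poly n m (hom x) (hom y) (hom z)"
  using hom_add[of 1 1] by (simp add: rel_poly_def hom_add hom_mult hom_cpol hom_dpol)

lemma (in comm_ring_hom) hom_type_eqs:
  "hom ` type_eqs n1 n2 m1 m2 e x y z = type_eqs n1 n2 m1 m2 e (hom x) (hom y) (hom z)"
  by (simp add: type_eqs_def hom_add hom_minus hom_mult hom_cpol hom_dpol hom_rel_poly hom_of_int)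

text \<open>In terms of matrices: \<open>A\<^bsup>n1-n2\<^esup> = -e\<close> and \<open>B\<^bsup>m1-m2\<^esup> = e\<close>.\<close>

lemma type_eqs_torsion:
  assumes I: "is_ideal I" and e: "e \<in> {1, -1}" and sub: "type_eqs n1 n2 m1 m2 e x y z \<subseteq> I"
  shows "cpol (n1 - n2) x \<in> I" "dpol (n1 - n2) x + of_int e \<in> I"
    "cpol (m1 - m2) y \<in> I" "dpol (m1 - m2) y - of_int e \<in> I"
proof -
  let ?e = "of_int e :: 'a"
  have ee: "?e * ?e = 1" using e by auto
  have *: "cpol (n - k) t \<in> I \<and> dpol (n - k) t - a \<in> I"
    if "cpol n t - a * cpol k t \<in> I" "dpol n t - a * dpol k t \<in> I" for n k t a
  proof -
    have "cpol (n - k) t = (cpol n t - a * cpol k t) * dpol k t - (dpol n t - a * dpol k t) * cpol k t"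
      by (simp add: cpol_diff algebra_simps)
    moreover have "dpol (n - k) t - a = (dpol n t - a * dpol k t) * (t * cpol k t + dpol k t) +
        (cpol n t - a * cpol k t) * cpol k t
        + a * (cpol k t ^ 2 + t * cpol k t * dpol k t + dpol k t ^ 2 - 1)"
      by (simp add: dpol_diff algebra_simps power2_eq_square)
    ultimately show ?thesis
      using that I by (auto simp: cd_norm intro!: ideal_add ideal_diff ideal_mult_r)
  qed
  show "cpol (n1 - n2) x \<in> I" "dpol (n1 - n2) x + of_int e \<in> I"
    using *[of n1 x "- ?e" n2] sub by (auto simp: type_eqs_def)
  show "cpol (m1 - m2) y \<in> I" "dpol (m1 - m2) y - of_int e \<in> I"
    using *[of m1 y ?e m2] sub by (auto simp: type_eqs_def)
qed

lemma norm_mem: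
  assumes "is_prime P" "cpol n t \<in> P"
  shows "dpol n t \<notin> P"
proof
  assume "dpol n t \<in> P"
  then have "cpol n t * (cpol n t + t * dpol n t) + dpol n t * dpol n t \<in> P"
    using assms by (auto intro!: ideal_add ideal_mult_r dest: prime_ideal)
  then show False using cd_norm[of n t] assms(1)
    by (auto simp: algebra_simps power2_eq_square prime_one)
qed

lemma cpol_unit_notin: "is_prime P \<Longrightarrow> n \<in> {1, -1} \<Longrightarrow> cpol n t \<notin> P"
  using prime_one[of P] ideal_uminus[OF prime_ideal[of P], of "-1"]
  by (auto simp: cpol_1 cpol_m1)

text \<open>On a point of type \<open>e\<close> neither first power is central. If, say, \<open>C\<^sub>1 = 0\<close>, then
  \<open>C\<^sub>2 = 0\<close>, and the last equation makes the trace of the first power of the second matrix zero, so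
  \<open>c\<^bsub>m1+m2\<^esub>\<close> vanishes; and \<open>c\<^bsub>n1+n2\<^esub>\<close> vanishes trivially.\<close>

lemma type_eqs_nonzero:
  assumes P: "is_prime P" and sub: "type_eqs n1 n2 m1 m2 e x y z \<subseteq> P" and e: "e \<in> {1, -1}"
    and sum: "m1 + m2 \<in> {1, -1} \<or> n1 + n2 \<in> {1, -1}"
  shows "cpol n1 x \<notin> P" "cpol m1 y \<notin> P"
proof -
  let ?e = "of_int e :: 'a"
  note I = prime_ideal[OF P]
  have ee: "?e * ?e = 1" using e by auto
  have eqs: "cpol n1 x + ?e * cpol n2 x \<in> P" "dpol n1 x + ?e * dpol n2 x \<in> P"
     "cpol m1 y - ?e * cpol m2 y \<in> P" "dpol m1 y - ?e * dpol m2 y \<in> P" "rel_poly n1 m1 x y z \<in> P"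
    using sub by (auto simp: type_eqs_def)
  have key: "cpol (n + k) t + a * cpol n t * (t * cpol n t + 2 * dpol n t) \<in> P"
    if "a * a = 1" "cpol n t + a * cpol k t \<in> P" "dpol n t + a * dpol k t \<in> P" for n k t a
  proof -
    have aa: "a * (a * w) = w" for w
      by (simp only: mult.assoc[symmetric] that(1) mult_1_left)
    have "cpol (n + k) t + a * cpol n t * (t * cpol n t + 2 * dpol n t) =
       a * ((t * cpol n t + dpol n t) * (cpol n t + a * cpol k t) + cpol n t * (dpol n t + a * dpol k t))"
      by (simp add: cpol_add algebra_simps aa)
    then show ?thesis using that I by (auto intro!: ideal_add ideal_mult_l)
  qed
  have key1: "cpol (n1 + n2) x + ?e * cpol n1 x * (x * cpol n1 x + 2 * dpol n1 x) \<in> P"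
    by (rule key) (use ee eqs in auto)
  have "cpol (m1 + m2) y + (- ?e) * cpol m1 y * (y * cpol m1 y + 2 * dpol m1 y) \<in> P"
    by (rule key) (use ee eqs in auto)
  then have key2: "cpol (m1 + m2) y + - (?e * cpol m1 y * (y * cpol m1 y + 2 * dpol m1 y)) \<in> P"
    by simp
  have addD: "a \<in> P" if "a + b \<in> P" "b \<in> P" for a b
    using ideal_diff[OF I that] by simp
  show "cpol n1 x \<notin> P"
  proof
    assume C: "cpol n1 x \<in> P"
    have "dpol n1 x * (y * cpol m1 y + 2 * dpol m1 y) + cpol n1 x * (z * cpol m1 y + x * dpol m1 y) \<in> P"
      using eqs(5) by (simp add: rel_poly_def algebra_simps)
    then have "dpol n1 x * (y * cpol m1 y + 2 * dpol m1 y) \<in> P"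
      using C I by (auto intro: addD ideal_mult_r)
    then have "y * cpol m1 y + 2 * dpol m1 y \<in> P" using norm_mem[OF P C] P by (simp add: prime_mult)
    then have "cpol (m1 + m2) y \<in> P" using addD[OF key2] I by (auto intro: ideal_uminus ideal_mult_l)
    moreover have "cpol (n1 + n2) x \<in> P" using key1 C I by (auto intro: addD ideal_mult_l ideal_mult_r)
    ultimately show False using sum cpol_unit_notin[OF P] by auto
  qed
  show "cpol m1 y \<notin> P"
  proof
    assume E: "cpol m1 y \<in> P"
    have "dpol m1 y * (x * cpol n1 x + 2 * dpol n1 x) + cpol m1 y * (z * cpol n1 x + y * dpol n1 x) \<in> P"
      using eqs(5) by (simp add: rel_poly_def algebra_simps)
    then have "dpol m1 y * (x * cpol n1 x + 2 * dpol n1 x) \<in> P"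
      using E I by (auto intro: addD ideal_mult_r)
    then have "x * cpol n1 x + 2 * dpol n1 x \<in> P" using norm_mem[OF P E] P by (simp add: prime_mult)
    then have "cpol (n1 + n2) x \<in> P" using key1 I by (auto intro: addD ideal_mult_l)
    moreover have "cpol (m1 + m2) y \<in> P"
      using addD[OF key2] E I by (auto intro: ideal_uminus ideal_mult_l ideal_mult_r)
    ultimately show False using sum cpol_unit_notin[OF P] by auto
  qed
qed

text \<open>In each of the first eight families one of the two products \<open>A\<^bsup>n1\<^esup> A\<^bsup>n2\<^esup>\<close> and \<open>B\<^bsup>m1\<^esup> B\<^bsup>m2\<^esup>\<close> is central because
  both factors are, and the other because its factors are inverse to each other up to sign. So
  \<open>c\<^bsub>n1+n2\<^esub>(x)\<close> and \<open>c\<^bsub>m1+m2\<^esub>(y)\<close> vanish, but \<open>c\<^sub>1 = 1\<close> and \<open>c\<^bsub>-1\<^esub> = -1\<close>.\<close>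

lemma fibre_1_to_8_empty:
  assumes sum: "m1 + m2 \<in> {1, -1} \<or> n1 + n2 \<in> {1, -1}" and i: "i \<in> {1..8}"
  shows "fibre_Q (M_circ n1 n2 m1 m2 i) = {}"
proof (rule ccontr)
  assume "\<not> ?thesis"
  then obtain P where P: "is_prime P" and sub: "M_circ n1 n2 m1 m2 i \<subseteq> P" by (auto simp: fibre_Q_iff)
  note I = prime_ideal[OF P]
  have g: "wp_gens n1 n2 m1 m2 i \<subseteq> P"
    using sub ideal_gen_superset unfolding M_circ_def by blast
  define x y where "x = (Var Vx :: xyz zpoly)" and "y = (Var Vy :: xyz zpoly)"
  have zero: "cpol (n + k) t \<in> P" if "cpol n t \<in> P" "cpol k t \<in> P" for n k t
    unfolding cpol_add
    by (intro ideal_add[OF I] ideal_mult_l[OF I that(2)] ideal_mult_r[OF I that(1)])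
  have inv: "cpol (n + k) t \<in> P"
    if "cpol n t + a * cpol k t \<in> P" "t * cpol n t + dpol n t - a * dpol k t \<in> P" "a * a = 1" for n k t a
  proof -
    have aa: "a * (a * w) = w" for w
      by (simp only: mult.assoc[symmetric] that(3) mult_1_left)
    have "cpol (n + k) t = a * ((t * cpol n t + dpol n t) * (cpol n t + a * cpol k t)
         - cpol n t * (t * cpol n t + dpol n t - a * dpol k t))"
      by (simp add: cpol_add algebra_simps aa)
    then show ?thesis using that I by (auto intro!: ideal_diff ideal_mult_l)
  qed
  have "i = 1 \<or> i = 2 \<or> i = 3 \<or> i = 4 \<or> i = 5 \<or> i = 6 \<or> i = 7 \<or> i = 8" using i by auto
  then have "cpol (n1 + n2) x \<in> P \<and> cpol (m1 + m2) y \<in> P"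
    using zero[of n1 x n2] zero[of m1 y m2] inv[of n1 x 1 n2] inv[of n1 x "-1" n2]
      inv[of m1 y 1 m2] inv[of m1 y "-1" m2] g
    by (elim disjE) (simp_all add: wp_gens_def Let_def x_def[symmetric] y_def[symmetric])
  then show False using sum cpol_unit_notin[OF P] by auto
qed

section \<open>The relation for pairs of matrices\<close>

text \<open>Such an ideal \<open>I\<close> is the preimage of an ideal of the local ring at \<open>P\<close>. Working modulo \<open>I\<close>, elements
  outside \<open>P\<close> can be cancelled, which makes the arguments for representations over a field (\<open>P = I = 0\<close>) work for
  the local rings of the scheme of representations.\<close>

definition localizes :: "'a::comm_ring_1 set \<Rightarrow> 'a set \<Rightarrow> bool" where
  "localizes P I \<longleftrightarrow> is_prime P \<and> is_ideal I \<and> I \<subseteq> P \<and> (\<forall>g f. g \<notin> P \<and> g * f \<in> I \<longrightarrow> f \<in> I)"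

lemma localizesD:
  assumes "localizes P I"
  shows "is_prime P" "is_ideal I" "a \<in> I \<Longrightarrow> a \<in> P" "g \<notin> P \<Longrightarrow> g * f \<in> I \<Longrightarrow> f \<in> I"
  using assms unfolding localizes_def by blast+

lemma localizes_0: "localizes {0} {0 :: 'a::idom}"
  by (auto simp: localizes_def is_prime_def is_ideal_def)

text \<open>Cramer's rule for the independence of \<open>AB, A, B, 1\<close>, where \<open>A\<close> has the rows \<open>(a, b)\<close>, \<open>(c, d)\<close> and
  \<open>B\<close> the rows \<open>(p, q)\<close>, \<open>(r, s)\<close>. The entries of \<open>AB - BA\<close> are \<open>u, v, w, -u\<close>, and \<open>u\<^sup>2 + v w = - det (AB - BA)\<close> is,
  up to sign, also the determinant of the four matrices seen as vectors.\<close>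

lemma independent_mod:
  fixes a b c d p q r s \<alpha> \<beta> \<gamma> \<epsilon> :: "'a::comm_ring_1"
  defines "u \<equiv> b * r - q * c" and "v \<equiv> a * q + b * s - p * b - q * d" and "w \<equiv> c * p + d * r - r * a - s * c"
  assumes loc: "localizes P I" and n: "u * u + v * w \<notin> P"
    and R11: "\<alpha> * (a * p + b * r) + \<beta> * a + \<gamma> * p + \<epsilon> \<in> I"
    and R12: "\<alpha> * (a * q + b * s) + \<beta> * b + \<gamma> * q \<in> I"
    and R21: "\<alpha> * (c * p + d * r) + \<beta> * c + \<gamma> * r \<in> I"
    and R22: "\<alpha> * (c * q + d * s) + \<beta> * d + \<gamma> * s + \<epsilon> \<in> I"
  shows "\<alpha> \<in> I" "\<beta> \<in> I" "\<gamma> \<in> I" "\<epsilon> \<in> I"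
proof -
  note I = localizesD(2)[OF loc] and L = localizesD(4)[OF loc n]
  have "(u * u + v * w) * \<alpha> =
      (\<alpha> * (a * p + b * r) + \<beta> * a + \<gamma> * p + \<epsilon>) * u + (\<alpha> * (a * q + b * s) + \<beta> * b + \<gamma> * q) * w
      + (\<alpha> * (c * p + d * r) + \<beta> * c + \<gamma> * r) * v - (\<alpha> * (c * q + d * s) + \<beta> * d + \<gamma> * s + \<epsilon>) * u"
    unfolding u_def v_def w_def by (simp add: algebra_simps)
  also have "\<dots> \<in> I" by (intro ideal_add[OF I] ideal_diff[OF I] ideal_mult_r[OF I] R11 R12 R21 R22)
  finally show \<alpha>: "\<alpha> \<in> I" by (rule L)
  have sub: "f - \<alpha> * g \<in> I" if "f \<in> I" for f g
    by (intro ideal_diff[OF I that] ideal_mult_r[OF I \<alpha>])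
  have S12: "\<beta> * b + \<gamma> * q \<in> I" and S21: "\<beta> * c + \<gamma> * r \<in> I"
    using sub[OF R12, of "a * q + b * s"] sub[OF R21, of "c * p + d * r"] by (simp_all add: algebra_simps)
  have S: "\<beta> * (a - d) + \<gamma> * (p - s) \<in> I"
    using sub[OF ideal_diff[OF I R11 R22], of "(a * p + b * r) - (c * q + d * s)"]
    by (simp add: algebra_simps)
  have "(u * u + v * w) * \<beta> =
     ((\<beta> * b + \<gamma> * q) * r - (\<beta> * c + \<gamma> * r) * q) * u
     + ((\<beta> * (a - d) + \<gamma> * (p - s)) * q - (\<beta> * b + \<gamma> * q) * (p - s)) * w"
    unfolding u_def v_def w_def by (simp add: algebra_simps)
  also have "\<dots> \<in> I" by (intro ideal_add[OF I] ideal_diff[OF I] ideal_mult_r[OF I] S S12 S21)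
  finally show \<beta>: "\<beta> \<in> I" by (rule L)
  have "(u * u + v * w) * \<gamma> =
     ((\<beta> * c + \<gamma> * r) * b - (\<beta> * b + \<gamma> * q) * c) * u
     + ((\<beta> * b + \<gamma> * q) * (a - d) - (\<beta> * (a - d) + \<gamma> * (p - s)) * b) * w"
    unfolding u_def v_def w_def by (simp add: algebra_simps)
  also have "\<dots> \<in> I" by (intro ideal_add[OF I] ideal_diff[OF I] ideal_mult_r[OF I] S S12 S21)
  finally show \<gamma>: "\<gamma> \<in> I" by (rule L)
  have "\<epsilon> = (\<alpha> * (a * p + b * r) + \<beta> * a + \<gamma> * p + \<epsilon>) - \<alpha> * (a * p + b * r) - \<beta> * a - \<gamma> * p"
    by simp
  also have "\<dots> \<in> I" by (intro ideal_diff[OF I] ideal_mult_r[OF I] R11 \<alpha> \<beta> \<gamma>)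
  finally show "\<epsilon> \<in> I" .
qed

text \<open>The hypotheses on \<open>\<alpha>, \<beta>, \<gamma>, \<epsilon>\<close> are the vanishing of the coefficients of \<open>AB, A, B, 1\<close> in the relation.
  First, \<open>C1\<close> and \<open>E1\<close> do not vanish at \<open>P\<close>: otherwise so would \<open>c\<^bsub>n1+n2\<^esub>(x)\<close> and \<open>c\<^bsub>m1+m2\<^esub>(y)\<close>. The first two
  equations and the two norm equations for \<open>y\<close> give \<open>C1\<^sup>2 = C2\<^sup>2\<close>, so \<open>C1 = -e C2\<close> for a sign \<open>e\<close>; here \<open>2 \<notin> P\<close> ensures
  that only one of the factors \<open>C1 \<plusminus> C2\<close> vanishes at \<open>P\<close>, so that the other can be cancelled. Cancelling
  \<open>C1\<close> and \<open>E1\<close> in the other equations gives the rest.\<close>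

lemma type_dichotomy:
  fixes x y z :: "'a::comm_ring_1" and n1 n2 m1 m2 :: int
  defines "C1 \<equiv> cpol n1 x" and "C2 \<equiv> cpol n2 x" and "D1 \<equiv> dpol n1 x" and "D2 \<equiv> dpol n2 x"
    and "E1 \<equiv> cpol m1 y" and "E2 \<equiv> cpol m2 y" and "F1 \<equiv> dpol m1 y" and "F2 \<equiv> dpol m2 y"
  assumes loc: "localizes P I" and two: "2 \<notin> P"
    and sum: "m1 + m2 \<in> {1, -1} \<or> n1 + n2 \<in> {1, -1}"
    and \<alpha>: "C1 * E1 + C2 * E2 \<in> I" and \<beta>: "C1 * F1 + C2 * F2 \<in> I" and \<gamma>: "D1 * E1 + D2 * E2 \<in> I"
    and \<epsilon>: "D1 * F1 - z * C2 * E2 - y * D2 * E2 - x * C2 * F2 - D2 * F2 \<in> I"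
  shows "\<exists>e\<in>{1, -1}. type_eqs n1 n2 m1 m2 e x y z \<subseteq> I"
proof -
  note P = localizesD(1)[OF loc] and I = localizesD(2)[OF loc] and IP = localizesD(3)[OF loc]
    and L = localizesD(4)[OF loc]
  note PI = prime_ideal[OF P]
  have addD: "b \<in> P" if "a + b \<in> P" "a \<in> P" for a b
    using ideal_diff[OF PI that] by simp
  have nE2: "E2 \<notin> P \<or> F2 \<notin> P" using norm_mem[OF P] unfolding E2_def F2_def by blast
  have nC2: "C2 \<notin> P \<or> D2 \<notin> P" using norm_mem[OF P] unfolding C2_def D2_def by blast
  have C1: "C1 \<notin> P"
  proof
    assume C: "C1 \<in> P"
    have "C2 * E2 \<in> P" "C2 * F2 \<in> P"
      by (rule addD[OF IP[OF \<alpha>] ideal_mult_r[OF PI C]], rule addD[OF IP[OF \<beta>] ideal_mult_r[OF PI C]])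
    then have C2: "C2 \<in> P" using nE2 P by (auto simp: prime_mult)
    have "cpol (n1 + n2) x \<in> P"
      unfolding cpol_add C1_def[symmetric] C2_def[symmetric] D1_def[symmetric] D2_def[symmetric]
      by (intro ideal_add[OF PI] ideal_mult_l[OF PI C2] ideal_mult_r[OF PI C])
    moreover have "D1 * cpol (m1 + m2) y = (y * E2 + F2) * (D1 * E1 + D2 * E2)
       + E2 * (D1 * F1 - z * C2 * E2 - y * D2 * E2 - x * C2 * F2 - D2 * F2) + (E2 * (z * E2 + x * F2)) * C2"
      unfolding cpol_add E1_def[symmetric] E2_def[symmetric] F1_def[symmetric] F2_def[symmetric]
      by (simp add: algebra_simps)
    then have "D1 * cpol (m1 + m2) y \<in> P"
      by (simp only:) (intro ideal_add[OF PI] ideal_mult_l[OF PI C2] ideal_mult_l[OF PI IP] \<gamma> \<epsilon>)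
    moreover have "D1 \<notin> P" using norm_mem[OF P] C unfolding C1_def D1_def by blast
    ultimately show False using sum cpol_unit_notin[OF P] P by (auto simp: prime_mult)
  qed
  have E1: "E1 \<notin> P"
  proof
    assume E: "E1 \<in> P"
    have "C2 * E2 \<in> P" "D2 * E2 \<in> P"
      by (rule addD[OF IP[OF \<alpha>] ideal_mult_l[OF PI E]], rule addD[OF IP[OF \<gamma>] ideal_mult_l[OF PI E]])
    then have E2: "E2 \<in> P" using nC2 P by (auto simp: prime_mult)
    have "cpol (m1 + m2) y \<in> P"
      unfolding cpol_add E1_def[symmetric] E2_def[symmetric] F1_def[symmetric] F2_def[symmetric]
      by (intro ideal_add[OF PI] ideal_mult_l[OF PI E2] ideal_mult_r[OF PI E])
    moreover have "F1 * cpol (n1 + n2) x = (x * C2 + D2) * (C1 * F1 + C2 * F2)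
       + C2 * (D1 * F1 - z * C2 * E2 - y * D2 * E2 - x * C2 * F2 - D2 * F2) + (C2 * (z * C2 + y * D2)) * E2"
      unfolding cpol_add C1_def[symmetric] C2_def[symmetric] D1_def[symmetric] D2_def[symmetric]
      by (simp add: algebra_simps)
    then have "F1 * cpol (n1 + n2) x \<in> P"
      by (simp only:) (intro ideal_add[OF PI] ideal_mult_l[OF PI E2] ideal_mult_l[OF PI IP] \<beta> \<epsilon>)
    moreover have "F1 \<notin> P" using norm_mem[OF P] E unfolding E1_def F1_def by blast
    ultimately show False using sum cpol_unit_notin[OF P] P by (auto simp: prime_mult)
  qed
  have norms: "E1 ^ 2 + y * E1 * F1 + F1 ^ 2 = 1" "E2 ^ 2 + y * E2 * F2 + F2 ^ 2 = 1"
    unfolding E1_def E2_def F1_def F2_def by (rule cd_norm)+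
  \<comment> \<open>Both norms are 1, so this expresses \<open>C1\<^sup>2 - C2\<^sup>2\<close> through the coefficients.\<close>
  have "C1 * C1 * (E1 ^ 2 + y * E1 * F1 + F1 ^ 2) - C2 * C2 * (E2 ^ 2 + y * E2 * F2 + F2 ^ 2)
    = (C1 * E1 + C2 * E2) * (C1 * E1 - C2 * E2)
      + ((C1 * E1 + C2 * E2) * (y * C1 * F1) - (C1 * F1 + C2 * F2) * (y * C2 * E2))
      + (C1 * F1 + C2 * F2) * (C1 * F1 - C2 * F2)"
    by (simp add: algebra_simps power2_eq_square)
  then have "C1 * C1 - C2 * C2 = (C1 * E1 + C2 * E2) * (C1 * E1 - C2 * E2)
      + ((C1 * E1 + C2 * E2) * (y * C1 * F1) - (C1 * F1 + C2 * F2) * (y * C2 * E2))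
      + (C1 * F1 + C2 * F2) * (C1 * F1 - C2 * F2)"
    unfolding norms by simp
  then have sq: "C1 * C1 - C2 * C2 \<in> I"
    by (simp only:) (intro ideal_add[OF I] ideal_diff[OF I] ideal_mult_r[OF I] \<alpha> \<beta>)
  have "(C1 + C2) * (C1 - C2) \<in> P" using IP[OF sq] by (simp add: algebra_simps)
  then have "C1 + of_int 1 * C2 \<in> P \<or> C1 + of_int (- 1) * C2 \<in> P"
    using P by (auto simp: prime_mult)
  then obtain e :: int where e: "e \<in> {1, -1}" and Ce: "C1 + of_int e * C2 \<in> P"
    by blast
  let ?e = "of_int e :: 'a"
  have ee: "?e * ?e = 1" using e by auto
  have aa: "?e * (?e * w) = w" for w by (simp add: mult.assoc[symmetric] ee)
  have "C1 - ?e * C2 \<notin> P"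
  proof
    assume "C1 - ?e * C2 \<in> P"
    from ideal_add[OF PI Ce this] have "2 * C1 \<in> P" by (simp add: algebra_simps)
    then show False using C1 two P by (simp add: prime_mult)
  qed
  moreover have "(C1 - ?e * C2) * (C1 + ?e * C2) = C1 * C1 - C2 * C2" by (simp add: algebra_simps aa ee)
  ultimately have C: "C1 + ?e * C2 \<in> I" using L sq by metis
  have "C1 * (E1 - ?e * E2) = (C1 * E1 + C2 * E2) - (?e * E2) * (C1 + ?e * C2)" by (simp add: algebra_simps aa ee)
  then have E: "E1 - ?e * E2 \<in> I"
    using L[OF C1, of "E1 - ?e * E2"] ideal_diff[OF I \<alpha> ideal_mult_l[OF I C]] by metis
  have "C1 * (F1 - ?e * F2) = (C1 * F1 + C2 * F2) - (?e * F2) * (C1 + ?e * C2)" by (simp add: algebra_simps aa ee)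
  then have F: "F1 - ?e * F2 \<in> I"
    using L[OF C1, of "F1 - ?e * F2"] ideal_diff[OF I \<beta> ideal_mult_l[OF I C]] by metis
  have "E1 * (D1 + ?e * D2) = (D1 * E1 + D2 * E2) + (?e * D2) * (E1 - ?e * E2)" by (simp add: algebra_simps aa ee)
  then have D: "D1 + ?e * D2 \<in> I"
    using L[OF E1, of "D1 + ?e * D2"] ideal_add[OF I \<gamma> ideal_mult_l[OF I E]] by metis
  have "rel_poly n1 m1 x y z = (D1 * F1 - z * C2 * E2 - y * D2 * E2 - x * C2 * F2 - D2 * F2)
      + z * (C1 * E1 + C2 * E2) + x * (C1 * F1 + C2 * F2) + y * (D1 * E1 + D2 * E2)
      + (F1 * (D1 + ?e * D2) - (?e * D2) * (F1 - ?e * F2))"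
    unfolding rel_poly_def C1_def[symmetric] D1_def[symmetric] E1_def[symmetric] F1_def[symmetric]
    by (simp add: algebra_simps aa ee)
  then have "rel_poly n1 m1 x y z \<in> I"
    by (simp only:) (intro ideal_add[OF I] ideal_diff[OF I] ideal_mult_l[OF I] \<alpha> \<beta> \<gamma> \<epsilon> D F)
  then show ?thesis
    using e C D E F unfolding type_eqs_def C1_def C2_def D1_def D2_def E1_def E2_def F1_def F2_def
    by blast
qed

subsection \<open>Congruences of matrices\<close>

definition mcong :: "'a::comm_ring_1 set \<Rightarrow> 'a ^ 2 ^ 2 \<Rightarrow> 'a ^ 2 ^ 2 \<Rightarrow> bool" where
  "mcong I M N \<longleftrightarrow> (\<forall>i j. M $ i $ j - N $ i $ j \<in> I)"

text \<open>The matrix \<open>c M + d\<close>; by Cayley-Hamilton all powers of \<open>M\<close> have this form.\<close>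

definition lin2 :: "'a::comm_ring_1 \<Rightarrow> 'a \<Rightarrow> 'a ^ 2 ^ 2 \<Rightarrow> 'a ^ 2 ^ 2" where
  "lin2 c d M = (\<chi> i j. c * M $ i $ j + (if i = j then d else 0))"

lemma mat2_eq_iff: "(M :: 'a ^ 2 ^ 2) = N \<longleftrightarrow>
    M $ 1 $ 1 = N $ 1 $ 1 \<and> M $ 1 $ 2 = N $ 1 $ 2 \<and> M $ 2 $ 1 = N $ 2 $ 1 \<and> M $ 2 $ 2 = N $ 2 $ 2"
  by (auto simp: vec_eq_iff forall_2)

lemma mult2: "((M :: 'a::comm_ring_1 ^ 2 ^ 2) ** (N :: 'a ^ 2 ^ 2)) $ i $ j = M $ i $ 1 * N $ 1 $ j + M $ i $ 2 * N $ 2 $ j"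
  by (simp add: matrix_matrix_mult_def sum_2)

lemma trace2: "trace (M :: 'a::comm_ring_1 ^ 2 ^ 2) = M $ 1 $ 1 + M $ 2 $ 2"
  by (simp add: trace_def sum_2)

lemma adj2_nth: "adj2 M $ 1 $ 1 = M $ 2 $ 2" "adj2 M $ 1 $ 2 = - M $ 1 $ 2"
    "adj2 M $ 2 $ 1 = - M $ 2 $ 1" "adj2 M $ 2 $ 2 = M $ 1 $ 1"
  by (simp_all add: adj2_def)

lemma mat1_nth: "(mat 1 :: 'a::comm_ring_1 ^ 2 ^ 2) $ i $ j = (if i = j then 1 else 0)"
  by (simp add: mat_def)

lemma lin2_nth: "lin2 c d M $ i $ j = c * M $ i $ j + (if i = j then d else 0)"
  by (simp add: lin2_def)

lemmas mat2_simps = mult2 adj2_nth mat1_nth lin2_nth trace2 det_2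

lemma mcong_refl: "is_ideal I \<Longrightarrow> mcong I M M"
  by (simp add: mcong_def ideal_zero)

lemma mcong_sym: "is_ideal I \<Longrightarrow> mcong I M N \<Longrightarrow> mcong I N M"
  unfolding mcong_def using ideal_uminus[of I "M $ i $ j - N $ i $ j" for i j] by simp

lemma mcong_trans: "is_ideal I \<Longrightarrow> mcong I L M \<Longrightarrow> mcong I M N \<Longrightarrow> mcong I L N"
  unfolding mcong_def using ideal_add[of I, where a = "L $ i $ j - M $ i $ j" and b = "M $ i $ j - N $ i $ j" for i j]
  by simp

lemma mcong_mult:
  assumes I: "is_ideal I" and "mcong I M M'" "mcong I N N'"
  shows "mcong I (M ** N) (M' ** N')"
  unfolding mcong_def
proof (intro allI)
  fix i j
  have eq: "(M ** N) $ i $ j - (M' ** N') $ i $ j =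
     (M $ i $ 1 - M' $ i $ 1) * N $ 1 $ j + M' $ i $ 1 * (N $ 1 $ j - N' $ 1 $ j) +
     ((M $ i $ 2 - M' $ i $ 2) * N $ 2 $ j + M' $ i $ 2 * (N $ 2 $ j - N' $ 2 $ j))"
    by (simp add: mult2 algebra_simps)
  show "(M ** N) $ i $ j - (M' ** N') $ i $ j \<in> I"
    unfolding eq using assms(2,3)
    by (intro ideal_add[OF I] ideal_mult_l[OF I] ideal_mult_r[OF I]) (auto simp: mcong_def)
qed

lemma word_mat_append: "word_mat M (u @ v) = word_mat M u ** word_mat M v"
  by (induction M u rule: word_mat.induct) (auto simp: matrix_mul_assoc)

lemma word_mat_gen_pow:
  assumes I: "is_ideal I" and det: "det (M g) - 1 \<in> I"
  shows "mcong I (word_mat M (gen_pow g k)) (lin2 (cpol k (trace (M g))) (dpol k (trace (M g))) (M g))"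
proof -
  let ?t = "trace (M g)"
  have pos: "mcong I (word_mat M (replicate n (g, True))) (lin2 (cpol (int n) ?t) (dpol (int n) ?t) (M g))" for n
  proof (induction n)
    case 0
    have "lin2 0 1 (M g) = mat 1" by (simp add: mat2_eq_iff mat2_simps)
    then show ?case by (simp add: cpol_0 dpol_0 mcong_refl[OF I])
  next
    case (Suc n)
    let ?c = "cpol (int n) ?t" and ?d = "dpol (int n) ?t"
    \<comment> \<open>Modulo \<open>det M = 1\<close>, Cayley-Hamilton turns multiplication by \<open>M\<close> into the recursion of \<open>c, d\<close>.\<close>
    have "mcong I (M g ** lin2 ?c ?d (M g)) (lin2 (?t * ?c + ?d) (- ?c) (M g))"
      using ideal_mult_r[OF I det, of "- ?c"] ideal_zero[OF I]
      by (auto simp: mcong_def forall_2 mat2_simps algebra_simps)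
    moreover have "mcong I (word_mat M (replicate (Suc n) (g, True))) (M g ** lin2 ?c ?d (M g))"
      using mcong_mult[OF I mcong_refl[OF I] Suc.IH] by simp
    moreover have "int (Suc n) = int n + 1" by simp
    ultimately show ?case by (simp only: cpol_rec dpol_rec mcong_trans[OF I])
  qed
  have neg: "mcong I (word_mat M (replicate n (g, False))) (lin2 (cpol (- int n) ?t) (dpol (- int n) ?t) (M g))" for n
  proof (induction n)
    case 0
    have "lin2 0 1 (M g) = mat 1" by (simp add: mat2_eq_iff mat2_simps)
    then show ?case by (simp add: cpol_0 dpol_0 mcong_refl[OF I])
  next
    case (Suc n)
    let ?c = "cpol (- int n) ?t" and ?d = "dpol (- int n) ?t"
    have "mcong I (adj2 (M g) ** lin2 ?c ?d (M g)) (lin2 (- ?d) (?c + ?t * ?d) (M g))"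
      using ideal_mult_r[OF I det, of "?c"] ideal_zero[OF I]
      by (auto simp: mcong_def forall_2 mat2_simps algebra_simps)
    moreover have "mcong I (word_mat M (replicate (Suc n) (g, False))) (adj2 (M g) ** lin2 ?c ?d (M g))"
      using mcong_mult[OF I mcong_refl[OF I] Suc.IH] by simp
    moreover have "- int (Suc n) = - int n - 1" by simp
    ultimately show ?case by (simp only: cpol_rec' dpol_rec' mcong_trans[OF I])
  qed
  show ?thesis
  proof (cases "k \<ge> 0")
    case True
    then show ?thesis using pos[of "nat k"] by (simp add: gen_pow_def)
  next
    case False
    then show ?thesis using neg[of "nat (- k)"] by (simp add: gen_pow_def)
  qed
qed

text \<open>The second factor is the adjugate of the first, and their product is the determinant, which is 1 by
  \<open>cd_norm\<close>.\<close>

lemma lin2_inverse: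
  assumes I: "is_ideal I" and det: "det M - 1 \<in> I" and t: "t = trace M"
  shows "mcong I (lin2 (cpol n t) (dpol n t) M ** lin2 (- cpol n t) (t * cpol n t + dpol n t) M) (mat 1)"
proof -
  let ?c = "cpol n t" and ?d = "dpol n t"
  have "lin2 c d M ** lin2 (- c) (trace M * c + d) M =
      lin2 0 (c ^ 2 * (det M - 1) + (c ^ 2 + trace M * c * d + d ^ 2)) M" for c d
    by (simp add: mat2_eq_iff mat2_simps) (simp add: algebra_simps power2_eq_square)
  from this[of ?c ?d] have eq: "lin2 ?c ?d M ** lin2 (- ?c) (t * ?c + ?d) M = lin2 0 (?c ^ 2 * (det M - 1) + 1) M"
    unfolding t[symmetric] cd_norm .
  have "mcong I (lin2 0 (k * (det M - 1) + 1) M) (mat 1)" for k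
    using ideal_mult_l[OF I det, of k] ideal_zero[OF I] by (auto simp: mcong_def lin2_nth mat1_nth)
  then show ?thesis unfolding eq .
qed

text \<open>The relation says that \<open>A\<^bsup>n1\<^esup> B\<^bsup>m1\<^esup>\<close> is the inverse of \<open>A\<^bsup>n2\<^esup> B\<^bsup>m2\<^esup>\<close>. Both sides are
  combinations of \<open>1, A, B, AB\<close>, because \<open>AB + BA = y A + x B + (z - x y)\<close>.\<close>

lemma lin2_products:
  fixes A B :: "'a::comm_ring_1 ^ 2 ^ 2"
  defines "x \<equiv> trace A" and "y \<equiv> trace B" and "z \<equiv> trace (A ** B)"
  shows "(lin2 c1 d1 A ** lin2 e1 f1 B) $ i $ j
      - (lin2 (- e2) (y * e2 + f2) B ** lin2 (- c2) (x * c2 + d2) A) $ i $ j =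
    (c1 * e1 + c2 * e2) * (A ** B) $ i $ j + (c1 * f1 + c2 * f2) * A $ i $ j
     + (d1 * e1 + d2 * e2) * B $ i $ j
     + (if i = j then d1 * f1 - z * c2 * e2 - y * d2 * e2 - x * c2 * f2 - d2 * f2 else 0)"
    (is "?L i j = ?R i j")
proof -
  have "\<forall>i j. ?L i j = ?R i j"
    unfolding forall_2 x_def y_def z_def
    by (simp add: mat2_simps) (simp add: algebra_simps)
  then show ?thesis by blast
qed

text \<open>The four coefficients are those of \<open>lin2_products\<close> for \<open>A\<^bsup>n1\<^esup> B\<^bsup>m1\<^esup> = B\<^bsup>-m2\<^esup> A\<^bsup>-n2\<^esup>\<close>.\<close>

lemma relation_coefficients:
  fixes M :: "gen \<Rightarrow> 'a::comm_ring_1 ^ 2 ^ 2"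
  defines "x \<equiv> trace (M Ga)" and "y \<equiv> trace (M Gb)" and "z \<equiv> trace (M Ga ** M Gb)"
  assumes I: "is_ideal I" and det: "\<And>g. det (M g) - 1 \<in> I"
    and rel: "mcong I (word_mat M (relator n1 n2 m1 m2)) (mat 1)"
  shows "(cpol n1 x * cpol m1 y + cpol n2 x * cpol m2 y) * (M Ga ** M Gb) $ i $ j
     + (cpol n1 x * dpol m1 y + cpol n2 x * dpol m2 y) * M Ga $ i $ j
     + (dpol n1 x * cpol m1 y + dpol n2 x * cpol m2 y) * M Gb $ i $ j
     + (if i = j then dpol n1 x * dpol m1 y - z * cpol n2 x * cpol m2 y - y * dpol n2 x * cpol m2 y
          - x * cpol n2 x * dpol m2 y - dpol n2 x * dpol m2 y else 0) \<in> I" (is "?L i j \<in> I")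
proof -
  let ?X = "\<lambda>n. lin2 (cpol n x) (dpol n x) (M Ga)" and ?Y = "\<lambda>m. lin2 (cpol m y) (dpol m y) (M Gb)"
  let ?X' = "lin2 (- cpol n2 x) (x * cpol n2 x + dpol n2 x) (M Ga)"
  let ?Y' = "lin2 (- cpol m2 y) (y * cpol m2 y + dpol m2 y) (M Gb)"
  note T = mcong_trans[OF I] and S = mcong_sym[OF I] and R = mcong_refl[OF I] and X = mcong_mult[OF I]
  have gp: "mcong I (word_mat M (gen_pow Ga n)) (?X n)" "mcong I (word_mat M (gen_pow Gb m)) (?Y m)" for n m
    unfolding x_def y_def by (intro word_mat_gen_pow I det)+
  have "mcong I (word_mat M (relator n1 n2 m1 m2)) (?X n1 ** (?Y m1 ** (?X n2 ** ?Y m2)))"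
    unfolding relator_def word_mat_append by (intro X gp)
  then have "mcong I (?X n1 ** (?Y m1 ** (?X n2 ** ?Y m2))) (mat 1)"
    using rel S T by blast
  from X[OF this R, of "?Y' ** ?X'"]
  have 1: "mcong I ((?X n1 ** ?Y m1) ** ((?X n2 ** (?Y m2 ** ?Y')) ** ?X')) (?Y' ** ?X')"
    by (simp add: matrix_mul_assoc matrix_mul_lid)
  have "mcong I (?Y m2 ** ?Y') (mat 1)" "mcong I (?X n2 ** ?X') (mat 1)"
    by (intro lin2_inverse I det; simp add: x_def y_def)+
  then have "mcong I ((?X n2 ** (?Y m2 ** ?Y')) ** ?X') (mat 1)"
    using X[OF X[OF R[of "?X n2"]] R[of ?X'], of "?Y m2 ** ?Y'" "mat 1"] T by (simp add: matrix_mul_rid)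
  from T[OF S[OF X[OF R[of "?X n1 ** ?Y m1"] this]] 1]
  have "mcong I (?X n1 ** ?Y m1) (?Y' ** ?X')" by (simp add: matrix_mul_rid)
  then have "(?X n1 ** ?Y m1) $ i $ j - (?Y' ** ?X') $ i $ j \<in> I" by (simp add: mcong_def)
  moreover have "(?X n1 ** ?Y m1) $ i $ j - (?Y' ** ?X') $ i $ j = ?L i j"
    unfolding x_def y_def z_def by (rule lin2_products)
  ultimately show ?thesis by simp
qed

definition comm2 :: "'a::comm_ring_1 ^ 2 ^ 2 \<Rightarrow> 'a ^ 2 ^ 2 \<Rightarrow> 'a ^ 2 ^ 2" where
  "comm2 A B = A ** B - B ** A"

text \<open>At a representation that is irreducible at \<open>P\<close>, the commutator is invertible at \<open>P\<close>, so the matrices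
  \<open>AB, A, B, 1\<close> are independent and every coefficient of the relation lies in \<open>I\<close>.\<close>

theorem relation_types:
  fixes M :: "gen \<Rightarrow> 'a::comm_ring_1 ^ 2 ^ 2"
  assumes loc: "localizes P I" and two: "2 \<notin> P"
    and sum: "m1 + m2 \<in> {1, -1} \<or> n1 + n2 \<in> {1, -1}"
    and det: "\<And>g. det (M g) - 1 \<in> I"
    and rel: "mcong I (word_mat M (relator n1 n2 m1 m2)) (mat 1)"
    and irr: "det (comm2 (M Ga) (M Gb)) \<notin> P"
  shows "\<exists>e\<in>{1, -1}. type_eqs n1 n2 m1 m2 e (trace (M Ga)) (trace (M Gb)) (trace (M Ga ** M Gb)) \<subseteq> I"
proof -
  note I = localizesD(2)[OF loc] and PI = prime_ideal[OF localizesD(1)[OF loc]]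
  note rc = relation_coefficients[OF I det rel]
  define a b c d p q r s where d: "a = M Ga $ 1 $ 1" "b = M Ga $ 1 $ 2" "c = M Ga $ 2 $ 1" "d = M Ga $ 2 $ 2"
     "p = M Gb $ 1 $ 1" "q = M Gb $ 1 $ 2" "r = M Gb $ 2 $ 1" "s = M Gb $ 2 $ 2"
  have "- det (comm2 (M Ga) (M Gb)) = (b * r - q * c) * (b * r - q * c)
      + (a * q + b * s - p * b - q * d) * (c * p + d * r - r * a - s * c)"
    unfolding d by (simp add: comm2_def mat2_simps) (simp add: algebra_simps)
  then have n: "(b * r - q * c) * (b * r - q * c)
      + (a * q + b * s - p * b - q * d) * (c * p + d * r - r * a - s * c) \<notin> P"
    using irr ideal_uminus[OF PI] by (metis minus_minus)
  note ind = independent_mod[OF loc n rc[of 1 1, simplified, unfolded mult2, folded d]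
      rc[of 1 2, simplified, unfolded mult2, folded d] rc[of 2 1, simplified, unfolded mult2, folded d]
      rc[of 2 2, simplified, unfolded mult2, folded d]]
  show ?thesis by (rule type_dichotomy[OF loc two sum ind])
qed

section \<open>Integral elements\<close>

definition integral_over :: "('a::comm_ring_1 \<Rightarrow> 'b::comm_ring_1) \<Rightarrow> 'b \<Rightarrow> bool" where
  "integral_over \<phi> u \<longleftrightarrow> (\<exists>f. Polynomial.lead_coeff f = 1 \<and> poly (map_poly \<phi> f) u = 0)"

definition hom_span :: "('a::comm_ring_1 \<Rightarrow> 'b::comm_ring_1) \<Rightarrow> 'b set \<Rightarrow> 'b set" where
  "hom_span \<phi> W = {\<Sum>w\<in>W. \<phi> (c w) * w | c. True}"

context comm_ring_hom
begin

lemma hom_span_add: "u \<in> hom_span hom W \<Longrightarrow> v \<in> hom_span hom W \<Longrightarrow> u + v \<in> hom_span hom W"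
proof -
  assume "u \<in> hom_span hom W" "v \<in> hom_span hom W"
  then obtain c d where "u = (\<Sum>w\<in>W. hom (c w) * w)" "v = (\<Sum>w\<in>W. hom (d w) * w)"
    by (auto simp: hom_span_def)
  then have "u + v = (\<Sum>w\<in>W. hom (c w + d w) * w)" by (simp add: hom_add sum.distrib distrib_right)
  then show ?thesis by (auto simp: hom_span_def)
qed

lemma hom_span_scale: "u \<in> hom_span hom W \<Longrightarrow> hom r * u \<in> hom_span hom W"
proof -
  assume "u \<in> hom_span hom W"
  then obtain c where "u = (\<Sum>w\<in>W. hom (c w) * w)" by (auto simp: hom_span_def)
  then have "hom r * u = (\<Sum>w\<in>W. hom (r * c w) * w)" by (simp add: hom_mult sum_distrib_left mult.assoc)
  then show ?thesis by (auto simp: hom_span_def)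
qed

lemma hom_span_0: "0 \<in> hom_span hom W"
  by (auto simp: hom_span_def intro: exI[of _ "\<lambda>_. 0"])

lemma hom_span_sum: "(\<And>i. i \<in> A \<Longrightarrow> f i \<in> hom_span hom W) \<Longrightarrow> sum f A \<in> hom_span hom W"
  by (induction A rule: infinite_finite_induct) (auto simp: hom_span_0 hom_span_add)

lemma hom_span_base:
  assumes "finite W" "w \<in> W"
  shows "w \<in> hom_span hom W"
proof -
  have "(\<Sum>v\<in>W. hom (if v = w then 1 else 0) * v) = (\<Sum>v\<in>W. if v = w then v else 0)"
    by (rule sum.cong) auto
  also have "\<dots> = w" using assms by simp
  finally have "w = (\<Sum>v\<in>W. hom (if v = w then 1 else 0) * v)" by simp
  then show ?thesis unfolding hom_span_def by (intro CollectI exI conjI TrueI)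
qed

lemma hom_span_mult:
  assumes "\<And>w. w \<in> W \<Longrightarrow> u * w \<in> hom_span hom W" "v \<in> hom_span hom W"
  shows "u * v \<in> hom_span hom W"
proof -
  obtain c where "v = (\<Sum>w\<in>W. hom (c w) * w)" using assms(2) by (auto simp: hom_span_def)
  then have "u * v = (\<Sum>w\<in>W. hom (c w) * (u * w))" by (simp add: sum_distrib_left mult_ac)
  then show ?thesis using assms(1) by (auto intro: hom_span_sum hom_span_scale)
qed

end

text \<open>The determinant trick: an element that maps a finitely generated module into itself is an
  eigenvalue of a matrix with entries in the ring, so a root of its characteristic polynomial.\<close>

lemma integral_over_module:
  fixes \<phi> :: "'a::idom \<Rightarrow> 'b::field"
  assumes "comm_ring_hom \<phi>" and fin: "finite W" and w0: "w0 \<in> W" "w0 \<noteq> 0"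
    and stable: "\<And>w. w \<in> W \<Longrightarrow> u * w \<in> hom_span \<phi> W"
  shows "integral_over \<phi> u"
proof -
  interpret comm_ring_hom \<phi> by fact
  define n where "n = card W"
  obtain h where h: "bij_betw h {0..<n} W" using ex_bij_betw_nat_finite[OF fin] n_def by blast
  have "\<forall>w\<in>W. \<exists>c. u * w = (\<Sum>v\<in>W. \<phi> (c v) * v)"
    using stable by (auto simp: hom_span_def)
  then obtain c where c: "\<And>w. w \<in> W \<Longrightarrow> u * w = (\<Sum>v\<in>W. \<phi> (c w v) * v)" by metis
  define A where "A = Matrix.mat n n (\<lambda>(i, j). c (h i) (h j))"
  define x where "x = Matrix.vec n h"
  have A: "A \<in> carrier_mat n n" by (simp add: A_def)
  have hW: "h i \<in> W" if "i < n" for i using h that by (auto simp: bij_betw_def)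
  have "map_mat \<phi> A *\<^sub>v x = u \<cdot>\<^sub>v x"
  proof (rule eq_vecI)
    show "dim_vec (map_mat \<phi> A *\<^sub>v x) = dim_vec (u \<cdot>\<^sub>v x)" by (simp add: A_def x_def)
    fix i assume "i < dim_vec (u \<cdot>\<^sub>v x)"
    then have i: "i < n" by (simp add: x_def)
    have "Matrix.vec_index (map_mat \<phi> A *\<^sub>v x) i = (\<Sum>j\<in>{0..<n}. \<phi> (c (h i) (h j)) * h j)"
      using i by (simp add: A_def x_def scalar_prod_def)
    also have "\<dots> = (\<Sum>v\<in>W. \<phi> (c (h i) v) * v)"
      by (rule sum.reindex_bij_betw[OF h])
    also have "\<dots> = u * h i" using c[OF hW[OF i]] by simp
    finally show "Matrix.vec_index (map_mat \<phi> A *\<^sub>v x) i = Matrix.vec_index (u \<cdot>\<^sub>v x) i" using i by (simp add: x_def)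
  qed
  moreover have "x \<noteq> 0\<^sub>v n"
  proof -
    obtain i where "i < n" "h i = w0" using h w0 by (auto simp: bij_betw_def image_iff)
    then have "Matrix.vec_index x i \<noteq> Matrix.vec_index (0\<^sub>v n) i" using w0 by (simp add: x_def)
    then show ?thesis by metis
  qed
  ultimately have "eigenvalue (map_mat \<phi> A) u"
    unfolding eigenvalue_def eigenvector_def using A by (intro exI[of _ x]) (auto simp: x_def)
  then have "poly (char_poly (map_mat \<phi> A)) u = 0"
    using A by (subst (asm) eigenvalue_root_char_poly[of _ n]) auto
  then have "poly (map_poly \<phi> (char_poly A)) u = 0"
    by (simp add: char_poly_hom[OF A])
  moreover have "Polynomial.lead_coeff (char_poly A) = 1"
    using degree_monic_char_poly[OF A] by simp
  ultimately show ?thesis unfolding integral_over_def by blast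
qed

text \<open>The monomials \<open>u\<^sup>i v\<^sup>j\<close> with exponents below the degrees of monic equations of \<open>u\<close> and \<open>v\<close> span such a
  module.\<close>

lemma integral_over_common_module:
  fixes \<phi> :: "'a::idom \<Rightarrow> 'b::field"
  assumes "comm_ring_hom \<phi>" "integral_over \<phi> u" "integral_over \<phi> v"
  obtains W where "finite W" "1 \<in> W" "\<And>w. w \<in> W \<Longrightarrow> u * w \<in> hom_span \<phi> W"
    "\<And>w. w \<in> W \<Longrightarrow> v * w \<in> hom_span \<phi> W"
proof -
  interpret comm_ring_hom \<phi> by fact
  have pos: "Polynomial.degree f > 0" and top: "x ^ Polynomial.degree f = (\<Sum>i<Polynomial.degree f. \<phi> (- Polynomial.coeff f i) * x ^ i)"
    if "Polynomial.lead_coeff f = 1" "poly (map_poly \<phi> f) x = 0" for f and x :: 'b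
  proof -
    have "Polynomial.degree (map_poly \<phi> f) = Polynomial.degree f"
      by (rule degree_map_poly) (use that(1) in auto)
    then have "(\<Sum>i\<le>Polynomial.degree f. \<phi> (Polynomial.coeff f i) * x ^ i) = 0"
      using that(2) by (simp add: poly_altdef coeff_map_poly)
    also have "{..Polynomial.degree f} = insert (Polynomial.degree f) {..<Polynomial.degree f}" by auto
    finally have *: "x ^ Polynomial.degree f + (\<Sum>i<Polynomial.degree f. \<phi> (Polynomial.coeff f i) * x ^ i) = 0"
      using that(1) by simp
    then show "x ^ Polynomial.degree f = (\<Sum>i<Polynomial.degree f. \<phi> (- Polynomial.coeff f i) * x ^ i)"
      by (simp add: hom_uminus sum_negf eq_neg_iff_add_eq_0)
    show "Polynomial.degree f > 0" using * by (cases "Polynomial.degree f") auto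
  qed
  obtain f g where f: "Polynomial.lead_coeff f = 1" "poly (map_poly \<phi> f) u = 0"
    and g: "Polynomial.lead_coeff g = 1" "poly (map_poly \<phi> g) v = 0"
    using assms(2,3) by (auto simp: integral_over_def)
  define d e where "d = Polynomial.degree f" and "e = Polynomial.degree g"
  define W where "W = (\<lambda>(i, j). u ^ i * v ^ j) ` ({..<d} \<times> {..<e})"
  have fin: "finite W" by (simp add: W_def)
  have "u ^ 0 * v ^ 0 \<in> W" using pos[OF f] pos[OF g] unfolding W_def d_def e_def by force
  then have "1 \<in> W" by simp
  have base: "u ^ i * v ^ j \<in> hom_span \<phi> W" if "i < d" "j < e" for i j
    by (rule hom_span_base[OF fin]) (use that in \<open>auto simp: W_def\<close>)
  have U: "u * (u ^ i * v ^ j) \<in> hom_span \<phi> W" if "i < d" "j < e" for i j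
  proof (cases "Suc i < d")
    case True
    then show ?thesis using base[of "Suc i" j] that by (simp add: mult_ac)
  next
    case False
    then have "d = Suc i" using that by simp
    then have "u * (u ^ i * v ^ j) = u ^ d * v ^ j" by (simp add: mult_ac)
    also have "\<dots> = (\<Sum>k<d. \<phi> (- Polynomial.coeff f k) * (u ^ k * v ^ j))"
      by (subst top[OF f, folded d_def]) (simp add: sum_distrib_right sum_distrib_left mult_ac)
    finally show ?thesis using base that by (auto intro!: hom_span_sum hom_span_scale)
  qed
  have V: "v * (u ^ i * v ^ j) \<in> hom_span \<phi> W" if "i < d" "j < e" for i j
  proof (cases "Suc j < e")
    case True
    then show ?thesis using base[of i "Suc j"] that by (simp add: mult_ac)
  next
    case False
    then have "e = Suc j" using that by simp
    then have "v * (u ^ i * v ^ j) = v ^ e * u ^ i" by (simp add: mult_ac)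
    also have "\<dots> = (\<Sum>k<e. \<phi> (- Polynomial.coeff g k) * (u ^ i * v ^ k))"
      by (subst top[OF g, folded e_def]) (simp add: sum_distrib_right sum_distrib_left mult_ac)
    finally show ?thesis using base that by (auto intro!: hom_span_sum hom_span_scale)
  qed
  show ?thesis
    by (rule that[OF fin \<open>1 \<in> W\<close>]) (auto simp: W_def intro: U[unfolded W_def] V[unfolded W_def])
qed

lemma integral_over_ring:
  fixes \<phi> :: "'a::idom \<Rightarrow> 'b::field"
  assumes hom: "comm_ring_hom \<phi>"
  shows integral_over_add: "integral_over \<phi> u \<Longrightarrow> integral_over \<phi> v \<Longrightarrow> integral_over \<phi> (u + v)"
    and integral_over_mult: "integral_over \<phi> u \<Longrightarrow> integral_over \<phi> v \<Longrightarrow> integral_over \<phi> (u * v)"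
    and integral_over_hom: "integral_over \<phi> (\<phi> r)"
    and integral_over_uminus: "integral_over \<phi> u \<Longrightarrow> integral_over \<phi> (- u)"
    and integral_over_diff: "integral_over \<phi> u \<Longrightarrow> integral_over \<phi> v \<Longrightarrow> integral_over \<phi> (u - v)"
    and integral_over_of_int: "integral_over \<phi> (of_int k)"
    and integral_over_power: "integral_over \<phi> u \<Longrightarrow> integral_over \<phi> (u ^ i)"
proof -
  interpret comm_ring_hom \<phi> by fact
  show add: "integral_over \<phi> (u + v)" if uv: "integral_over \<phi> u" "integral_over \<phi> v" for u v
  proof -
    from integral_over_common_module[OF hom uv]
    obtain W where W: "finite W" "1 \<in> W" "\<And>w. w \<in> W \<Longrightarrow> u * w \<in> hom_span \<phi> W"
      "\<And>w. w \<in> W \<Longrightarrow> v * w \<in> hom_span \<phi> W" by blast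
    show ?thesis
      by (rule integral_over_module[OF hom W(1,2)]) (auto simp: distrib_right intro: hom_span_add W)
  qed
  show mult: "integral_over \<phi> (u * v)" if uv: "integral_over \<phi> u" "integral_over \<phi> v" for u v
  proof -
    from integral_over_common_module[OF hom uv]
    obtain W where W: "finite W" "1 \<in> W" "\<And>w. w \<in> W \<Longrightarrow> u * w \<in> hom_span \<phi> W"
      "\<And>w. w \<in> W \<Longrightarrow> v * w \<in> hom_span \<phi> W" by blast
    show ?thesis
      by (rule integral_over_module[OF hom W(1,2)]) (auto simp: mult.assoc intro: hom_span_mult W)
  qed
  show h: "integral_over \<phi> (\<phi> r)" for r
    unfolding integral_over_def by (rule exI[of _ "[:- r, 1:]"]) (simp add: hom_uminus)
  show um: "integral_over \<phi> (- u)" if "integral_over \<phi> u" for u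
    using mult[OF h[of "- 1"] that] by (simp add: hom_uminus)
  show "integral_over \<phi> (u - v)" if "integral_over \<phi> u" "integral_over \<phi> v" for u v
    using add[OF that(1) um[OF that(2)]] by simp
  show "integral_over \<phi> (of_int k)" using h[of "of_int k"] by (simp add: hom_of_int)
  show "integral_over \<phi> u \<Longrightarrow> integral_over \<phi> (u ^ i)"
    using h[of 1] mult by (induction i) auto
qed

lemma integral_over_eval:
  fixes \<phi> :: "'a::idom \<Rightarrow> 'b::field"
  assumes hom: "comm_ring_hom \<phi>" and "\<And>v. integral_over \<phi> (p v)"
  shows "integral_over \<phi> (eval p f)"
proof (induction f rule: zpoly_induct)
  case (int k)
  then show ?case by (simp add: eval_hom.hom_of_int integral_over_of_int[OF hom])
next
  case (Var v)
  then show ?case by (simp add: eval_Var assms)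
next
  case (add f g)
  then show ?case by (simp add: eval_add integral_over_add[OF hom])
next
  case (mult f g)
  then show ?case by (simp add: eval_mult integral_over_mult[OF hom])
qed

lemma of_int_comm_ring_hom: "comm_ring_hom (of_int :: int \<Rightarrow> 'a::comm_ring_1)"
  by unfold_locales auto

lemma of_rat_comm_ring_hom: "comm_ring_hom (of_rat :: rat \<Rightarrow> 'a::field_char_0)"
  by unfold_locales (auto simp: of_rat_add of_rat_mult)

lemma algebraic_int_iff: "algebraic_int (u :: complex) \<longleftrightarrow> integral_over (of_int :: int \<Rightarrow> complex) u"
  by (auto simp: integral_over_def algebraic_int_altdef_ipoly)

lemma algebraic_iff: "algebraic (u :: complex) \<longleftrightarrow> integral_over (of_rat :: rat \<Rightarrow> complex) u"
proof
  interpret of_rat: comm_ring_hom "of_rat :: rat \<Rightarrow> complex" by (rule of_rat_comm_ring_hom)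
  assume "algebraic u"
  then obtain p where p: "\<forall>i. Polynomial.coeff p i \<in> \<rat>" "p \<noteq> 0" "poly p u = 0" by (auto simp: algebraic_altdef)
  then obtain g where g: "\<And>i. Polynomial.coeff p i = of_rat (g i)" by (auto simp: Rats_def image_iff) metis
  define q where "q = map_poly (\<lambda>c. inv_into UNIV of_rat c) p"
  have "inv_into UNIV of_rat (of_rat x :: complex) = x" for x by (simp add: inj_on_def inv_f_f)
  moreover have "inv_into UNIV of_rat (0::complex) = 0" using \<open>inv_into UNIV of_rat (of_rat 0 :: complex) = 0\<close> by simp
  ultimately have pq: "p = map_poly of_rat q"
    by (intro poly_eqI) (simp add: q_def coeff_map_poly g)
  have q0: "q \<noteq> 0" using p(2) pq by auto
  define f where "f = Polynomial.smult (inverse (Polynomial.lead_coeff q)) q"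
  have "Polynomial.lead_coeff f = 1" using q0 by (simp add: f_def)
  moreover have "poly (map_poly of_rat f) u = 0"
  proof -
    have "map_poly of_rat f = Polynomial.smult (of_rat (inverse (Polynomial.lead_coeff q))) (map_poly of_rat q :: complex poly)"
      by (rule poly_eqI) (simp add: f_def coeff_map_poly of_rat_mult)
    then show ?thesis using p(3) by (simp add: pq)
  qed
  ultimately show "integral_over of_rat u" unfolding integral_over_def by blast
next
  assume "integral_over (of_rat :: rat \<Rightarrow> complex) u"
  then obtain f :: "rat poly" where f: "Polynomial.lead_coeff f = 1" "poly (map_poly of_rat f) u = 0"
    by (auto simp: integral_over_def)
  then have "Polynomial.coeff (map_poly of_rat f :: complex poly) (Polynomial.degree f) = 1" by (simp add: coeff_map_poly)
  then have "(map_poly of_rat f :: complex poly) \<noteq> 0" by auto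
  then show "algebraic u" using f(2)
    by (auto simp: algebraic_altdef coeff_map_poly intro!: exI[of _ "map_poly of_rat f"])
qed

lemma algebraic_add: "algebraic u \<Longrightarrow> algebraic v \<Longrightarrow> algebraic (u + v :: complex)"
  and algebraic_mult: "algebraic u \<Longrightarrow> algebraic v \<Longrightarrow> algebraic (u * v :: complex)"
  and algebraic_power: "algebraic u \<Longrightarrow> algebraic (u ^ k :: complex)"
  and algebraic_eval: "(\<And>v. algebraic (p v)) \<Longrightarrow> algebraic (eval p f :: complex)"
  unfolding algebraic_iff
  by (auto intro: integral_over_ring[OF of_rat_comm_ring_hom] integral_over_eval[OF of_rat_comm_ring_hom])

lemma algebraic_divide: "algebraic u \<Longrightarrow> algebraic v \<Longrightarrow> algebraic (u / v :: complex)"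
  unfolding divide_inverse by (intro algebraic_mult algebraic_inverse)

section \<open>The closure of the l-adic numbers\<close>

lemma Rep_adic_int_of_nat:
  "Rep_adic_int (of_nat n :: 'p::prime_card adic_int) k = int n mod int CARD('p) ^ k"
proof (induction n)
  case 0
  show ?case by (simp add: zero_adic_int.rep_eq)
next
  case (Suc n)
  then show ?case by (simp add: plus_adic_int.rep_eq one_adic_int.rep_eq mod_simps)
qed

instance adic_int :: (prime_card) ring_char_0
proof
  show "inj (of_nat :: nat \<Rightarrow> 'a adic_int)"
  proof (rule injI, rule ccontr)
    fix a b assume eq: "(of_nat a :: 'a adic_int) = of_nat b" and ne: "a \<noteq> b"
    have "1 < CARD('a)" using prime_card[where 'a = 'a] prime_gt_1_nat by blast
    define k where "k = a + b"
    have lt: "n < CARD('a) ^ n" for n using \<open>1 < CARD('a)\<close> by (simp add: power_gt_expt)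
    have "CARD('a) ^ k > k" by (rule lt)
    moreover have "a \<le> k" "b \<le> k" by (simp_all add: k_def)
    ultimately have "a < CARD('a) ^ k" "b < CARD('a) ^ k" by (blast intro: le_less_trans)+
    then have "int a < int CARD('a) ^ k" "int b < int CARD('a) ^ k"
      by (simp_all only: of_nat_power[symmetric] of_nat_less_iff)
    then have "int a mod int CARD('a) ^ k = int a" "int b mod int CARD('a) ^ k = int b"
      by (auto intro: mod_pos_pos_trivial)
    moreover have "int a mod int CARD('a) ^ k = int b mod int CARD('a) ^ k"
      by (simp only: Rep_adic_int_of_nat[symmetric] eq)
    ultimately show False using ne by linarith
  qed
qed

instance fract :: ("{idom,ring_char_0}") field_char_0
proof
  show "inj (of_nat :: nat \<Rightarrow> 'a fract)"
    by (rule injI) (simp add: of_nat_fract eq_fract)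
qed

interpretation adic_embed: comm_ring_hom adic_embed
  by unfold_locales (auto simp: adic_embed_def One_fract_def[symmetric] Zero_fract_def[symmetric]
      to_ac_add[symmetric] to_ac_mult[symmetric])

lemma adic_embed_of_nat: "adic_embed (of_nat n) = of_nat n"
  by (induction n) (simp_all add: adic_embed.hom_add)

lemma adic_embed_inj: "adic_embed a = adic_embed b \<longleftrightarrow> a = b"
  by (simp add: adic_embed_def eq_fract)

lemma adic_integers_iff: "u \<in> adic_integers \<longleftrightarrow> integral_over adic_embed u"
  by (simp add: adic_integers_def integral_over_def)

lemmas adic_integral = integral_over_ring[OF adic_embed.comm_ring_hom_axioms, folded adic_integers_iff]

lemma adic_int_prime_nonunit: "of_nat CARD('p) * (c :: 'p::prime_card adic_int) \<noteq> 1"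
proof
  assume eq: "of_nat CARD('p) * c = 1"
  have "Rep_adic_int (of_nat CARD('p) * c) 1 = 0" by (simp add: times_adic_int.rep_eq Rep_adic_int_of_nat)
  moreover have "Rep_adic_int (1 :: 'p adic_int) 1 = 1"
    using prime_card[where 'a = 'p] prime_gt_1_nat by (simp add: one_adic_int.rep_eq)
  ultimately show False using eq by simp
qed

text \<open>A monic equation for \<open>1/l\<close>, multiplied by a power of \<open>l\<close>, would make \<open>l\<close> a unit of the \<open>l\<close>-adic integers.\<close>

lemma inverse_prime_not_integral:
  fixes c :: "'p::prime_card adic_closure"
  assumes "of_nat CARD('p) * c = 1"
  shows "c \<notin> adic_integers"
proof
  let ?l = "of_nat CARD('p)"
  assume "c \<in> adic_integers"
  then obtain f :: "'p adic_int poly" where f: "Polynomial.lead_coeff f = 1" "poly (map_poly adic_embed f) c = 0"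
    by (auto simp: adic_integers_def)
  define n where "n = Polynomial.degree f"
  have lead: "Polynomial.coeff f n = 1" using f(1) by (simp add: n_def)
  have deg: "Polynomial.degree (map_poly adic_embed f) = n"
    unfolding n_def by (rule degree_map_poly) (use f(1) in auto)
  have "0 = ?l ^ n * (\<Sum>i\<le>n. adic_embed (Polynomial.coeff f i) * c ^ i)"
    using f(2) by (simp add: poly_altdef deg coeff_map_poly)
  also have "\<dots> = (\<Sum>i\<le>n. adic_embed (Polynomial.coeff f i * ?l ^ (n - i)))"
    unfolding sum_distrib_left
  proof (rule sum.cong)
    fix i assume "i \<in> {..n}"
    then have "?l ^ n = (?l ^ (n - i) * ?l ^ i :: 'p adic_closure)" by (simp add: power_add[symmetric])
    then have "?l ^ n * (adic_embed (Polynomial.coeff f i) * c ^ i) = adic_embed (Polynomial.coeff f i) * ?l ^ (n - i) * (?l * c) ^ i"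
      by (simp add: power_mult_distrib mult_ac)
    then show "?l ^ n * (adic_embed (Polynomial.coeff f i) * c ^ i) = adic_embed (Polynomial.coeff f i * ?l ^ (n - i))"
      using assms by (simp add: adic_embed.hom_mult adic_embed.hom_power adic_embed_of_nat)
  qed simp
  finally have "adic_embed (\<Sum>i\<le>n. Polynomial.coeff f i * ?l ^ (n - i)) = adic_embed 0"
    by (simp add: adic_embed.hom_sum)
  then have "0 = (\<Sum>i\<le>n. Polynomial.coeff f i * ?l ^ (n - i))" by (simp only: adic_embed_inj)
  also have "{..n} = insert n {..<n}" by auto
  also have "(\<Sum>i\<in>insert n {..<n}. Polynomial.coeff f i * ?l ^ (n - i)) = 1 + (\<Sum>i<n. Polynomial.coeff f i * ?l ^ (n - i))"
    using lead by simp
  also have "(\<Sum>i<n. Polynomial.coeff f i * ?l ^ (n - i)) = ?l * (\<Sum>i<n. Polynomial.coeff f i * ?l ^ (n - i - 1))"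
    unfolding sum_distrib_left
  proof (rule sum.cong)
    fix i assume "i \<in> {..<n}"
    then obtain k where "n - i = Suc k" by (cases "n - i") auto
    then have "?l ^ (n - i) = (?l * ?l ^ (n - i - 1) :: 'p adic_int)" by simp
    then show "Polynomial.coeff f i * ?l ^ (n - i) = ?l * (Polynomial.coeff f i * ?l ^ (n - i - 1))" by (simp add: mult_ac)
  qed simp
  finally have "?l * (- (\<Sum>i<n. Polynomial.coeff f i * ?l ^ (n - i - 1))) = 1"
    by (simp add: add_eq_0_iff)
  then show False using adic_int_prime_nonunit by blast
qed

section \<open>Polynomials that vanish on the two families\<close>

lemma poly_map_poly_hom:
  assumes "comm_ring_hom \<phi>"
  shows "comm_ring_hom (\<lambda>g. poly (map_poly \<phi> g) y)"
proof -
  interpret comm_ring_hom \<phi> by fact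
  interpret m: map_poly_comm_ring_hom \<phi> ..
  show ?thesis by unfold_locales (auto simp: m.hom_add m.hom_mult)
qed

definition ev1 :: "int poly \<Rightarrow> 'a::comm_ring_1 \<Rightarrow> 'a" where
  "ev1 f x = poly (map_poly of_int f) x"

definition ev2 :: "int poly poly \<Rightarrow> 'a::comm_ring_1 \<Rightarrow> 'a \<Rightarrow> 'a" where
  "ev2 g x y = poly (map_poly (\<lambda>f. ev1 f x) g) y"

lemma ev1_hom: "comm_ring_hom (\<lambda>f. ev1 f x)"
  unfolding ev1_def by (rule poly_map_poly_hom[OF of_int_comm_ring_hom])

lemma ev2_hom: "comm_ring_hom (\<lambda>g. ev2 g x y)"
  unfolding ev2_def by (rule poly_map_poly_hom[OF ev1_hom])

interpretation ev1: comm_ring_hom "\<lambda>f. ev1 f x" by (rule ev1_hom)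
interpretation ev2: comm_ring_hom "\<lambda>g. ev2 g x y" by (rule ev2_hom)

lemma ev1_X: "ev1 [:0, 1:] x = x" unfolding ev1_def by simp
lemma ev1_X': "ev1 (pCons 0 1) x = x" unfolding ev1_def by simp
lemma ev1_pCons: "ev1 (pCons a g) x = of_int a + x * ev1 g x"
proof -
  have "pCons a g = of_int a + [:0, 1:] * g" by (simp add: of_int_poly)
  then show ?thesis by (simp only: ev1.hom_add ev1.hom_mult ev1_X ev1.hom_of_int)
qed

lemma ev2_X: "ev2 [:[:0, 1:]:] x y = x" and ev2_Y: "ev2 [:0, 1:] x y = y"
  by (simp_all add: ev2_def map_poly_pCons ev1_X ev1_X' ev1.hom_one ev1.hom_zero)

lemma poly_map_as_sum:
  fixes \<phi> :: "'a::zero \<Rightarrow> 'b::comm_ring_1"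
  assumes "\<phi> 0 = 0"
  shows "poly (map_poly \<phi> g) y = (\<Sum>i\<le>Polynomial.degree g. \<phi> (Polynomial.coeff g i) * y ^ i)"
proof -
  have "poly (map_poly \<phi> g) y = (\<Sum>i\<le>Polynomial.degree (map_poly \<phi> g). \<phi> (Polynomial.coeff g i) * y ^ i)"
    unfolding poly_altdef using coeff_map_poly[of \<phi> g, OF assms] by simp
  also have "\<dots> = (\<Sum>i\<le>Polynomial.degree g. \<phi> (Polynomial.coeff g i) * y ^ i)"
    by (rule sum.mono_neutral_left)
      (auto simp: coeff_map_poly[of \<phi> g, OF assms, symmetric] intro: order_trans[OF _ degree_map_poly_le] coeff_eq_0 le_degree)
  finally show ?thesis .
qed

lemma ev1_sum: "ev1 f x = (\<Sum>i\<le>Polynomial.degree f. of_int (Polynomial.coeff f i) * x ^ i)"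
  unfolding ev1_def by (rule poly_map_as_sum) simp

lemma (in comm_ring_hom) hom_ev1: "hom (ev1 f x) = ev1 f (hom x)"
  by (simp add: ev1_sum hom_sum hom_mult hom_power hom_of_int)

lemma ev2_sum: "ev2 g x y = (\<Sum>i\<le>Polynomial.degree g. ev1 (Polynomial.coeff g i) x * y ^ i)"
  unfolding ev2_def by (rule poly_map_as_sum) (rule ev1.hom_zero)

lemma (in comm_ring_hom) hom_ev2: "hom (ev2 g x y) = ev2 g (hom x) (hom y)"
  by (simp add: ev2_sum hom_sum hom_mult hom_power hom_ev1)

lemma vanishing_poly_zero:
  fixes f :: "complex poly"
  assumes "finite S" "\<And>x. x \<in> S \<Longrightarrow> poly f x = 0" "f = 0 \<or> Polynomial.degree f < card S"
  shows "f = 0"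
proof (rule ccontr)
  assume f: "f \<noteq> 0"
  have "card S \<le> card {x. poly f x = 0}"
    using assms poly_roots_finite[OF f] by (intro card_mono) auto
  also have "\<dots> \<le> Polynomial.degree f" using f by (rule card_poly_roots_bound)
  finally show False using assms(3) f by auto
qed

lemma monic_division:
  fixes f b :: "'a::idom poly"
  assumes "Polynomial.lead_coeff b = 1"
  obtains q r where "f = b * q + r" "r = 0 \<or> Polynomial.degree r < Polynomial.degree b"
proof -
  obtain q r where qr: "pseudo_divmod f b = (q, r)" by force
  have "b \<noteq> 0" using assms by auto
  from pseudo_divmod[OF this qr] show ?thesis using that assms by auto
qed

text \<open>Dividing by both monic polynomials leaves a remainder whose degree in each variable is smaller than the
  number of zeros on the grid, so the remainder is zero.\<close>

lemma grid_division:
  fixes a b :: "int poly" and S T :: "complex set" and J :: "'a::comm_ring_1 set"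
  assumes J: "is_ideal J" and a: "Polynomial.lead_coeff a = 1" "ev1 a X0 \<in> J"
    and b: "Polynomial.lead_coeff b = 1" "ev1 b Y0 \<in> J"
    and S: "finite S" "Polynomial.degree a \<le> card S" "\<And>x. x \<in> S \<Longrightarrow> ev1 a x = 0"
    and T: "finite T" "Polynomial.degree b \<le> card T" "\<And>y. y \<in> T \<Longrightarrow> ev1 b y = 0"
    and g: "\<And>x y. x \<in> S \<Longrightarrow> y \<in> T \<Longrightarrow> ev2 g x y = 0"
  shows "ev2 g X0 Y0 \<in> J"
proof -
  define B where "B = map_poly (\<lambda>c. [:c:]) b"
  have B: "Polynomial.lead_coeff B = 1" "Polynomial.degree B = Polynomial.degree b"
    using b(1) by (auto simp: B_def coeff_map_poly degree_map_poly)
  have evB: "ev2 B x y = ev1 b y" for x y :: "'b::comm_ring_1"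
    by (simp add: ev2_sum B(2)) (simp add: B_def ev1_sum coeff_map_poly)
  obtain q r where gq: "g = B * q + r" and r: "r = 0 \<or> Polynomial.degree r < Polynomial.degree B"
    using monic_division[OF B(1)] .
  have zero: "ev1 (Polynomial.coeff r i) x = 0" if x: "x \<in> S" for i and x :: complex
  proof -
    have "map_poly (\<lambda>f. ev1 f x) r = 0"
    proof (rule vanishing_poly_zero[OF T(1)])
      show "poly (map_poly (\<lambda>f. ev1 f x) r) y = 0" if y: "y \<in> T" for y
        using g[OF x y] T(3)[OF y] unfolding gq by (simp add: ev2.hom_add ev2.hom_mult evB) (simp add: ev2_def)
      show "map_poly (\<lambda>f. ev1 f x) r = 0 \<or> Polynomial.degree (map_poly (\<lambda>f. ev1 f x) r) < card T"
        using r B(2) T(2) degree_map_poly_le[of "\<lambda>f. ev1 f x" r] by auto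
    qed
    then have "Polynomial.coeff (map_poly (\<lambda>f. ev1 f x) r) i = 0" by simp
    then show ?thesis by (simp add: coeff_map_poly ev1.hom_zero)
  qed
  have "ev1 (Polynomial.coeff r i) X0 \<in> J" for i
  proof -
    obtain q' r' where rq: "Polynomial.coeff r i = a * q' + r'" and r': "r' = 0 \<or> Polynomial.degree r' < Polynomial.degree a"
      using monic_division[OF a(1)] .
    have "(map_poly of_int r' :: complex poly) = 0"
    proof (rule vanishing_poly_zero[OF S(1)])
      show "poly (map_poly of_int r') x = 0" if x: "x \<in> S" for x :: complex
        using zero[OF x, of i] S(3)[OF x] unfolding rq by (simp add: ev1.hom_add ev1.hom_mult flip: ev1_def)
      show "(map_poly of_int r' :: complex poly) = 0 \<or> Polynomial.degree (map_poly of_int r' :: complex poly) < card S"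
        using r' S(2) degree_map_poly_le[of "of_int :: int \<Rightarrow> complex" r'] by auto
    qed
    then have "r' = 0" by (metis of_int_poly_hom.hom_0_iff)
    then show ?thesis unfolding rq by (simp add: ev1.hom_mult ideal_mult_r[OF J a(2)])
  qed
  then have "ev2 r X0 Y0 \<in> J" unfolding ev2_sum by (intro ideal_sum[OF J] ideal_mult_r[OF J])
  then show ?thesis unfolding gq
    by (simp add: ev2.hom_add ev2.hom_mult evB ideal_add[OF J] ideal_mult_r[OF J b(2)])
qed

lemma cpol_poly:
  "Polynomial.degree (cpol (1 + int n) [:0, 1:] :: int poly) = n \<and>
   Polynomial.lead_coeff (cpol (1 + int n) [:0, 1:] :: int poly) = 1"
proof -
  let ?c = "\<lambda>n. cpol (int n) [:0, 1:] :: int poly"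
  have rec: "?c (Suc (Suc n)) = [:0, 1:] * ?c (Suc n) - ?c n" for n
  proof -
    have "int (Suc (Suc n)) = int n + 1 + 1" "int (Suc n) = int n + 1" by auto
    then show ?thesis by (simp only: cpol_rec dpol_rec)
  qed
  have "(\<forall>i>n. Polynomial.coeff (?c (Suc n)) i = 0) \<and> Polynomial.coeff (?c (Suc n)) n = 1 \<and>
     (\<forall>i\<ge>n. Polynomial.coeff (?c n) i = 0)"
  proof (induction n)
    case 0
    show ?case by (auto simp: cpol_1 cpol_0 coeff_eq_0)
  next
    case (Suc n)
    have "Polynomial.coeff (?c (Suc (Suc n))) i = (if i = 0 then 0 else Polynomial.coeff (?c (Suc n)) (i - 1)) - Polynomial.coeff (?c n) i" for i
      unfolding rec by (cases i) auto
    then show ?case using Suc by auto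
  qed
  then have "\<forall>i>n. Polynomial.coeff (?c (Suc n)) i = 0" "Polynomial.coeff (?c (Suc n)) n = 1" by auto
  moreover from this have "Polynomial.degree (?c (Suc n)) = n"
    by (metis degree_le le_degree one_neq_zero order_antisym)
  ultimately show ?thesis by simp
qed

lemma cpol_ev1: "ev1 (cpol n [:0, 1:]) x = cpol n x"
  by (simp add: ev1.hom_cpol ev1_X ev1_X')

text \<open>The zeros of \<open>c\<^sub>n\<close> are \<open>2 cos(\<pi>j/n)\<close>: they come from the nonreal \<open>2n\<close>-th roots of unity.\<close>

lemma cpol_zeros:
  assumes "n \<noteq> 0"
  shows "\<exists>S :: complex set. finite S \<and> card S = nat \<bar>n\<bar> - 1 \<and>
    (\<forall>x\<in>S. cpol n x = 0 \<and> (\<exists>u. u \<notin> {0, 1, -1} \<and> x = u + inverse u))"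
proof -
  define k where "k = nat \<bar>n\<bar>"
  have k: "k > 0" "n = int k \<or> n = - int k" using assms by (auto simp: k_def)
  define h where "h = (\<lambda>j. 2 * cos (pi * real j / real k))"
  define S where "S = (\<lambda>j. complex_of_real (h j)) ` {1..<k}"
  have inj: "inj_on h {1..<k}"
  proof (rule inj_onI)
    fix i j assume ij: "i \<in> {1..<k}" "j \<in> {1..<k}" "h i = h j"
    have le: "pi * real l / real k \<le> pi" if "l \<in> {1..<k}" for l
      using that by (simp add: field_simps)
    have "pi * real i / real k = pi * real j / real k"
      by (rule cos_inj_pi) (use ij le in \<open>auto simp: h_def\<close>)
    then show "i = j" using k by simp
  qed
  have "card S = k - 1"
    unfolding S_def by (subst card_image) (use inj in \<open>auto simp: inj_on_def\<close>)
  moreover have "cpol n x = 0 \<and> (\<exists>u. u \<notin> {0, 1, -1} \<and> x = u + inverse u)" if "x \<in> S" for x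
  proof -
    obtain j where j: "1 \<le> j" "j < k" "x = complex_of_real (h j)" using \<open>x \<in> S\<close> by (auto simp: S_def)
    define a where "a = pi * real j / real k"
    define u where "u = cis a"
    have a: "0 < a" "a < pi" using j k by (auto simp: a_def field_simps)
    then have "sin a > 0" by (rule sin_gt_zero)
    then have im: "Im u > 0" by (simp add: u_def)
    then have u: "u \<notin> {0, 1, -1}" by auto
    have inv: "inverse u = cis (- a)" by (simp add: u_def)
    have x: "x = u + inverse u" by (simp add: inv u_def complex_eq_iff j(3) h_def a_def)
    have "u - inverse u \<noteq> 0" using im by (auto simp: inv u_def complex_eq_iff)
    have "u ^ (2 * k) = cis (real (2 * k) * a)" unfolding u_def by (rule Complex.DeMoivre)
    also have "real (2 * k) * a = 2 * pi * real j" using k by (simp add: a_def)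
    also have "cis (2 * pi * real j) = 1"
      by (rule cis_multiple_2pi) simp
    finally have "u ^ k * u ^ k = 1" by (simp add: mult_2 power_add)
    then have "u powi int k - u powi (- int k) = 0" using u by (simp add: power_int_minus divide_simps)
    then have "cpol (int k) x = 0"
      using cpol_powi[of u "int k"] u \<open>u - inverse u \<noteq> 0\<close> x by simp
    then show ?thesis using k(2) u x by (auto simp: cpol_uminus)
  qed
  moreover have "finite S" by (simp add: S_def)
  ultimately show ?thesis unfolding k_def by blast
qed

text \<open>The eigenvalues of \<open>A\<close> and \<open>B\<close> at a point of type \<open>e\<close>. The conditions on \<open>c\<close> say that \<open>A\<^bsup>n1\<^esup>\<close> and \<open>B\<^bsup>m1\<^esup>\<close> are not
  central, and that the denominators of \<open>z_value\<close> are not zero.\<close>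

definition type_roots :: "int \<Rightarrow> int \<Rightarrow> int \<Rightarrow> int \<Rightarrow> int \<Rightarrow> complex \<Rightarrow> complex \<Rightarrow> bool" where
  "type_roots n1 n2 m1 m2 e \<zeta> \<eta> \<longleftrightarrow>
     \<zeta> powi (n1 - n2) = - of_int e \<and> \<eta> powi (m1 - m2) = of_int e \<and>
     \<zeta> \<notin> {0, 1, -1} \<and> \<eta> \<notin> {0, 1, -1} \<and>
     cpol n1 (\<zeta> + inverse \<zeta>) \<noteq> 0 \<and> cpol m1 (\<eta> + inverse \<eta>) \<noteq> 0"

lemma root_diff_nonzero: "u \<notin> {0, 1, -1} \<Longrightarrow> u - inverse u \<noteq> (0 :: 'a::field)"
  by (auto simp: field_simps square_eq_1_iff)

lemma cpol_nonzero_iff: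
  fixes u :: complex
  assumes "u \<notin> {0, 1, -1}"
  shows "u powi n - u powi (- n) \<noteq> 0 \<longleftrightarrow> cpol n (u + inverse u) \<noteq> 0"
  using cpol_powi[of u n] root_diff_nonzero[OF assms] assms by auto

lemma root_choice_iff_9:
  assumes "m1 \<noteq> 0"
  shows "root_choice n1 n2 m1 m2 \<zeta> \<eta> \<longleftrightarrow> type_roots n1 n2 m1 m2 1 \<zeta> \<eta>"
proof -
  have p2: "\<zeta> powi (2 * k) = (\<zeta> powi k)\<^sup>2" for k
    by (simp add: power_int_mult mult.commute[of 2])
  have "\<zeta> powi (2 * (n1 - n2)) = 1 \<and> \<zeta> powi (n1 - n2) \<noteq> 1 \<longleftrightarrow> \<zeta> powi (n1 - n2) = -1"
    using p2[of "n1 - n2"] by (auto simp: power2_eq_1_iff)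
  moreover have "root_choice n1 n2 m1 m2 \<zeta> \<eta> \<Longrightarrow> \<zeta> \<noteq> 0 \<and> \<eta> \<noteq> 0"
    using assms by (auto simp: root_choice_def power_int_0_left_if split: if_splits)
  moreover have "\<zeta> powi n1 - \<zeta> powi (- n1) \<noteq> 0 \<longleftrightarrow> cpol n1 (\<zeta> + inverse \<zeta>) \<noteq> 0"
    "\<eta> powi m1 - \<eta> powi (- m1) \<noteq> 0 \<longleftrightarrow> cpol m1 (\<eta> + inverse \<eta>) \<noteq> 0"
    if "\<zeta> \<notin> {0, 1, -1}" "\<eta> \<notin> {0, 1, -1}"
    using cpol_nonzero_iff that by blast+
  ultimately show ?thesis
    unfolding root_choice_def type_roots_def of_int_1 insert_iff empty_iff by blast
qed

lemma root_choice_iff_10: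
  assumes "n1 \<noteq> 0"
  shows "root_choice m1 m2 n1 n2 \<eta> \<zeta> \<longleftrightarrow> type_roots n1 n2 m1 m2 (-1) \<zeta> \<eta>"
  using root_choice_iff_9[OF assms, of m1 m2 n2 \<eta> \<zeta>] by (auto simp: type_roots_def)

lemma z_value_swap: "z_value m n \<eta> \<zeta> = z_value n m \<zeta> \<eta>"
  by (simp add: z_value_def mult_ac)

text \<open>The quotients in \<open>z_value\<close> are quotients of consecutive \<open>c\<close>, since \<open>c\<^sub>n (\<zeta> - \<zeta>\<^sup>-\<^sup>1) = \<zeta>\<^sup>n - \<zeta>\<^sup>-\<^sup>n\<close>. So the
  formula is the solution of an equation linear in \<open>z\<close>.\<close>

lemma rel_poly_z_value:
  assumes "\<zeta> \<notin> {0, 1, -1}" "\<eta> \<notin> {0, 1, -1}"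
    "cpol n (\<zeta> + inverse \<zeta>) \<noteq> 0" "cpol m (\<eta> + inverse \<eta>) \<noteq> 0"
  shows "rel_poly n m (\<zeta> + inverse \<zeta>) (\<eta> + inverse \<eta>) z = 0 \<longleftrightarrow> z = z_value n m \<zeta> \<eta>"
proof -
  define x y where "x = \<zeta> + inverse \<zeta>" and "y = \<eta> + inverse \<eta>"
  have q: "(u powi k - u powi (- k)) / (u powi l - u powi (- l)) = cpol k (u + inverse u) / cpol l (u + inverse u)"
    if "u \<notin> {0, 1, -1}" for u :: complex and k l
    using cpol_powi[of u k] cpol_powi[of u l] root_diff_nonzero[OF that] that
    by (metis insertCI mult_divide_mult_cancel_right)
  have c: "cpol n x \<noteq> 0" "cpol m y \<noteq> 0" using assms by (auto simp: x_def y_def)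
  have fr: "(a / p * (b / q) + c / q * (d / p)) * (p * q) = a * b + c * d"
    if "p \<noteq> 0" "q \<noteq> 0" for a b c d p q :: complex
    using that by (simp add: field_simps)
  have "z_value n m \<zeta> \<eta> = cpol (n + 1) x / cpol n x * (cpol (m - 1) y / cpol m y)
      + cpol (m + 1) y / cpol m y * (cpol (n - 1) x / cpol n x)"
    unfolding z_value_def x_def y_def by (simp only: q[OF assms(1)] q[OF assms(2)])
  then have eq: "z_value n m \<zeta> \<eta> * (cpol n x * cpol m y) =
      (x * cpol n x + dpol n x) * (- dpol m y) + (y * cpol m y + dpol m y) * (- dpol n x)"
    unfolding cpol_rec cpol_rec' by (simp only: fr[OF c])
  have "rel_poly n m x y z = z * (cpol n x * cpol m y) -
      ((x * cpol n x + dpol n x) * (- dpol m y) + (y * cpol m y + dpol m y) * (- dpol n x))"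
    by (simp add: rel_poly_def algebra_simps)
  then have "rel_poly n m x y z = (z - z_value n m \<zeta> \<eta>) * (cpol n x * cpol m y)"
    unfolding eq[symmetric] by (simp add: algebra_simps)
  then show ?thesis using c by (simp add: x_def y_def)
qed

abbreviation vx :: "xyz zpoly" where "vx \<equiv> Var Vx"
abbreviation vy :: "xyz zpoly" where "vy \<equiv> Var Vy"
abbreviation vz :: "xyz zpoly" where "vz \<equiv> Var Vz"

text \<open>The equation \<open>rel_poly\<close> is linear in \<open>z\<close>, so up to a power of its leading coefficient every
  polynomial becomes one in \<open>x\<close> and \<open>y\<close>.\<close>

lemma eliminate_z:
  assumes J: "is_ideal J" and rel: "rel_poly n m vx vy vz \<in> J"
  shows "\<exists>N g. (cpol n vx * cpol m vy) ^ N * f - ev2 g vx vy \<in> J"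
proof (induction f rule: zpoly_induct)
  case (int k)
  have "(cpol n vx * cpol m vy) ^ 0 * of_int k - ev2 (of_int k) vx vy = 0"
    by (simp add: ev2.hom_of_int)
  then show ?case using ideal_zero[OF J] by metis
next
  case (Var v)
  show ?case
  proof (cases v)
    case Vx
    have "(cpol n vx * cpol m vy) ^ 0 * Var v - ev2 [:[:0, 1:]:] vx vy = 0" by (simp only: ev2_X Vx) simp
    then show ?thesis using ideal_zero[OF J] by metis
  next
    case Vy
    have "(cpol n vx * cpol m vy) ^ 0 * Var v - ev2 [:0, 1:] vx vy = 0" by (simp only: ev2_Y Vy) simp
    then show ?thesis using ideal_zero[OF J] by metis
  next
    case Vz
    let ?x = "[:[:0, 1:]:] :: int poly poly" and ?y = "[:0, 1:] :: int poly poly"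
    define g where "g = - (?x * cpol n ?x * dpol m ?y + ?y * dpol n ?x * cpol m ?y + 2 * dpol n ?x * dpol m ?y)"
    have ev: "ev2 g vx vy = - (vx * cpol n vx * dpol m vy + vy * dpol n vx * cpol m vy + 2 * dpol n vx * dpol m vy)"
      using ev2.hom_add[of 1 1 vx vy] unfolding g_def
      by (simp only: ev2.hom_uminus ev2.hom_add ev2.hom_mult ev2.hom_cpol ev2.hom_dpol ev2_X ev2_Y
          ev2.hom_one one_add_one)
    have "(cpol n vx * cpol m vy) ^ 1 * Var v - ev2 g vx vy = rel_poly n m vx vy vz"
      unfolding ev by (simp add: Vz rel_poly_def algebra_simps)
    then show ?thesis using rel by metis
  qed
next
  case (add f1 f2)
  let ?u = "cpol n vx * cpol m vy"
  let ?U = "cpol n [:[:0, 1:]:] * cpol m [:0, 1:] :: int poly poly"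
  have U: "ev2 ?U vx vy = ?u" by (simp only: ev2.hom_mult ev2.hom_cpol ev2_X ev2_Y)
  obtain N1 g1 N2 g2 where "?u ^ N1 * f1 - ev2 g1 vx vy \<in> J" "?u ^ N2 * f2 - ev2 g2 vx vy \<in> J"
    using add by blast
  then have "?u ^ N2 * (?u ^ N1 * f1 - ev2 g1 vx vy) + ?u ^ N1 * (?u ^ N2 * f2 - ev2 g2 vx vy) \<in> J"
    by (intro ideal_add[OF J] ideal_mult_l[OF J])
  also have "?u ^ N2 * (?u ^ N1 * f1 - ev2 g1 vx vy) + ?u ^ N1 * (?u ^ N2 * f2 - ev2 g2 vx vy) =
    ?u ^ (N1 + N2) * (f1 + f2) - ev2 (?U ^ N2 * g1 + ?U ^ N1 * g2) vx vy"
    unfolding ev2.hom_add ev2.hom_mult[of "?U ^ _"] ev2.hom_power U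
    by (simp only: power_add) (simp only: algebra_simps)
  finally show ?case by blast
next
  case (mult f1 f2)
  let ?u = "cpol n vx * cpol m vy"
  obtain N1 g1 N2 g2 where *: "?u ^ N1 * f1 - ev2 g1 vx vy \<in> J" "?u ^ N2 * f2 - ev2 g2 vx vy \<in> J"
    using mult by blast
  then have "(?u ^ N2 * f2) * (?u ^ N1 * f1 - ev2 g1 vx vy) + ev2 g1 vx vy * (?u ^ N2 * f2 - ev2 g2 vx vy) \<in> J"
    by (intro ideal_add[OF J] ideal_mult_l[OF J])
  also have "(?u ^ N2 * f2) * (?u ^ N1 * f1 - ev2 g1 vx vy) + ev2 g1 vx vy * (?u ^ N2 * f2 - ev2 g2 vx vy)
     = ?u ^ (N1 + N2) * (f1 * f2) - ev2 (g1 * g2) vx vy"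
    unfolding ev2.hom_mult by (simp only: power_add) (simp only: algebra_simps)
  finally show ?case by blast
qed

definition type_point :: "int \<Rightarrow> int \<Rightarrow> complex \<Rightarrow> complex \<Rightarrow> xyz \<Rightarrow> complex" where
  "type_point n1 m1 \<zeta> \<eta> = trace_point \<zeta> \<eta> (z_value n1 m1 \<zeta> \<eta>)"

lemma trace_point_simps: "trace_point \<zeta> \<eta> z Vx = \<zeta> + inverse \<zeta>" "trace_point \<zeta> \<eta> z Vy = \<eta> + inverse \<eta>"
   "trace_point \<zeta> \<eta> z Vz = z"
  by (simp_all add: trace_point_def)

lemma type_point_rel:
  assumes "type_roots n1 n2 m1 m2 e \<zeta> \<eta>"
  shows "eval (type_point n1 m1 \<zeta> \<eta>) (rel_poly n1 m1 vx vy vz) = 0"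
  using assms rel_poly_z_value[of \<zeta> \<eta> n1 m1 "z_value n1 m1 \<zeta> \<eta>"]
  by (simp add: type_roots_def eval_hom.hom_rel_poly eval_Var type_point_def trace_point_simps)

text \<open>Eliminating \<open>z\<close> leaves a polynomial in \<open>x\<close> and \<open>y\<close>, to which \<open>grid_division\<close> is applied on the grid of zeros of
  \<open>c\<^bsub>n1-n2\<^esub>(x)\<close> and \<open>c\<^bsub>m1-m2\<^esub>(y)\<close>. On this grid \<open>d\<^bsub>n1-n2\<^esub>\<close> and \<open>d\<^bsub>m1-m2\<^esub>\<close> take the values \<open>\<plusminus>1\<close>. The extra factors vanish
  at the grid points that are not of type \<open>e\<close>: the power removes those where \<open>z\<close> cannot be solved for, and the
  other two factors those with \<open>\<zeta>\<^bsup>n1-n2\<^esup> = e\<close> or \<open>\<eta>\<^bsup>m1-m2\<^esup> = -e\<close>.\<close>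

theorem vanishing_at_type_points:
  assumes J: "is_ideal J" and rel: "rel_poly n1 m1 vx vy vz \<in> J"
    and Jx: "cpol (n1 - n2) vx \<in> J" and Jy: "cpol (m1 - m2) vy \<in> J"
    and st: "n1 \<noteq> n2" "m1 \<noteq> m2" and e: "e \<in> {1, -1}"
    and van: "\<And>\<zeta> \<eta>. type_roots n1 n2 m1 m2 e \<zeta> \<eta> \<Longrightarrow> eval (type_point n1 m1 \<zeta> \<eta>) f = 0"
  shows "\<exists>N. (cpol n1 vx * cpol m1 vy) ^ N * ((dpol (n1 - n2) vx - of_int e) * (dpol (m1 - m2) vy + of_int e)) * f \<in> J"
proof -
  \<comment> \<open>Eliminating modulo the ideal of \<open>rel_poly\<close> alone makes the result valid both in \<open>J\<close> and at the points
    of type \<open>e\<close>.\<close>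
  define J0 where "J0 = ideal_gen {rel_poly n1 m1 vx vy vz}"
  have J0: "is_ideal J0" "rel_poly n1 m1 vx vy vz \<in> J0"
    using ideal_gen_is_ideal ideal_gen_superset unfolding J0_def by blast+
  have J0J: "J0 \<subseteq> J" unfolding J0_def using rel by (simp add: ideal_gen_subset_iff[OF J])
  define u where "u = cpol n1 vx * cpol m1 vy"
  define w where "w = (dpol (n1 - n2) vx - of_int e) * (dpol (m1 - m2) vy + of_int e)"
  obtain N g where Ng: "u ^ N * f - ev2 g vx vy \<in> J0"
    using eliminate_z[OF J0] unfolding u_def by blast
  let ?x = "[:[:0, 1:]:] :: int poly poly" and ?y = "[:0, 1:] :: int poly poly"
  define G where "G = cpol n1 ?x * cpol m1 ?y * ((dpol (n1 - n2) ?x - of_int e) * (dpol (m1 - m2) ?y + of_int e)) * g"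
  have evG: "ev2 G x y = cpol n1 x * cpol m1 y * ((dpol (n1 - n2) x - of_int e) * (dpol (m1 - m2) y + of_int e)) * ev2 g x y"
    for x y :: "'b::comm_ring_1"
    unfolding G_def
    by (simp only: ev2.hom_mult ev2.hom_add ev2.hom_minus ev2.hom_cpol ev2.hom_dpol ev2_X ev2_Y ev2.hom_of_int)
  have nz: "n1 - n2 \<noteq> 0" "m1 - m2 \<noteq> 0" using st by auto
  from cpol_zeros[OF nz(1)] obtain S :: "complex set" where S': "finite S \<and> card S = nat \<bar>n1 - n2\<bar> - 1 \<and>
    (\<forall>x\<in>S. cpol (n1 - n2) x = 0 \<and> (\<exists>u. u \<notin> {0, 1, -1} \<and> x = u + inverse u))" ..
  note S = S'[THEN conjunct1] S'[THEN conjunct2, THEN conjunct1] S'[THEN conjunct2, THEN conjunct2, rule_format]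
  from cpol_zeros[OF nz(2)] obtain T :: "complex set" where T': "finite T \<and> card T = nat \<bar>m1 - m2\<bar> - 1 \<and>
    (\<forall>x\<in>T. cpol (m1 - m2) x = 0 \<and> (\<exists>u. u \<notin> {0, 1, -1} \<and> x = u + inverse u))" ..
  note T = T'[THEN conjunct1] T'[THEN conjunct2, THEN conjunct1] T'[THEN conjunct2, THEN conjunct2, rule_format]
  \<comment> \<open>\<open>c\<^bsub>-n\<^esub> = -c\<^sub>n\<close>, and \<open>c\<^sub>n\<close> is monic for \<open>n > 0\<close>.\<close>
  have sgn: "cpol (1 + int (nat \<bar>n\<bar> - 1)) x = cpol n x \<or> cpol (1 + int (nat \<bar>n\<bar> - 1)) x = - cpol n x"
    if "n \<noteq> 0" for n and x :: "'c::comm_ring_1"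
  proof -
    have eq: "1 + int (nat \<bar>n\<bar> - 1) = \<bar>n\<bar>" using that by auto
    show ?thesis unfolding eq by (cases "n \<ge> 0") (simp_all add: cpol_uminus)
  qed
  have sgn0: "cpol (1 + int (nat \<bar>n\<bar> - 1)) x \<in> I"
    if "n \<noteq> 0" "is_ideal I" "cpol n x \<in> I" for n and x :: "'c::comm_ring_1" and I
    using sgn[OF that(1), of x] that(3) ideal_uminus[OF that(2,3)] by auto
  have zI: "is_ideal {0 :: complex}" by (simp add: is_ideal_def)
  have inJ: "ev2 G vx vy \<in> J"
  proof (rule grid_division[OF J])
    show "Polynomial.lead_coeff (cpol (1 + int (nat \<bar>n1 - n2\<bar> - 1)) [:0, 1:] :: int poly) = 1"
      "Polynomial.lead_coeff (cpol (1 + int (nat \<bar>m1 - m2\<bar> - 1)) [:0, 1:] :: int poly) = 1"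
      by (rule cpol_poly[THEN conjunct2])+
    show "ev1 (cpol (1 + int (nat \<bar>n1 - n2\<bar> - 1)) [:0, 1:]) vx \<in> J"
      "ev1 (cpol (1 + int (nat \<bar>m1 - m2\<bar> - 1)) [:0, 1:]) vy \<in> J"
      unfolding cpol_ev1 by (rule sgn0[OF nz(1) J Jx], rule sgn0[OF nz(2) J Jy])
    show "finite S" "finite T" by fact+
    show "Polynomial.degree (cpol (1 + int (nat \<bar>n1 - n2\<bar> - 1)) [:0, 1:] :: int poly) \<le> card S"
      "Polynomial.degree (cpol (1 + int (nat \<bar>m1 - m2\<bar> - 1)) [:0, 1:] :: int poly) \<le> card T"
      unfolding cpol_poly[THEN conjunct1] S T by simp_all
    show "ev1 (cpol (1 + int (nat \<bar>n1 - n2\<bar> - 1)) [:0, 1:]) x = 0" if "x \<in> S" for x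
      unfolding cpol_ev1 using sgn0[OF nz(1) zI, of x] S(3)[OF that] by simp
    show "ev1 (cpol (1 + int (nat \<bar>m1 - m2\<bar> - 1)) [:0, 1:]) x = 0" if "x \<in> T" for x
      unfolding cpol_ev1 using sgn0[OF nz(2) zI, of x] T(3)[OF that] by simp
    fix x y assume xS: "x \<in> S" and yT: "y \<in> T"
    obtain \<zeta> \<eta> where z: "\<zeta> \<notin> {0, 1, -1}" "x = \<zeta> + inverse \<zeta>" and h: "\<eta> \<notin> {0, 1, -1}" "y = \<eta> + inverse \<eta>"
      using S(3)[OF xS] T(3)[OF yT] by auto
    have pz: "\<zeta> powi (n1 - n2) = dpol (n1 - n2) x" and ph: "\<eta> powi (m1 - m2) = dpol (m1 - m2) y"
      using powi_cd[of \<zeta> "n1 - n2"] powi_cd[of \<eta> "m1 - m2"] z h S(3)[OF xS] T(3)[OF yT] by auto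
    have sq: "dpol (n1 - n2) x = 1 \<or> dpol (n1 - n2) x = -1" "dpol (m1 - m2) y = 1 \<or> dpol (m1 - m2) y = -1"
      using cd_norm[of "n1 - n2" x] cd_norm[of "m1 - m2" y] S(3)[OF xS] T(3)[OF yT]
      by (simp_all add: power2_eq_1_iff)
    show "ev2 G x y = 0"
    proof (cases "type_roots n1 n2 m1 m2 e \<zeta> \<eta>")
      case True
      define p where "p = type_point n1 m1 \<zeta> \<eta>"
      have p: "p Vx = x" "p Vy = y" by (simp_all add: p_def type_point_def trace_point_simps z h)
      have "J0 \<subseteq> ker_eval p"
        unfolding J0_def ideal_gen_subset_iff[OF ker_eval_ideal]
        using type_point_rel[OF True] by (simp add: ker_eval_def p_def)
      then have "eval p (u ^ N * f - ev2 g vx vy) = 0" using Ng by (auto simp: ker_eval_def)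
      then have "ev2 g x y = 0"
        using van[OF True] p by (simp add: eval_hom.hom_minus eval_hom.hom_mult eval_hom.hom_ev2 eval_Var p_def)
      then show ?thesis by (simp add: evG)
    next
      case False
      then have "cpol n1 x = 0 \<or> cpol m1 y = 0 \<or> dpol (n1 - n2) x = of_int e \<or> dpol (m1 - m2) y = - of_int e"
        using sq e z h pz ph unfolding type_roots_def by auto
      then show ?thesis unfolding evG by auto
    qed
  qed
  have GG: "ev2 G vx vy = u * w * ev2 g vx vy" by (simp add: evG u_def w_def)
  have "u * w * (u ^ N * f - ev2 g vx vy) \<in> J" using Ng J0J by (intro ideal_mult_l[OF J]) auto
  from ideal_add[OF J this inJ] have "u ^ Suc N * w * f \<in> J"
    unfolding GG by (simp add: algebra_simps)
  then show ?thesis unfolding u_def w_def by blast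
qed

section \<open>Representations and pairs of matrices\<close>

text \<open>This is \<open>tr (A B A\<^sup>-\<^sup>1 B\<^sup>-\<^sup>1) - 2\<close>, which vanishes exactly on the reducible pairs.\<close>

definition red_poly :: "'a::comm_ring_1 \<Rightarrow> 'a \<Rightarrow> 'a \<Rightarrow> 'a" where
  "red_poly x y z = x * x + y * y + z * z - x * y * z - 4"

lemma (in comm_ring_hom) hom_red_poly: "hom (red_poly x y z) = red_poly (hom x) (hom y) (hom z)"
proof -
  have "hom 4 = 4" using hom_of_int[of 4] by simp
  then show ?thesis by (simp add: red_poly_def hom_add hom_minus hom_mult)
qed

lemma det_comm2:
  assumes "det A = 1" "det B = 1"
  shows "det (comm2 A B) = - red_poly (trace A) (trace B) (trace (A ** B))"
proof -
  have "det (comm2 A B) = - (trace A * trace A * det B + trace B * trace B * det A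
     + trace (A ** B) * trace (A ** B) - trace A * trace B * trace (A ** B) - 4 * det A * det B)"
    by (simp add: comm2_def mat2_simps) (simp add: algebra_simps)
  then show ?thesis using assms by (simp add: red_poly_def)
qed

lemma adj2_mult: "adj2 M ** M = lin2 0 (det M) M" "M ** adj2 M = lin2 0 (det M) M"
  by (simp_all add: mat2_eq_iff mat2_simps mult.commute)

lemma adj2_inverse: "det M = 1 \<Longrightarrow> adj2 M ** M = mat 1" "det M = 1 \<Longrightarrow> M ** adj2 M = mat 1"
  by (simp_all add: adj2_mult) (simp_all add: mat2_eq_iff mat2_simps)

lemma det_adj2: "det (adj2 M) = det M"
  by (simp add: mat2_simps algebra_simps)

lemma det_word_mat: "(\<And>g. det (M g) = 1) \<Longrightarrow> det (word_mat M w) = 1"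
  by (induction M w rule: word_mat.induct) (auto simp: det_mul det_adj2)

lemma word_eq_context: "word_eq r u v \<Longrightarrow> word_eq r (a @ u @ b) (a @ v @ b)"
proof (induction rule: word_eq.induct)
  case (cancel u g e v)
  show ?case using word_eq.cancel[of r "a @ u" g e "v @ b"] by simp
next
  case (relator u v)
  show ?case using word_eq.relator[of r "a @ u" "v @ b"] by simp
next
  case (refl u)
  show ?case by (rule word_eq.refl)
next
  case (sym u v)
  show ?case by (rule word_eq.sym[OF sym.IH])
next
  case (trans u v w)
  show ?case by (rule word_eq.trans[OF trans.IH])
qed

lemma word_class_eq_iff: "word_class r u = word_class r v \<longleftrightarrow> word_eq r u v"
proof
  assume "word_class r u = word_class r v"
  moreover have "v \<in> word_class r v" by (simp add: word_class_def word_eq.refl)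
  ultimately have "v \<in> word_class r u" by simp
  then show "word_eq r u v" by (simp add: word_class_def)
next
  assume uv: "word_eq r u v"
  show "word_class r u = word_class r v"
    unfolding word_class_def using word_eq.trans[OF uv] word_eq.trans[OF word_eq.sym[OF uv]] by blast
qed

lemma word_eq_append: "word_eq r u u' \<Longrightarrow> word_eq r v v' \<Longrightarrow> word_eq r (u @ v) (u' @ v')"
  using word_eq.trans[of r "u @ v" "u' @ v"] word_eq_context[of r u u' "[]" v] word_eq_context[of r v v' u' "[]"]
  by simp

lemma pres_group_mult: "word_class r u \<otimes>\<^bsub>pres_group r\<^esub> word_class r v = word_class r (u @ v)"
proof -
  have "word_class r (u' @ v') = word_class r (u @ v)" if "u' \<in> word_class r u" "v' \<in> word_class r v" for u' v'
    unfolding word_class_eq_iff using word_eq.sym[OF word_eq_append[of r u u' v v']] that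
    by (simp add: word_class_def)
  moreover have "u \<in> word_class r u" "v \<in> word_class r v" by (auto simp: word_class_def word_eq.refl)
  ultimately have "(\<Union>u'\<in>word_class r u. \<Union>v'\<in>word_class r v. word_class r (u' @ v')) = word_class r (u @ v)"
    by blast
  then show ?thesis by (simp add: pres_group_def)
qed

lemma pres_group_carrier: "carrier (pres_group r) = range (word_class r)"
  by (simp add: pres_group_def)

lemma word_mat_respects:
  assumes det: "\<And>g. det (M g) = 1" and rel: "word_mat M r = mat 1"
  shows "word_eq r u v \<Longrightarrow> word_mat M u = word_mat M v"
proof (induction rule: word_eq.induct)
  case (cancel u g e v)
  have "word_mat M [(g, e), (g, \<not> e)] = mat 1"
    using adj2_inverse[OF det[of g]] by (cases e) (simp_all add: matrix_mul_rid)
  then show ?case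
    by (simp only: word_mat_append matrix_mul_lid)
next
  case (relator u v)
  show ?case by (simp only: word_mat_append rel matrix_mul_lid)
qed auto

text \<open>For matrices that satisfy the relation, the value does not depend on the representative, by
  \<open>word_mat_respects\<close>.\<close>

definition rep_of :: "word \<Rightarrow> (gen \<Rightarrow> 'a::comm_ring_1 ^ 2 ^ 2) \<Rightarrow> word set \<Rightarrow> 'a ^ 2 ^ 2" where
  "rep_of r M S = word_mat M (SOME w. w \<in> S)"

lemma rep_of_class:
  assumes "\<And>g. det (M g) = 1" "word_mat M r = mat 1"
  shows "rep_of r M (word_class r w) = word_mat M w"
proof -
  have "(SOME v. v \<in> word_class r w) \<in> word_class r w"
    by (rule someI[of _ w]) (simp add: word_class_def word_eq.refl)
  then show ?thesis
    using word_mat_respects[OF assms] by (simp add: rep_of_def word_class_def)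
qed

lemma rep_mats_rep_of:
  assumes "\<And>g. det (M g) = 1" "word_mat M r = mat 1"
  shows "rep_mats r (rep_of r M) = M"
  by (rule ext) (simp add: rep_mats_def rep_of_class[OF assms] matrix_mul_rid)

lemma rep_of_hom_SL2:
  assumes "\<And>g. det (M g) = 1" "word_mat M r = mat 1"
  shows "rep_of r M \<in> hom (pres_group r) SL2"
  by (auto simp: hom_def pres_group_carrier pres_group_mult rep_of_class[OF assms] SL2_def
      det_word_mat[OF assms(1)] word_mat_append)

text \<open>Only products and determinants enter, so this covers homomorphisms to \<open>SL\<^sub>2\<close> and homomorphisms of
  determinant 1 to \<open>GL\<^sub>2\<close> of a subring. Inverses are adjugates because the determinants are 1.\<close>

lemma rep_mats_word:
  fixes \<rho> :: "word set \<Rightarrow> 'a::comm_ring_1 ^ 2 ^ 2"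
  assumes mult: "\<And>S T. S \<in> carrier (pres_group r) \<Longrightarrow> T \<in> carrier (pres_group r) \<Longrightarrow>
      \<rho> (S \<otimes>\<^bsub>pres_group r\<^esub> T) = \<rho> S ** \<rho> T"
    and det: "\<And>S. S \<in> carrier (pres_group r) \<Longrightarrow> det (\<rho> S) = 1"
  shows "\<rho> (word_class r w) = word_mat (rep_mats r \<rho>) w" "det (rep_mats r \<rho> g) = 1"
    "word_mat (rep_mats r \<rho>) r = mat 1"
proof -
  have app: "\<rho> (word_class r (u @ v)) = \<rho> (word_class r u) ** \<rho> (word_class r v)" for u v
    using mult[of "word_class r u" "word_class r v"] by (simp add: pres_group_mult pres_group_carrier)
  have d: "det (\<rho> (word_class r w)) = 1" for w using det by (simp add: pres_group_carrier)
  have "\<rho> (word_class r []) ** \<rho> (word_class r []) = \<rho> (word_class r [])" using app[of "[]" "[]"] by simp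
  then have "adj2 (\<rho> (word_class r [])) ** (\<rho> (word_class r []) ** \<rho> (word_class r [])) = mat 1"
    by (simp add: adj2_inverse(1)[OF d])
  then have one: "\<rho> (word_class r []) = mat 1"
    by (simp add: matrix_mul_assoc adj2_inverse(1)[OF d] matrix_mul_lid)
  have gen: "\<rho> (word_class r [(g, e)]) = (if e then rep_mats r \<rho> g else adj2 (rep_mats r \<rho> g))" for g e
  proof (cases e)
    case True
    then show ?thesis by (simp add: rep_mats_def)
  next
    case False
    have "word_class r ([(g, False)] @ [(g, True)]) = word_class r []"
      unfolding word_class_eq_iff using word_eq.cancel[of r "[]" g False "[]"] by simp
    then have "\<rho> (word_class r [(g, False)]) ** rep_mats r \<rho> g = mat 1"
      using app[of "[(g, False)]" "[(g, True)]"] one by (simp add: rep_mats_def)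
    then have "(\<rho> (word_class r [(g, False)]) ** rep_mats r \<rho> g) ** adj2 (rep_mats r \<rho> g) = adj2 (rep_mats r \<rho> g)"
      by (simp add: matrix_mul_lid)
    then have "\<rho> (word_class r [(g, False)]) = adj2 (rep_mats r \<rho> g)"
      by (simp add: matrix_mul_assoc[symmetric] adj2_inverse(2)[OF d] rep_mats_def matrix_mul_rid)
    then show ?thesis using False by simp
  qed
  show w: "\<rho> (word_class r w) = word_mat (rep_mats r \<rho>) w" for w
  proof (induction w)
    case Nil
    show ?case by (simp add: one)
  next
    case (Cons l w)
    then show ?case using app[of "[l]" w] gen[of "fst l" "snd l"] by (cases l) simp
  qed
  show "det (rep_mats r \<rho> g) = 1" by (simp add: rep_mats_def d)
  have "word_class r r = word_class r []"
    unfolding word_class_eq_iff using word_eq.relator[of r "[]" "[]"] by simp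
  then show "word_mat (rep_mats r \<rho>) r = mat 1" using w[of r] one by simp
qed

lemma hom_SL2_mats:
  assumes "\<rho> \<in> hom (pres_group r) SL2"
  shows "\<rho> (word_class r w) = word_mat (rep_mats r \<rho>) w" "det (rep_mats r \<rho> g) = 1"
    "word_mat (rep_mats r \<rho>) r = mat 1"
  by (rule rep_mats_word; use assms in \<open>auto simp: hom_def SL2_def\<close>)+

subsection \<open>Irreducibility\<close>

lemma vec2_eq_iff: "(v :: 'a ^ 2) = w \<longleftrightarrow> v $ 1 = w $ 1 \<and> v $ 2 = w $ 2"
  by (auto simp: vec_eq_iff forall_2)

lemma mult_vec2: "(M *v v) $ i = M $ i $ 1 * v $ 1 + M $ i $ 2 * (v :: 'a::comm_ring_1 ^ 2) $ 2"
  by (simp add: matrix_vector_mult_def sum_2)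

lemma mult_vec_scale: "A *v (c *s v) = c *s (A *v v)" for A :: "'a::comm_ring_1 ^ 2 ^ 2"
  by (simp add: vec2_eq_iff mult_vec2 algebra_simps)

lemma adj2_trace: "adj2 A *v v = trace A *s v - A *v (v :: 'a::comm_ring_1 ^ 2)"
  by (simp add: vec2_eq_iff mult_vec2 adj2_nth trace2 algebra_simps)

lemma word_mat_invariant:
  fixes W :: "('a::field ^ 2) set"
  assumes W: "vec.subspace W" and inv: "\<And>g v. v \<in> W \<Longrightarrow> M g *v v \<in> W" and v: "v \<in> W"
  shows "word_mat M w *v v \<in> W"
proof (induction w)
  case Nil
  show ?case using v by simp
next
  case (Cons l w)
  obtain g e where l: "l = (g, e)" by force
  have "adj2 (M g) *v u \<in> W" if "u \<in> W" for u
    unfolding adj2_trace by (intro vec.subspace_diff[OF W] vec.subspace_scale[OF W] inv that)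
  then show ?case using Cons inv by (simp add: l matrix_vector_mul_assoc[symmetric])
qed

lemma kernel_invariant_subspace:
  fixes K :: "'a::field ^ 2 ^ 2"
  assumes "K \<noteq> 0" "det K = 0"
  defines "W \<equiv> {v. K *v v = 0}"
  shows "vec.subspace W" "W \<noteq> {0}" "W \<noteq> UNIV"
proof -
  show "vec.subspace W"
    unfolding vec.subspace_def W_def
    by (auto simp: matrix_vector_right_distrib mult_vec_scale)
  show "W \<noteq> {0}"
  proof
    assume W0: "W = {0}"
    define u v where "u = (vector [K $ 2 $ 2, - K $ 2 $ 1] :: 'a ^ 2)" and "v = (vector [- K $ 1 $ 2, K $ 1 $ 1] :: 'a ^ 2)"
    have "K *v u = 0" "K *v v = 0"
      using assms(2) by (simp_all add: vec2_eq_iff mult_vec2 u_def v_def det_2 algebra_simps)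
    then have "u = 0" "v = 0" using W0 by (auto simp: W_def)
    then have "K = 0" by (simp add: mat2_eq_iff vec2_eq_iff u_def v_def)
    then show False using assms(1) by simp
  qed
  show "W \<noteq> UNIV"
  proof
    assume "W = UNIV"
    then have "K *v vector [1, 0] = 0" "K *v vector [0, 1] = 0" by (auto simp: W_def)
    then have "K = 0" by (simp add: mat2_eq_iff vec2_eq_iff mult_vec2)
    then show False using assms(1) by simp
  qed
qed

text \<open>The invariant line is the kernel of \<open>K\<close>. If \<open>K = AB - BA\<close> is not zero, then its kernel is invariant because
  \<open>K A + A K = (tr A) K\<close>, and likewise for \<open>B\<close>. If \<open>A\<close> and \<open>B\<close> commute, an eigenspace of one of them works, unless
  both are scalar, when every line is invariant.\<close>

lemma invariant_line_exists:
  fixes A B :: "'a::alg_closed_field ^ 2 ^ 2"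
  assumes "det (comm2 A B) = 0"
  obtains K where "K \<noteq> 0" "det K = 0" "\<And>v. K *v v = 0 \<Longrightarrow> K *v (A *v v) = 0"
    "\<And>v. K *v v = 0 \<Longrightarrow> K *v (B *v v) = 0"
proof (cases "comm2 A B = 0")
  case False
  have "comm2 A B *v (A *v v) = trace A *s (comm2 A B *v v) - A *v (comm2 A B *v v)"
    "comm2 A B *v (B *v v) = trace B *s (comm2 A B *v v) - B *v (comm2 A B *v v)" for v
    by (simp_all add: vec2_eq_iff mult_vec2 comm2_def mat2_simps algebra_simps)
  then show ?thesis using that[OF False assms] by (simp add: matrix_vector_mult_0_right)
next
  case True
  then have AB: "A ** B = B ** A" by (simp add: comm2_def)
  have shift: "\<exists>c. det (M - lin2 0 c M) = 0" for M :: "'a ^ 2 ^ 2"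
  proof -
    obtain c where "poly [:det M, - trace M, 1:] c = 0" using alg_closed_imp_poly_has_root[of "[:det M, - trace M, 1:]"] by auto
    then have "det (M - lin2 0 c M) = 0" by (simp add: mat2_simps algebra_simps)
    then show ?thesis ..
  qed
  have scal: "K *v (lin2 0 c M *v v) = c *s (K *v v)" for K M :: "'a ^ 2 ^ 2" and c v
    by (simp add: vec2_eq_iff mult_vec2 lin2_nth algebra_simps)
  have comm: "(M - lin2 0 c M) *v (N *v v) = N *v ((M - lin2 0 c M) *v v)" if "M ** N = N ** M" for M N :: "'a ^ 2 ^ 2" and c v
  proof -
    have sub: "(M - lin2 0 c M) *v u = M *v u - c *s u" for u
      by (simp add: vec2_eq_iff mult_vec2 lin2_nth algebra_simps)
    have "M *v (N *v v) = N *v (M *v v)" using that by (simp add: matrix_vector_mul_assoc)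
    then show ?thesis by (simp add: sub matrix_vector_mult_diff_distrib mult_vec_scale)
  qed
  obtain a where a: "det (A - lin2 0 a A) = 0" using shift by blast
  obtain b where b: "det (B - lin2 0 b B) = 0" using shift by blast
  show ?thesis
  proof (cases "A = lin2 0 a A")
    case False
    then have "A - lin2 0 a A \<noteq> 0" by simp
    then show ?thesis
      by (rule that[OF _ a]) (simp_all add: comm AB matrix_vector_mult_0_right)
  next
    case A: True
    show ?thesis
    proof (cases "B = lin2 0 b B")
      case False
      then have "B - lin2 0 b B \<noteq> 0" by simp
      then show ?thesis
        by (rule that[OF _ b]) (simp_all add: comm AB matrix_vector_mult_0_right)
    next
      case B: True
      define K where "K = (vector [vector [1, 0], vector [0, 0]] :: 'a ^ 2 ^ 2)"
      have "K $ 1 $ 1 \<noteq> 0 $ 1 $ 1" by (simp add: K_def)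
      then have "K \<noteq> 0" by metis
      moreover have "det K = 0" by (simp add: det_2 K_def)
      ultimately show ?thesis
        by (rule that) (subst A B, simp add: scal)+
    qed
  qed
qed

text \<open>A proper invariant subspace is spanned by a common eigenvector, which the commutator maps to 0.\<close>

lemma irreducible_comm2:
  fixes \<rho> :: "word set \<Rightarrow> 'a::alg_closed_field ^ 2 ^ 2"
  assumes w: "\<And>w. \<rho> (word_class r w) = word_mat M w"
  shows "irreducible_rep (pres_group r) \<rho> \<longleftrightarrow> det (comm2 (M Ga) (M Gb)) \<noteq> 0"
proof
  assume irr: "irreducible_rep (pres_group r) \<rho>"
  show "det (comm2 (M Ga) (M Gb)) \<noteq> 0"
  proof
    assume "det (comm2 (M Ga) (M Gb)) = 0"
    from invariant_line_exists[OF this] obtain K where K: "K \<noteq> 0" "det K = 0"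
      "\<And>v. K *v v = 0 \<Longrightarrow> K *v (M Ga *v v) = 0" "\<And>v. K *v v = 0 \<Longrightarrow> K *v (M Gb *v v) = 0" by metis
    note W = kernel_invariant_subspace[OF K(1,2)]
    have "M g *v v \<in> {v. K *v v = 0}" if "v \<in> {v. K *v v = 0}" for g v
      using that K(3,4) by (cases g) auto
    then have "\<forall>g\<in>carrier (pres_group r). \<forall>v\<in>{v. K *v v = 0}. \<rho> g *v v \<in> {v. K *v v = 0}"
      using word_mat_invariant[OF W(1), of M] by (auto simp: pres_group_carrier w)
    then show False using irr W unfolding irreducible_rep_def by metis
  qed
next
  assume N: "det (comm2 (M Ga) (M Gb)) \<noteq> 0"
  show "irreducible_rep (pres_group r) \<rho>"
    unfolding irreducible_rep_def
  proof (intro allI impI)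
    fix W :: "('a ^ 2) set"
    assume "vec.subspace W \<and> (\<forall>g\<in>carrier (pres_group r). \<forall>v\<in>W. \<rho> g *v v \<in> W)"
    then have W: "vec.subspace W" and "\<And>u v. v \<in> W \<Longrightarrow> word_mat M u *v v \<in> W"
      by (auto simp: pres_group_carrier w)
    from this(2)[of _ "[(g, True)]" for g] have inv: "M g *v v \<in> W" if "v \<in> W" for g v
      using that by (simp add: matrix_mul_rid)
    show "W = {0} \<or> W = UNIV"
    proof (rule ccontr)
      assume n: "\<not> ?thesis"
      then obtain v where v: "v \<in> W" "v \<noteq> 0" using vec.subspace_0[OF W] by auto
      have dep: "v $ 1 * u $ 2 - v $ 2 * u $ 1 = 0" if "u \<in> W" for u
      proof (rule ccontr)
        define D where "D = v $ 1 * u $ 2 - v $ 2 * u $ 1"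
        assume "v $ 1 * u $ 2 - v $ 2 * u $ 1 \<noteq> 0"
        then have D: "D \<noteq> 0" by (simp add: D_def)
        have "x \<in> W" for x
        proof -
          define a b where "a = x $ 1 * u $ 2 - x $ 2 * u $ 1" and "b = v $ 1 * x $ 2 - v $ 2 * x $ 1"
          have "D *s x = a *s v + b *s u"
            by (simp add: vec2_eq_iff a_def b_def D_def algebra_simps)
          then have "inverse D *s (D *s x) \<in> W"
            using vec.subspace_scale[OF W] vec.subspace_add[OF W] v(1) that by metis
          then show ?thesis using D by simp
        qed
        then show False using n by auto
      qed
      have eig: "\<exists>c. M g *v v = c *s v" for g
      proof (cases "v $ 1 = 0")
        case True
        then have "v $ 2 \<noteq> 0" using v(2) by (simp add: vec2_eq_iff)
        then show ?thesis using dep[OF inv[OF v(1)], of g] True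
          by (intro exI[of _ "(M g *v v) $ 2 / v $ 2"]) (simp add: vec2_eq_iff)
      next
        case False
        then show ?thesis using dep[OF inv[OF v(1)], of g]
          by (intro exI[of _ "(M g *v v) $ 1 / v $ 1"]) (simp add: vec2_eq_iff field_simps)
      qed
      obtain a b where ab: "M Ga *v v = a *s v" "M Gb *v v = b *s v" using eig by metis
      have "comm2 (M Ga) (M Gb) *v v = M Ga *v (M Gb *v v) - M Gb *v (M Ga *v v)"
        by (simp add: comm2_def matrix_vector_mult_diff_rdistrib matrix_vector_mul_assoc)
      also have "\<dots> = 0" by (simp add: ab mult_vec_scale vec2_eq_iff mult.left_commute)
      finally have "adj2 (comm2 (M Ga) (M Gb)) *v (comm2 (M Ga) (M Gb) *v v) = 0" by (simp add: matrix_vector_mult_0_right)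
      then have "lin2 0 (det (comm2 (M Ga) (M Gb))) (comm2 (M Ga) (M Gb)) *v v = 0"
        by (simp add: matrix_vector_mul_assoc adj2_mult)
      then have "det (comm2 (M Ga) (M Gb)) *s v = 0" by (simp add: vec2_eq_iff mult_vec2 lin2_nth)
      then show False using N v(2) by (auto simp: vec2_eq_iff)
    qed
  qed
qed

subsection \<open>Construction of representations\<close>

text \<open>A pair of triangular matrices, one upper and one lower, with prescribed traces. All entries lie in
  every ring that contains the eigenvalues and \<open>z\<close>.\<close>

definition tri_mats :: "'a::field \<Rightarrow> 'a \<Rightarrow> 'a \<Rightarrow> gen \<Rightarrow> 'a ^ 2 ^ 2" where
  "tri_mats a b z g = (case g of Ga \<Rightarrow> vector [vector [a, 1], vector [0, inverse a]]
     | Gb \<Rightarrow> vector [vector [b, 0], vector [z - a * b - inverse a * inverse b, inverse b]])"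

lemma tri_mats_props:
  assumes "a \<noteq> 0" "b \<noteq> 0"
  shows "det (tri_mats a b z g) = 1" "trace (tri_mats a b z Ga) = a + inverse a"
    "trace (tri_mats a b z Gb) = b + inverse b" "trace (tri_mats a b z Ga ** tri_mats a b z Gb) = z"
  using assms by (cases g; simp add: tri_mats_def mat2_simps)+

text \<open>Put \<open>X = A\<^bsup>n1\<^esup> B\<^bsup>m1\<^esup>\<close>. The equations say that \<open>A\<^bsup>n2\<^esup> B\<^bsup>m2\<^esup> = -X\<close> and that \<open>X\<close> has trace 0, so \<open>X\<^sup>2 = -1\<close> and the
  relator is \<open>-X\<^sup>2 = 1\<close>.\<close>

lemma relation_holds:
  fixes M :: "gen \<Rightarrow> 'a::idom ^ 2 ^ 2"
  assumes det: "\<And>g. det (M g) = 1" and e: "e \<in> {1, -1}"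
    and eqs: "type_eqs n1 n2 m1 m2 e (trace (M Ga)) (trace (M Gb)) (trace (M Ga ** M Gb)) \<subseteq> {0}"
  shows "word_mat M (relator n1 n2 m1 m2) = mat 1"
proof -
  define x y z where xyz: "x = trace (M Ga)" "y = trace (M Gb)" "z = trace (M Ga ** M Gb)"
  let ?e = "of_int e :: 'a"
  have ee: "?e * ?e = 1" using e by auto
  have zI: "is_ideal {0 :: 'a}" by (simp add: is_ideal_def)
  have eq: "cpol n1 x = - ?e * cpol n2 x" "dpol n1 x = - ?e * dpol n2 x"
     "cpol m1 y = ?e * cpol m2 y" "dpol m1 y = ?e * dpol m2 y" "rel_poly n1 m1 x y z = 0"
    using eqs unfolding type_eqs_def xyz[symmetric] by (auto simp: eq_neg_iff_add_eq_0)
  have gp: "word_mat M (gen_pow g k) = lin2 (cpol k (trace (M g))) (dpol k (trace (M g))) (M g)" for g k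
    using word_mat_gen_pow[OF zI, of M g k] det by (simp add: mcong_def vec_eq_iff)
  define X1 where "X1 = lin2 (cpol n2 x) (dpol n2 x) (M Ga)"
  define Y1 where "Y1 = lin2 (cpol m2 y) (dpol m2 y) (M Gb)"
  have X: "lin2 (cpol n1 x) (dpol n1 x) (M Ga) = lin2 (- ?e) 0 X1"
    and Y: "lin2 (cpol m1 y) (dpol m1 y) (M Gb) = lin2 ?e 0 Y1"
    by (simp_all add: mat2_eq_iff lin2_nth X1_def Y1_def eq algebra_simps)
  define Z where "Z = X1 ** Y1"
  have XY: "lin2 (- ?e) 0 X1 ** lin2 ?e 0 Y1 = lin2 (- 1) 0 Z"
  proof -
    have "lin2 (- ?e) 0 X1 ** lin2 ?e 0 Y1 = lin2 (- (?e * ?e)) 0 Z"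
      by (simp add: mat2_eq_iff mat2_simps Z_def algebra_simps)
    then show ?thesis by (simp add: ee)
  qed
  have dets: "det (lin2 c d A) = c ^ 2 * det A + trace A * c * d + d ^ 2" for c d and A :: "'a ^ 2 ^ 2"
    by (simp add: mat2_simps algebra_simps power2_eq_square)
  have "det X1 = 1" "det Y1 = 1"
    using cd_norm[of n2 x] cd_norm[of m2 y] det by (simp_all add: X1_def Y1_def dets xyz)
  then have dZ: "det Z = 1" by (simp add: Z_def det_mul)
  have "trace Z = rel_poly n2 m2 x y z"
    unfolding Z_def X1_def Y1_def rel_poly_def xyz
    by (simp add: mat2_simps) (simp add: algebra_simps)
  moreover have "rel_poly n1 m1 x y z = - (?e * ?e) * rel_poly n2 m2 x y z"
    unfolding rel_poly_def eq(1-4) by (simp add: algebra_simps)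
  ultimately have tZ: "trace Z = 0" using eq(5) ee by simp
  have "lin2 (- 1) 0 Z ** Z = lin2 (- trace Z) (det Z) Z"
    by (simp add: mat2_eq_iff mat2_simps algebra_simps)
  also have "\<dots> = mat 1" unfolding tZ dZ by (simp add: mat2_eq_iff lin2_nth mat1_nth)
  finally have ZZ: "lin2 (- 1) 0 Z ** Z = mat 1" .
  have "word_mat M (relator n1 n2 m1 m2) = (lin2 (- ?e) 0 X1 ** lin2 ?e 0 Y1) ** (X1 ** Y1)"
    unfolding relator_def word_mat_append gp xyz(1,2)[symmetric] X Y
    by (simp add: X1_def Y1_def matrix_mul_assoc)
  then show ?thesis using ZZ by (simp add: XY Z_def[symmetric])
qed

section \<open>Valuations\<close>

definition is_subring :: "complex set \<Rightarrow> bool" where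
  "is_subring B \<longleftrightarrow> 1 \<in> B \<and> (\<forall>a\<in>B. - a \<in> B) \<and> (\<forall>a\<in>B. \<forall>b\<in>B. a + b \<in> B \<and> a * b \<in> B)"

lemma is_subringD:
  assumes "is_subring B"
  shows sub_1: "1 \<in> B" and sub_uminus: "a \<in> B \<Longrightarrow> - a \<in> B" and sub_add: "a \<in> B \<Longrightarrow> b \<in> B \<Longrightarrow> a + b \<in> B"
    and sub_mult: "a \<in> B \<Longrightarrow> b \<in> B \<Longrightarrow> a * b \<in> B" and sub_0: "0 \<in> B"
    and sub_diff: "a \<in> B \<Longrightarrow> b \<in> B \<Longrightarrow> a - b \<in> B" and sub_power: "a \<in> B \<Longrightarrow> a ^ k \<in> B"
proof -
  show 1: "1 \<in> B" and m: "a \<in> B \<Longrightarrow> - a \<in> B" and a: "a \<in> B \<Longrightarrow> b \<in> B \<Longrightarrow> a + b \<in> B"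
    and t: "a \<in> B \<Longrightarrow> b \<in> B \<Longrightarrow> a * b \<in> B" for a b using assms by (auto simp: is_subring_def)
  show "0 \<in> B" using a[OF 1 m[OF 1]] by simp
  show "a \<in> B \<Longrightarrow> b \<in> B \<Longrightarrow> a - b \<in> B" using a[of a "- b"] m by simp
  show "a \<in> B \<Longrightarrow> a ^ k \<in> B" by (induction k) (auto intro: 1 t)
qed

lemma sub_sum: "is_subring B \<Longrightarrow> (\<And>i. i \<in> A \<Longrightarrow> f i \<in> B) \<Longrightarrow> sum f A \<in> B"
  by (induction A rule: infinite_finite_induct) (auto intro: sub_add sub_0)

lemma sub_of_int: "is_subring B \<Longrightarrow> of_int k \<in> B"
proof (induction k rule: int_induct[where k = 0])
  case base
  then show ?case by (simp add: sub_0)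
next
  case (step1 i)
  then show ?case using sub_add[OF step1.prems, of "of_int i" 1] sub_1 by simp
next
  case (step2 i)
  then show ?case using sub_diff[OF step2.prems, of "of_int i" 1] sub_1 by simp
qed

text \<open>Such a ring is a valuation ring of the complex numbers in which \<open>l\<close> is not a unit, so it carries a
  valuation that is positive at \<open>l\<close>. On algebraic numbers the value group has rank 1, and comparing
  powers of \<open>u\<close> with powers of \<open>l\<close> gives the value of \<open>u\<close> as a real number.\<close>

locale maximal_subring =
  fixes B :: "complex set" and l :: nat
  assumes ring: "is_subring B" and prime: "Factorial_Ring.prime l"
    and noninv: "inverse (of_nat l) \<notin> B"
    and maximal: "\<And>B'. is_subring B' \<Longrightarrow> B \<subseteq> B' \<Longrightarrow> inverse (of_nat l) \<notin> B' \<Longrightarrow> B' = B"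
begin

abbreviation L :: complex where "L \<equiv> of_nat l"

lemma L_nz: "L \<noteq> 0" using prime by (simp add: prime_gt_0_nat)

lemma L_mem: "L \<in> B" using sub_of_int[OF ring, of "int l"] by simp

text \<open>Localising \<open>B\<close> at the powers of \<open>1 - l b\<close> does not make \<open>l\<close> invertible, because these powers are 1 modulo
  \<open>l\<close>. So the localisation is \<open>B\<close> by maximality.\<close>

lemma one_minus_unit:
  assumes "b \<in> B"
  shows "inverse (1 - L * b) \<in> B" "1 - L * b \<noteq> 0"
proof -
  show nz: "1 - L * b \<noteq> 0"
  proof
    assume "1 - L * b = 0"
    then have "L * b = 1" by simp
    then have "b = inverse L" by (metis inverse_unique)
    then show False using assms noninv by simp
  qed
  define c where "c = 1 - L * b"
  have c: "c \<in> B" unfolding c_def by (intro sub_diff[OF ring] sub_1[OF ring] sub_mult[OF ring] L_mem assms)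
  define B' where "B' = {x. \<exists>n. x * c ^ n \<in> B}"
  have "is_subring B'"
    unfolding is_subring_def
  proof (intro conjI ballI)
    show "1 \<in> B'" unfolding B'_def by (rule CollectI, rule exI[of _ 0]) (simp add: sub_1[OF ring])
    fix x assume "x \<in> B'"
    then obtain n where n: "x * c ^ n \<in> B" by (auto simp: B'_def)
    show "- x \<in> B'" unfolding B'_def
      by (rule CollectI, rule exI[of _ n]) (use sub_uminus[OF ring n] in simp)
    fix y assume "y \<in> B'"
    then obtain m where m: "y * c ^ m \<in> B" by (auto simp: B'_def)
    have "(x * c ^ n) * c ^ m + (y * c ^ m) * c ^ n \<in> B"
      by (intro sub_add[OF ring] sub_mult[OF ring] n m sub_power[OF ring c])
    then have "(x + y) * c ^ (n + m) \<in> B" by (simp add: power_add algebra_simps)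
    then show "x + y \<in> B'" unfolding B'_def by blast
    have "(x * c ^ n) * (y * c ^ m) \<in> B" by (intro sub_mult[OF ring] n m)
    then have "(x * y) * c ^ (n + m) \<in> B" by (simp add: power_add algebra_simps)
    then show "x * y \<in> B'" unfolding B'_def by blast
  qed
  moreover have "B \<subseteq> B'" unfolding B'_def by (rule subsetI, rule CollectI, rule exI[of _ 0]) simp
  moreover have "inverse L \<notin> B'"
  proof
    assume "inverse L \<in> B'"
    then obtain n where n: "inverse L * c ^ n \<in> B" by (auto simp: B'_def)
    have "\<exists>d\<in>B. c ^ n = 1 - L * d"
    proof (induction n)
      case 0
      show ?case by (rule bexI[of _ 0]) (simp_all add: sub_0[OF ring])
    next
      case (Suc n)
      then obtain d where d: "d \<in> B" "c ^ n = 1 - L * d" by blast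
      have "c ^ Suc n = (1 - L * b) * (1 - L * d)" by (simp add: d(2)[symmetric] c_def)
      then have "c ^ Suc n = 1 - L * (b + d - L * (b * d))" by (simp add: algebra_simps)
      moreover have "b + d - L * (b * d) \<in> B"
        by (intro sub_diff[OF ring] sub_add[OF ring] sub_mult[OF ring] L_mem d assms)
      ultimately show ?case by blast
    qed
    then obtain d where d: "d \<in> B" "c ^ n = 1 - L * d" by blast
    have "inverse L * c ^ n = inverse L - d" using L_nz by (simp add: d(2) algebra_simps)
    then have "inverse L = inverse L * c ^ n + d" by simp
    then show False using noninv sub_add[OF ring n d(1)] by simp
  qed
  ultimately have "B' = B" by (rule maximal)
  moreover have "inverse c \<in> B'" unfolding B'_def
    by (rule CollectI, rule exI[of _ 1]) (use nz sub_1[OF ring] in \<open>simp add: c_def\<close>)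
  ultimately show "inverse (1 - L * b) \<in> B" by (simp add: c_def)
qed

text \<open>The number \<open>1/l\<close> is the value at \<open>x\<close> of a polynomial over \<open>B\<close> of degree at most \<open>n\<close>.\<close>

definition unit_expr :: "complex \<Rightarrow> nat \<Rightarrow> bool" where
  "unit_expr x n \<longleftrightarrow> (\<exists>c. (\<forall>i. c i \<in> B) \<and> 1 = L * (\<Sum>i<Suc n. c i * x ^ i))"

lemma unit_expr_mono:
  assumes "unit_expr x n" "n \<le> m"
  shows "unit_expr x m"
proof -
  obtain c where c: "\<And>i. c i \<in> B" "1 = L * (\<Sum>i<Suc n. c i * x ^ i)" using assms(1) by (auto simp: unit_expr_def)
  have "(\<Sum>i<Suc m. (if i \<le> n then c i else 0) * x ^ i) = (\<Sum>i<Suc n. c i * x ^ i)"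
    by (rule sum.mono_neutral_cong_right) (use assms(2) in auto)
  then show ?thesis unfolding unit_expr_def
    by (intro exI[of _ "\<lambda>i. if i \<le> n then c i else 0"]) (use c sub_0[OF ring] in auto)
qed

text \<open>The constant term of the relation for \<open>1/x\<close> can be collected into the unit \<open>1 - l d\<^sub>0\<close>. Multiplied by \<open>x\<^bsup>n+1\<^esup>\<close>,
  the relation then expresses \<open>x\<^bsup>n+1\<^esup>\<close> by lower powers of \<open>x\<close>, and the top term of the relation for \<open>x\<close> can be
  replaced.\<close>

lemma unit_expr_step:
  assumes "x \<noteq> 0" "unit_expr x (Suc n)" "unit_expr (inverse x) (Suc n)"
  shows "unit_expr x n"
proof -
  obtain c where c: "\<And>i. c i \<in> B" "1 = L * (\<Sum>i<Suc (Suc n). c i * x ^ i)"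
    using assms(2) by (auto simp: unit_expr_def)
  obtain d where d: "\<And>i. d i \<in> B" "1 = L * (\<Sum>i<Suc (Suc n). d i * inverse x ^ i)"
    using assms(3) by (auto simp: unit_expr_def)
  define w where "w = inverse (1 - L * d 0)"
  have w: "w \<in> B" "w * (1 - L * d 0) = 1" using one_minus_unit[OF d(1)[of 0]] by (auto simp: w_def)
  have "(\<Sum>i<Suc (Suc n). d i * inverse x ^ i) = d 0 + (\<Sum>i<Suc n. d (Suc i) * inverse x ^ Suc i)"
    by (subst sum.lessThan_Suc_shift) simp
  then have e: "1 - L * d 0 = L * (\<Sum>i<Suc n. d (Suc i) * inverse x ^ Suc i)"
    using d(2) by (simp add: algebra_simps)
  have "x ^ Suc n * (1 - L * d 0) = L * (\<Sum>i<Suc n. d (Suc i) * (x ^ Suc n * inverse x ^ Suc i))"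
    unfolding e sum_distrib_left by (simp only: mult_ac)
  also have "(\<Sum>i<Suc n. d (Suc i) * (x ^ Suc n * inverse x ^ Suc i)) = (\<Sum>i<Suc n. d (Suc n - (Suc n - Suc i)) * x ^ (Suc n - Suc i))"
  proof (rule sum.cong)
    fix i assume "i \<in> {..<Suc n}"
    then have i: "i \<le> n" by simp
    then have "x ^ Suc n = x ^ (n - i) * x ^ Suc i" by (simp flip: power_add)
    then have "x ^ Suc n * inverse x ^ Suc i = x ^ (n - i) * (x * inverse x) ^ Suc i"
      by (simp only: power_mult_distrib mult.assoc)
    then show "d (Suc i) * (x ^ Suc n * inverse x ^ Suc i) = d (Suc n - (Suc n - Suc i)) * x ^ (Suc n - Suc i)"
      using assms(1) i by (simp add: Suc_diff_le)
  qed simp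
  also have "\<dots> = (\<Sum>i<Suc n. d (Suc n - i) * x ^ i)"
    by (rule sum.nat_diff_reindex)
  finally have x: "x ^ Suc n = w * (L * (\<Sum>i<Suc n. d (Suc n - i) * x ^ i))"
    using w(2) by (metis mult.assoc mult.commute mult_1_right)
  define c' where "c' i = c i + c (Suc n) * (w * (L * d (Suc n - i)))" for i
  have "(\<Sum>i<Suc (Suc n). c i * x ^ i) = (\<Sum>i<Suc n. c i * x ^ i) + c (Suc n) * x ^ Suc n" by simp
  also have "c (Suc n) * x ^ Suc n = (\<Sum>i<Suc n. c (Suc n) * (w * (L * d (Suc n - i))) * x ^ i)"
    unfolding x sum_distrib_left by (simp only: mult_ac)
  also have "(\<Sum>i<Suc n. c i * x ^ i) + \<dots> = (\<Sum>i<Suc n. c' i * x ^ i)"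
    by (simp only: c'_def distrib_right sum.distrib)
  finally have "1 = L * (\<Sum>i<Suc n. c' i * x ^ i)" using c(2) by simp
  moreover have "c' i \<in> B" for i unfolding c'_def by (intro sub_add[OF ring] sub_mult[OF ring] c d w L_mem)
  ultimately show ?thesis unfolding unit_expr_def by blast
qed

lemma unit_expr_both: "x \<noteq> 0 \<Longrightarrow> unit_expr x n \<Longrightarrow> unit_expr (inverse x) n \<Longrightarrow> False"
proof (induction n)
  case 0
  then obtain c where c': "(\<forall>i. c i \<in> B) \<and> 1 = L * (\<Sum>i<Suc 0. c i * x ^ i)" unfolding unit_expr_def by blast
  then have c: "c 0 \<in> B" "L * c 0 = 1" by simp_all
  then have "inverse L = c 0" by (metis inverse_unique)
  then show False using c(1) noninv by simp
next
  case (Suc n)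
  have "unit_expr x n" by (rule unit_expr_step) (use Suc in auto)
  moreover have "unit_expr (inverse x) n" by (rule unit_expr_step) (use Suc in auto)
  ultimately show False using Suc by blast
qed

lemma adjoin_unit_expr:
  assumes "x \<notin> B"
  shows "\<exists>n. unit_expr x n"
proof -
  define B' where "B' = {poly p x | p. \<forall>i. Polynomial.coeff p i \<in> B}"
  have B'I: "poly p x \<in> B'" if "\<And>i. Polynomial.coeff p i \<in> B" for p using that by (auto simp: B'_def)
  have "is_subring B'"
    unfolding is_subring_def
  proof (intro conjI ballI)
    show "1 \<in> B'" using B'I[of 1] by (simp add: sub_0[OF ring] sub_1[OF ring])
    fix u assume "u \<in> B'"
    then obtain p where p: "u = poly p x" "\<And>i. Polynomial.coeff p i \<in> B" by (auto simp: B'_def)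
    show "- u \<in> B'" using B'I[of "- p"] p by (simp add: sub_uminus[OF ring])
    fix w assume "w \<in> B'"
    then obtain q where q: "w = poly q x" "\<And>i. Polynomial.coeff q i \<in> B" by (auto simp: B'_def)
    show "u + w \<in> B'" using B'I[of "p + q"] p q by (simp add: sub_add[OF ring])
    show "u * w \<in> B'" using B'I[of "p * q"] p q
      by (simp add: coeff_mult sub_sum[OF ring] sub_mult[OF ring])
  qed
  moreover have "B \<subseteq> B'"
  proof
    fix b assume "b \<in> B"
    then show "b \<in> B'" using B'I[of "[:b:]"] by (simp add: coeff_pCons sub_0[OF ring] split: nat.split)
  qed
  moreover have "x \<in> B'"
    using B'I[of "[:0, 1:]"] by (simp add: coeff_pCons sub_0[OF ring] sub_1[OF ring] split: nat.split)
  ultimately have "inverse L \<in> B'" using maximal[of B'] assms by blast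
  then obtain p where p: "inverse L = poly p x" "\<And>i. Polynomial.coeff p i \<in> B" by (auto simp: B'_def)
  have "1 = L * poly p x" using L_nz by (simp flip: p(1))
  also have "poly p x = (\<Sum>i<Suc (Polynomial.degree p). Polynomial.coeff p i * x ^ i)"
    by (simp add: poly_altdef lessThan_Suc_atMost)
  finally show ?thesis unfolding unit_expr_def using p(2) by blast
qed

text \<open>If both \<open>x\<close> and \<open>1/x\<close> are outside \<open>B\<close>, then \<open>1/l\<close> lies in \<open>B[x]\<close> and in \<open>B[1/x]\<close> by maximality, and the two
  expressions can be shortened against each other down to degree 0.\<close>

lemma valuation_ring:
  assumes "x \<noteq> 0"
  shows "x \<in> B \<or> inverse x \<in> B"
proof (rule ccontr)
  assume "\<not> ?thesis"
  then obtain n m where "unit_expr x n" "unit_expr (inverse x) m" using adjoin_unit_expr by blast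
  then have "unit_expr x (max n m)" "unit_expr (inverse x) (max n m)" using unit_expr_mono by (meson max.cobounded1 max.cobounded2)+
  then show False using unit_expr_both[OF assms] by blast
qed

lemma root_closed:
  assumes "x ^ k \<in> B" "k > 0"
  shows "x \<in> B"
proof (rule ccontr)
  assume x: "x \<notin> B"
  then have "x \<noteq> 0" using sub_0[OF ring] by auto
  then have i: "inverse x \<in> B" using valuation_ring x by blast
  obtain j where k: "k = Suc j" using assms(2) by (cases k) auto
  have "x ^ k * inverse x ^ j = x * (x * inverse x) ^ j" by (simp add: k power_mult_distrib mult_ac)
  then have "x = x ^ k * inverse x ^ j" using \<open>x \<noteq> 0\<close> by simp
  then show False using x sub_mult[OF ring assms(1) sub_power[OF ring i]] by metis
qed

lemma L_powi_mem: "L powi a \<in> B \<longleftrightarrow> a \<ge> 0"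
proof
  assume a: "L powi a \<in> B"
  show "a \<ge> 0"
  proof (rule ccontr)
    assume "\<not> a \<ge> 0"
    then obtain j where j: "a = - int (Suc j)" by (metis int_cases nonneg_int_cases of_nat_0_le_iff)
    have "L powi a = inverse (L ^ Suc j)" by (simp only: j power_int_minus power_int_of_nat)
    then have "L powi a * L ^ j = inverse L" using L_nz by (simp add: field_simps)
    then show False using noninv sub_mult[OF ring a sub_power[OF ring L_mem]] by metis
  qed
next
  assume "a \<ge> 0"
  then have "L powi a = L ^ nat a" by (simp add: power_int_def)
  then show "L powi a \<in> B" using sub_power[OF ring L_mem] by simp
qed

lemma coprime_unit:
  assumes "\<not> int l dvd k"
  shows "inverse (of_int k) \<in> B"
proof -
  have "coprime (int l) k" using prime assms by (simp add: prime_imp_coprime)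
  then obtain a b where ab: "a * int l + b * k = 1" using bezout_int[of "int l" k] by auto
  then have "of_int (a * int l + b * k) = (1 :: complex)" by simp
  then have eq: "of_int k * of_int b = 1 - L * of_int a" by (simp add: algebra_simps)
  have nz: "1 - L * of_int a \<noteq> 0" and i: "inverse (1 - L * of_int a) \<in> B"
    using one_minus_unit[OF sub_of_int[OF ring]] by blast+
  have "of_int k * (of_int b * inverse (1 - L * of_int a)) = 1"
    using nz by (simp flip: mult.assoc add: eq)
  then have "inverse (of_int k) = of_int b * inverse (1 - L * of_int a)" by (metis inverse_unique)
  then show ?thesis using sub_mult[OF ring sub_of_int[OF ring] i] by simp
qed

text \<open>Let \<open>l\<^sup>e m\<close> be the leading coefficient of an integer equation of \<open>u\<close>, with \<open>m\<close> prime to \<open>l\<close> and therefore a unit of \<open>B\<close>.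
  If \<open>l\<^sup>e u\<close> were not in \<open>B\<close>, then \<open>1/u\<close> would be, and dividing the equation by \<open>u\<^bsup>n-1\<^esup>\<close> would put \<open>l\<^sup>e u\<close> in \<open>B\<close>.\<close>

lemma bounded_denominator:
  assumes "algebraic u" "u \<noteq> 0"
  shows "\<exists>k. L ^ k * u \<in> B"
proof -
  obtain p where p': "\<forall>i. Polynomial.coeff p i \<in> \<int>" "p \<noteq> 0" "poly p u = 0"
    using assms(1) by (auto simp: algebraic_def)
  note p = p'(1)[rule_format] p'(2,3)
  define n where "n = Polynomial.degree p"
  obtain a where a: "Polynomial.coeff p n = of_int a" using p(1)[of n] by (auto elim: Ints_cases)
  have a0: "a \<noteq> 0" using p(2) a by (auto simp: n_def)
  have "n > 0"
  proof (rule ccontr)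
    assume "\<not> n > 0"
    then have "Polynomial.degree p = 0" by (simp add: n_def)
    then obtain c where "p = [:c:]" by (rule degree_eq_zeroE)
    then show False using p(2,3) by simp
  qed
  have "int l \<noteq> 0" "\<not> is_unit (int l)" using prime by (auto simp: prime_gt_0_nat)
  define e where "e = multiplicity (int l) a"
  obtain m where m: "a = int l ^ e * m" "\<not> int l dvd m"
    using multiplicity_decompose'[OF a0 \<open>\<not> is_unit (int l)\<close>] unfolding e_def by (metis mult.commute)
  have "L ^ e * u \<in> B"
  proof (rule ccontr)
    assume n1: "L ^ e * u \<notin> B"
    have "L ^ e * u \<noteq> 0" using L_nz assms(2) by simp
    then have y: "inverse (L ^ e * u) \<in> B" using valuation_ring n1 by blast
    have "inverse u = L ^ e * inverse (L ^ e * u)" using L_nz assms(2) by (simp add: field_simps)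
    then have iu: "inverse u \<in> B" by (rule ssubst) (rule sub_mult[OF ring sub_power[OF ring L_mem] y])
    have "0 = (\<Sum>i<Suc n. Polynomial.coeff p i * u ^ i) * inverse u ^ (n - 1)"
      using p(3) by (simp add: poly_altdef n_def lessThan_Suc_atMost)
    also have "\<dots> = (\<Sum>i<n. Polynomial.coeff p i * (u ^ i * inverse u ^ (n - 1))) + of_int a * (u ^ n * inverse u ^ (n - 1))"
      by (simp add: a sum_distrib_right distrib_right mult.assoc)
    also have "u ^ n * inverse u ^ (n - 1) = u"
    proof -
      have "u ^ n * inverse u ^ (n - 1) = u * (u * inverse u) ^ (n - 1)"
        using \<open>n > 0\<close> by (cases n) (simp_all add: power_mult_distrib mult_ac)
      then show ?thesis using assms(2) by simp
    qed
    also have "of_int a * u = of_int m * (L ^ e * u)" by (simp add: m(1) mult_ac)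
    finally have "of_int m * (L ^ e * u) = - (\<Sum>i<n. Polynomial.coeff p i * (u ^ i * inverse u ^ (n - 1)))"
      by (simp add: eq_neg_iff_add_eq_0 add.commute)
    also have "\<dots> \<in> B"
    proof (rule sub_uminus[OF ring], rule sub_sum[OF ring], rule sub_mult[OF ring])
      show "Polynomial.coeff p i \<in> B" for i using p(1)[of i] sub_of_int[OF ring] by (auto elim: Ints_cases)
      fix i assume "i \<in> {..<n}"
      then have i: "n - 1 = i + (n - 1 - i)" by auto
      have "u ^ i * inverse u ^ (n - 1) = (u * inverse u) ^ i * inverse u ^ (n - 1 - i)"
        by (subst i) (simp only: power_add power_mult_distrib mult.assoc)
      then have "u ^ i * inverse u ^ (n - 1) = inverse u ^ (n - 1 - i)" using assms(2) by simp
      then show "u ^ i * inverse u ^ (n - 1) \<in> B" using sub_power[OF ring iu] by simp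
    qed
    finally have "inverse (of_int m) * (of_int m * (L ^ e * u)) \<in> B"
      by (rule sub_mult[OF ring coprime_unit[OF m(2)]])
    moreover have "of_int m \<noteq> (0 :: complex)" using m(2) by auto
    ultimately show False using n1 by (simp flip: mult.assoc)
  qed
  then show ?thesis ..
qed

text \<open>The inequality \<open>a/b \<le> v(u)\<close>, expressed by membership in \<open>B\<close>. The valuation is the supremum of these
  fractions, normalised by \<open>v(l) = 1\<close>.\<close>

definition slope :: "complex \<Rightarrow> int \<Rightarrow> nat \<Rightarrow> bool" where
  "slope u a b \<longleftrightarrow> b > 0 \<and> u ^ b * L powi (- a) \<in> B"

definition slopes :: "complex \<Rightarrow> real set" where
  "slopes u = {of_int a / of_nat b | a b. slope u a b}"

definition val :: "complex \<Rightarrow> real" where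
  "val u = Sup (slopes u)"

lemma powi_pow: "(x powi a) ^ n = (x :: complex) powi (a * int n)"
  by (simp only: power_int_mult power_int_of_nat)

lemma slopeD: "slope u a b \<Longrightarrow> u ^ b * L powi (- a) \<in> B" "slope u a b \<Longrightarrow> b > 0"
  by (simp_all add: slope_def)

lemma slope_scale: "k > 0 \<Longrightarrow> slope u (int k * a) (k * b) \<longleftrightarrow> slope u a b"
proof -
  assume k: "k > 0"
  have "(u ^ b * L powi (- a)) ^ k = u ^ (b * k) * L powi (- a * int k)"
    by (simp only: power_mult_distrib power_mult powi_pow)
  then have "(u ^ b * L powi (- a)) ^ k = u ^ (k * b) * L powi (- (int k * a))"
    by (simp only: mult.commute[of b k] mult.commute[of "- a"] mult_minus_right)
  then show ?thesis
    unfolding slope_def using k root_closed[of "u ^ b * L powi (- a)" k] sub_power[OF ring, of "u ^ b * L powi (- a)" k]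
    by auto
qed

lemma slope_down:
  assumes "slope u a b" "b' > 0" "a' * int b \<le> a * int b'"
  shows "slope u a' b'"
proof -
  have b: "b > 0" using assms(1) by (simp add: slope_def)
  have "slope u (int b' * a) (b' * b)" using assms(1,2) by (simp add: slope_scale)
  then have "(u ^ (b' * b) * L powi (- (int b' * a))) * L powi (int b' * a - int b * a') \<in> B"
    by (rule sub_mult[OF ring slopeD(1)]) (use assms(3) in \<open>simp add: L_powi_mem mult.commute\<close>)
  moreover have "L powi (- (int b' * a)) * L powi (int b' * a - int b * a') = L powi (- (int b * a'))"
    using L_nz by (simp flip: power_int_add)
  ultimately have "slope u (int b * a') (b * b')" using b assms(2) by (simp add: slope_def mult.assoc mult.commute[of b])
  then show ?thesis by (simp only: slope_scale[OF b])
qed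

lemma slope_mult:
  assumes "slope u a b" "slope w c d"
  shows "slope (u * w) (int d * a + int b * c) (b * d)"
proof -
  have bd: "b > 0" "d > 0" using assms by (auto simp: slope_def)
  have s: "slope u (int d * a) (b * d)" "slope w (int b * c) (b * d)"
    using assms bd by (simp_all add: slope_scale mult.commute[of b d]) (simp_all add: slope_scale mult.commute[of d b])
  have "(u ^ (b * d) * L powi (- (int d * a))) * (w ^ (b * d) * L powi (- (int b * c))) \<in> B"
    by (rule sub_mult[OF ring slopeD(1)[OF s(1)] slopeD(1)[OF s(2)]])
  moreover have "L powi (- (int d * a)) * L powi (- (int b * c)) = L powi (- (int d * a + int b * c))"
    using L_nz by (simp flip: power_int_add)
  ultimately show ?thesis using bd by (simp add: slope_def power_mult_distrib mult_ac)
qed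

lemma slope_total:
  assumes "u \<noteq> 0" "b > 0"
  shows "slope u a b \<or> slope (inverse u) (- a) b"
proof -
  have "u ^ b * L powi (- a) \<noteq> 0" using assms L_nz by simp
  then have "u ^ b * L powi (- a) \<in> B \<or> inverse (u ^ b * L powi (- a)) \<in> B" by (rule valuation_ring)
  moreover have "inverse (u ^ b * L powi (- a)) = inverse u ^ b * L powi (- (- a))"
    using L_nz by (simp add: power_int_minus power_inverse)
  ultimately show ?thesis using assms(2) by (auto simp: slope_def)
qed

lemma slope_bound:
  assumes "L ^ k * inverse u \<in> B" "u \<noteq> 0" "slope u a b"
  shows "a \<le> int k * int b"
proof -
  have "(L ^ k * inverse u) ^ b * (u ^ b * L powi (- a)) \<in> B"
    by (rule sub_mult[OF ring sub_power[OF ring assms(1)] slopeD(1)[OF assms(3)]])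
  also have "(L ^ k * inverse u) ^ b * (u ^ b * L powi (- a)) = L powi (int k * int b) * L powi (- a) * (inverse u * u) ^ b"
  proof -
    have "L powi (int k * int b) = (L ^ k) ^ b"
      by (simp only: of_nat_mult[symmetric] power_int_of_nat power_mult)
    then show ?thesis by (simp add: power_mult_distrib mult_ac)
  qed
  also have "\<dots> = L powi (int k * int b - a)" using assms(2) L_nz by (simp flip: power_int_add)
  finally show ?thesis by (simp add: L_powi_mem)
qed

lemma slopes_bdd:
  assumes "algebraic u" "u \<noteq> 0"
  shows "slopes u \<noteq> {}" "bdd_above (slopes u)"
proof -
  obtain k where "L ^ k * u \<in> B" using bounded_denominator[OF assms] by blast
  then have "slope u (- int k) 1" by (simp add: slope_def mult.commute)
  then show "slopes u \<noteq> {}" by (auto simp: slopes_def)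
  obtain j where j: "L ^ j * inverse u \<in> B" using bounded_denominator[of "inverse u"] assms by auto
  show "bdd_above (slopes u)"
  proof (rule bdd_aboveI[of _ "real j"])
    fix x assume "x \<in> slopes u"
    then obtain a b where x: "x = of_int a / of_nat b" "slope u a b" by (auto simp: slopes_def)
    have "real_of_int a \<le> of_int (int j * int b)" using slope_bound[OF j assms(2) x(2)] by (simp only: of_int_le_iff)
    then show "x \<le> real j" unfolding x(1) using slopeD(2)[OF x(2)] by (simp add: divide_le_eq)
  qed
qed

lemma val_ge: "algebraic u \<Longrightarrow> u \<noteq> 0 \<Longrightarrow> slope u a b \<Longrightarrow> of_int a / of_nat b \<le> val u"
  unfolding val_def by (rule cSup_upper[OF _ slopes_bdd(2)]) (auto simp: slopes_def)

lemma val_le: "algebraic u \<Longrightarrow> u \<noteq> 0 \<Longrightarrow> (\<And>a b. slope u a b \<Longrightarrow> of_int a / of_nat b \<le> r) \<Longrightarrow> val u \<le> r"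
  unfolding val_def by (rule cSup_least[OF slopes_bdd(1)]) (auto simp: slopes_def)

lemma val_mult_ge:
  assumes u: "algebraic u" "u \<noteq> 0" and w: "algebraic w" "w \<noteq> 0"
  shows "val (u * w) \<ge> val u + val w"
proof -
  have uw: "algebraic (u * w)" "u * w \<noteq> 0" using assms algebraic_mult by auto
  have *: "of_int a / of_nat b + of_int c / of_nat d \<le> val (u * w)" if "slope u a b" "slope w c d" for a b c d
  proof -
    have "real b \<noteq> 0" "real d \<noteq> 0" using that by (auto simp: slope_def)
    then have "of_int a / of_nat b + of_int c / of_nat d = (of_int a * real d + of_int c * real b) / (real b * real d)"
      by (rule add_frac_eq)
    also have "\<dots> = of_int (int d * a + int b * c) / (of_nat (b * d) :: real)"
      by (simp add: mult.commute)
    finally have "of_int a / of_nat b + of_int c / of_nat d = of_int (int d * a + int b * c) / (of_nat (b * d) :: real)" .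
    then show ?thesis using val_ge[OF uw slope_mult[OF that]] by simp
  qed
  have "val u \<le> val (u * w) - val w"
  proof (rule val_le[OF u])
    fix a b assume s: "slope u a b"
    have "val w \<le> val (u * w) - of_int a / of_nat b"
      by (rule val_le[OF w]) (use *[OF s] in \<open>simp add: algebra_simps\<close>)
    then show "of_int a / of_nat b \<le> val (u * w) - val w" by simp
  qed
  then show ?thesis by simp
qed

lemma val_L_powi: "val (L powi k) = of_int k"
proof -
  have alg: "algebraic (L powi k)"
    using algebraic_int_imp_algebraic by (auto simp: power_int_def intro!: algebraic_power)
  have nz: "L powi k \<noteq> 0" using L_nz by simp
  have s: "slope (L powi k) a b \<longleftrightarrow> b > 0 \<and> a \<le> k * int b" for a b
  proof -
    have "(L powi k) ^ b * L powi (- a) = L powi (k * int b + - a)"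
      using L_nz by (simp only: powi_pow power_int_add simp_thms)
    then have "(L powi k) ^ b * L powi (- a) = L powi (k * int b - a)" by simp
    then show ?thesis by (simp add: slope_def L_powi_mem)
  qed
  show ?thesis
  proof (rule antisym)
    show "val (L powi k) \<le> of_int k"
    proof (rule val_le[OF alg nz])
      fix a b assume "slope (L powi k) a b"
      then have b: "b > 0" "a \<le> k * int b" by (auto simp: s)
      have "real_of_int a \<le> of_int (k * int b)" using b(2) by (simp only: of_int_le_iff)
      then show "of_int a / of_nat b \<le> real_of_int k" using b(1) by (simp add: field_simps)
    qed
    show "of_int k \<le> val (L powi k)" using val_ge[OF alg nz, of k 1] by (simp add: s)
  qed
qed

text \<open>Since \<open>B\<close> is a valuation ring, each fraction is a lower bound for the value of \<open>u\<close>, or its negative is one for that of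
  \<open>1/u\<close>. So there is no gap between \<open>v(u)\<close> and \<open>-v(1/u)\<close>.\<close>

lemma val_inverse:
  assumes u: "algebraic u" "u \<noteq> 0"
  shows "val (inverse u) = - val u"
proof (rule antisym)
  have i: "algebraic (inverse u)" "inverse u \<noteq> 0" using u by auto
  have "val (u * inverse u) \<ge> val u + val (inverse u)" by (rule val_mult_ge[OF u i])
  moreover have "val 1 = 0" using val_L_powi[of 0] by simp
  ultimately show "val (inverse u) \<le> - val u" using u by simp
  show "- val u \<le> val (inverse u)"
  proof (rule ccontr)
    assume "\<not> ?thesis"
    then have "val u < - val (inverse u)" by simp
    then obtain q where q: "q \<in> \<rat>" "val u < q" "q < - val (inverse u)" using Rats_dense_in_real by blast
    then obtain a b where ab: "b > 0" "q = of_int a / of_nat b" by (metis Rats_cases' of_int_of_nat_eq pos_int_cases of_nat_0_less_iff)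
    have "\<not> slope u a b" using val_ge[OF u] q(2) ab(2) by force
    then have "slope (inverse u) (- a) b" using slope_total[OF u(2) ab(1)] by blast
    from val_ge[OF i this] show False using q(3) ab(2) by simp
  qed
qed

lemma val_mult:
  assumes u: "algebraic u" "u \<noteq> 0" and w: "algebraic w" "w \<noteq> 0"
  shows "val (u * w) = val u + val w"
proof (rule antisym)
  have uw: "algebraic (u * w)" "u * w \<noteq> 0" using assms algebraic_mult by auto
  have i: "algebraic (inverse w)" "inverse w \<noteq> 0" using w by auto
  have "val (u * w * inverse w) \<ge> val (u * w) + val (inverse w)" by (rule val_mult_ge[OF uw i])
  then show "val (u * w) \<le> val u + val w" using w val_inverse[OF w] by (simp add: mult.assoc)
qed (rule val_mult_ge[OF assms])

text \<open>If \<open>u/w \<in> B\<close>, then \<open>u + w = w (1 + u/w)\<close> with \<open>1 + u/w \<in> B\<close>; otherwise exchange \<open>u\<close> and \<open>w\<close>.\<close>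

lemma val_add:
  assumes u: "algebraic u" "u \<noteq> 0" and w: "algebraic w" "w \<noteq> 0" and uw: "u + w \<noteq> 0"
  shows "val (u + w) \<ge> min (val u) (val w)"
proof -
  have alg: "algebraic (u + w)" using u w algebraic_add by blast
  have *: "val y \<le> val (x + y)" if y: "algebraic y" "y \<noteq> 0" and xy: "algebraic (x + y)" "x + y \<noteq> 0" and x: "x * inverse y \<in> B" for x y
  proof (rule val_le[OF y])
    fix a b assume s: "slope y a b"
    have "(y ^ b * L powi (- a)) * (1 + x * inverse y) ^ b \<in> B"
      by (rule sub_mult[OF ring slopeD(1)[OF s] sub_power[OF ring sub_add[OF ring sub_1[OF ring] x]]])
    also have "(y ^ b * L powi (- a)) * (1 + x * inverse y) ^ b = (y * (1 + x * inverse y)) ^ b * L powi (- a)"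
      by (simp add: power_mult_distrib mult_ac)
    also have "y * (1 + x * inverse y) = x + y" using y(2) by (simp add: field_simps)
    finally have "slope (x + y) a b" using s by (simp add: slope_def)
    then show "of_int a / of_nat b \<le> val (x + y)" by (rule val_ge[OF xy])
  qed
  have "u * inverse w \<noteq> 0" using u w by simp
  then have "u * inverse w \<in> B \<or> w * inverse u \<in> B" using valuation_ring[of "u * inverse w"] by (simp add: mult.commute)
  then show ?thesis
    using *[OF w alg uw] *[OF u, of w] alg uw by (auto simp: add.commute min_def)
qed

lemma val_nonneg: "z \<in> B \<Longrightarrow> algebraic z \<Longrightarrow> z \<noteq> 0 \<Longrightarrow> val z \<ge> 0"
  using val_ge[of z 0 1] by (simp add: slope_def)

lemma adic_valuation_exists: "adic_valuation l (\<lambda>u. if u = 0 then \<infinity> else ereal (val u))"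
  unfolding adic_valuation_def
proof (intro conjI allI impI)
  fix u w :: complex assume a: "algebraic u \<and> algebraic w"
  let ?v = "\<lambda>u. if u = 0 then \<infinity> else ereal (val u)"
  show "?v (u * w) = ?v u + ?v w" using a val_mult by auto
  show "min (?v u) (?v w) \<le> ?v (u + w)"
    using a val_add[of u w] by (cases "u = 0"; cases "w = 0") (auto simp: min_def)
next
  show "(if L = 0 then \<infinity> else ereal (val L)) = 1"
    using val_L_powi[of 1] L_nz by simp
qed auto

end

text \<open>If \<open>v(z) \<ge> 0\<close>, then \<open>v\<close> is nonnegative on \<open>\<int>[z]\<close>, so \<open>1/l\<close> is not in it. Conversely, by Zorn's lemma \<open>\<int>[z]\<close> is
  contained in a subring of the complex numbers that is maximal among those that do not contain \<open>1/l\<close>.\<close>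

theorem adic_valuation_iff:
  assumes l: "Factorial_Ring.prime l" and z: "algebraic z"
  shows "(\<exists>v. adic_valuation l v \<and> v z \<ge> 0) \<longleftrightarrow> (\<forall>f. of_nat l * ev1 f z \<noteq> 1)"
proof
  assume "\<exists>v. adic_valuation l v \<and> v z \<ge> 0"
  then obtain v where v: "adic_valuation l v" "v z \<ge> 0" by blast
  have fin: "v u \<noteq> -\<infinity>" "v u = \<infinity> \<longleftrightarrow> u = 0" if "algebraic u" for u
    using v(1) that unfolding adic_valuation_def by blast+
  have mult: "v (u * w) = v u + v w" and add: "v (u + w) \<ge> min (v u) (v w)" if "algebraic u" "algebraic w" for u w
    using v(1) that unfolding adic_valuation_def by blast+
  have v1: "v 1 = 0"
  proof -
    have "v 1 = v 1 + v 1" using mult[of 1 1] by simp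
    moreover obtain r where "v 1 = ereal r" using fin[of 1] by (cases "v 1") auto
    ultimately show ?thesis by (simp add: zero_ereal_def)
  qed
  have vm1: "v (- 1) = 0"
  proof -
    have "v (- 1) + v (- 1) = 0" using mult[of "- 1" "- 1"] v1 by simp
    moreover obtain r where "v (- 1) = ereal r" using fin[of "- 1"] by (cases "v (- 1)") auto
    ultimately show ?thesis by (simp add: zero_ereal_def)
  qed
  have v0: "v 0 = \<infinity>" using fin[of 0] by simp
  have vn: "v (of_nat n) \<ge> 0" for n
  proof (induction n)
    case (Suc n)
    have "algebraic (of_nat n :: complex)" "algebraic (1 :: complex)" by auto
    from add[OF this] show ?case using Suc v1 by (simp add: add.commute min_def split: if_splits)
  qed (simp add: v0)
  have vi: "v (of_int k) \<ge> 0" for k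
  proof (cases k rule: int_cases2)
    case (nonneg n)
    then show ?thesis using vn by simp
  next
    case (nonpos n)
    have "v (- 1 * of_nat n) = v (- 1) + v (of_nat n)" by (rule mult) auto
    then show ?thesis using vm1 vn nonpos by simp
  qed
  have alg: "algebraic (ev1 f z)" for f
  proof (induction f)
    case (pCons a f)
    then show ?case using z by (auto simp: ev1_pCons intro!: algebraic_add algebraic_mult)
  qed (simp add: ev1.hom_zero)
  have vf: "v (ev1 f z) \<ge> 0" for f
  proof (induction f)
    case 0
    then show ?case by (simp add: ev1.hom_zero v0)
  next
    case (pCons a f)
    have "algebraic (of_int a :: complex)" by auto
    have "v (of_int a + z * ev1 f z) \<ge> min (v (of_int a)) (v (z * ev1 f z))"
      by (rule add) (use alg z algebraic_mult in auto)
    moreover have "v (z * ev1 f z) = v z + v (ev1 f z)" by (rule mult[OF z alg])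
    moreover have "0 \<le> min (v (of_int a)) (v z + v (ev1 f z))"
      using pCons.IH v(2) vi[of a] by (simp add: add_nonneg_nonneg)
    ultimately show ?case unfolding ev1_pCons by (metis order_trans)
  qed
  show "\<forall>f. of_nat l * ev1 f z \<noteq> 1"
  proof (intro allI notI)
    fix f assume "of_nat l * ev1 f z = 1"
    then have "v 1 = v (of_nat l) + v (ev1 f z)" using mult[OF _ alg, of "of_nat l" f] by simp
    moreover have "v (of_nat l) = 1" using v(1) by (simp add: adic_valuation_def)
    ultimately have "0 = 1 + v (ev1 f z)" using v1 by simp
    moreover have "1 \<le> 1 + v (ev1 f z)" using vf[of f] by (metis add.right_neutral add_left_mono)
    ultimately show False by simp
  qed
next
  assume nounit: "\<forall>f. of_nat l * ev1 f z \<noteq> 1"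
  have l0: "of_nat l \<noteq> (0 :: complex)" using l by (simp add: prime_gt_0_nat)
  define \<A> where "\<A> = {B. is_subring B \<and> z \<in> B \<and> inverse (of_nat l) \<notin> B}"
  define B0 where "B0 = range (\<lambda>f. ev1 f z)"
  have "B0 \<in> \<A>"
  proof -
    have "is_subring B0"
      unfolding is_subring_def B0_def
      by (auto simp flip: ev1.hom_add ev1.hom_mult ev1.hom_uminus intro: range_eqI[of _ _ 1] simp: ev1.hom_one)
    moreover have "z \<in> B0" unfolding B0_def using ev1_X[of z] by (metis rangeI)
    moreover have "inverse (of_nat l) \<notin> B0"
    proof
      assume "inverse (of_nat l) \<in> B0"
      then obtain f where "inverse (of_nat l) = ev1 f z" by (auto simp: B0_def)
      then have "of_nat l * ev1 f z = 1" using l0 by (metis right_inverse)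
      then show False using nounit by blast
    qed
    ultimately show ?thesis by (simp add: \<A>_def)
  qed
  have "\<exists>M\<in>\<A>. \<forall>X'\<in>\<A>. M \<subseteq> X' \<longrightarrow> X' = M"
  proof (rule subset_Zorn_nonempty)
    show "\<A> \<noteq> {}" using \<open>B0 \<in> \<A>\<close> by blast
    fix \<C> assume \<C>: "\<C> \<noteq> {}" "subset.chain \<A> \<C>"
    then have sub: "\<C> \<subseteq> \<A>" and tot: "\<And>S T. S \<in> \<C> \<Longrightarrow> T \<in> \<C> \<Longrightarrow> S \<subseteq> T \<or> T \<subseteq> S"
      by (auto simp: subset.chain_def)
    have two: "\<exists>S\<in>\<C>. a \<in> S \<and> b \<in> S" if "a \<in> \<Union>\<C>" "b \<in> \<Union>\<C>" for a b
      using that tot by blast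
    have r: "is_subring S" if "S \<in> \<C>" for S using sub that by (auto simp: \<A>_def)
    have "is_subring (\<Union>\<C>)"
      unfolding is_subring_def
    proof (intro conjI ballI)
      show "1 \<in> \<Union>\<C>" using \<C>(1) r sub_1 by blast
      show "- a \<in> \<Union>\<C>" if "a \<in> \<Union>\<C>" for a using that r sub_uminus by blast
      show "a + b \<in> \<Union>\<C>" "a * b \<in> \<Union>\<C>" if "a \<in> \<Union>\<C>" "b \<in> \<Union>\<C>" for a b
        using two[OF that] r sub_add sub_mult by blast+
    qed
    then show "\<Union>\<C> \<in> \<A>" using \<C>(1) sub by (auto simp: \<A>_def)
  qed
  then obtain B where B: "B \<in> \<A>" "\<And>B'. B' \<in> \<A> \<Longrightarrow> B \<subseteq> B' \<Longrightarrow> B' = B" by blast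
  interpret maximal_subring B l
    by unfold_locales (use B l in \<open>auto simp: \<A>_def\<close>)
  show "\<exists>v. adic_valuation l v \<and> v z \<ge> 0"
  proof (intro exI conjI)
    show "adic_valuation l (\<lambda>u. if u = 0 then \<infinity> else ereal (val u))" by (rule adic_valuation_exists)
    show "0 \<le> (if z = 0 then \<infinity> else ereal (val z))" using val_nonneg[of z] B(1) z by (auto simp: \<A>_def)
  qed
qed

section \<open>Integral roots of integer polynomials\<close>

text \<open>The congruence of \<open>x\<close> and \<open>a\<close> modulo the \<open>n\<close>-th power of the prime.\<close>

definition adic_cong :: "nat \<Rightarrow> 'p::prime_card adic_int \<Rightarrow> int \<Rightarrow> bool" where
  "adic_cong n x a \<longleftrightarrow> Rep_adic_int x n = a mod int CARD('p) ^ n"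

lemma adic_eqI:
  assumes "\<And>n. \<exists>a. adic_cong n x a \<and> adic_cong n y a"
  shows "x = y"
proof -
  have "Rep_adic_int x = Rep_adic_int y"
    using assms by (intro ext) (metis adic_cong_def)
  then show ?thesis by (simp add: Rep_adic_int_inject)
qed

lemma adic_cong_add: "adic_cong n x a \<Longrightarrow> adic_cong n y b \<Longrightarrow> adic_cong n (x + y) (a + b)"
  by (simp add: adic_cong_def plus_adic_int.rep_eq mod_simps)

lemma adic_cong_mult: "adic_cong n x a \<Longrightarrow> adic_cong n y b \<Longrightarrow> adic_cong n (x * y) (a * b)"
  by (simp add: adic_cong_def times_adic_int.rep_eq mod_simps)

lemma adic_cong_0: "adic_cong n 0 0" and adic_cong_1: "adic_cong n 1 1"
  by (simp_all add: adic_cong_def zero_adic_int.rep_eq one_adic_int.rep_eq)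

lemma adic_cong_uminus: "adic_cong n x a \<Longrightarrow> adic_cong n (- x) (- a)"
  by (simp add: adic_cong_def uminus_adic_int.rep_eq mod_simps)

lemma adic_cong_sum: "(\<And>i. i \<in> A \<Longrightarrow> adic_cong n (f i) (g i)) \<Longrightarrow> adic_cong n (sum f A) (sum g A)"
  by (induction A rule: infinite_finite_induct) (auto intro: adic_cong_0 adic_cong_add)

lemma adic_cong_of_int: "adic_cong n (of_int k) k"
proof (induction k rule: int_induct[where k = 0])
  case base
  show ?case by (simp add: adic_cong_0)
next
  case (step1 i)
  then show ?case using adic_cong_add[OF step1.IH adic_cong_1] by simp
next
  case (step2 i)
  then show ?case using adic_cong_add[OF step2.IH adic_cong_uminus[OF adic_cong_1]] by simp
qed

text \<open>The adic limit of a sequence of integers whose consecutive terms satisfy the congruences of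
  \<open>adic_lim_cong\<close>.\<close>

definition adic_lim :: "(nat \<Rightarrow> int) \<Rightarrow> 'p::prime_card adic_int" where
  "adic_lim a = Abs_adic_int (\<lambda>n. a n mod int CARD('p) ^ n)"

lemma adic_lim_cong:
  assumes "\<And>n. int CARD('p) ^ n dvd a (Suc n) - a n"
  shows "adic_cong n (adic_lim a :: 'p::prime_card adic_int) (a n)"
proof -
  have "a n mod int CARD('p) ^ n = a (Suc n) mod int CARD('p) ^ Suc n mod int CARD('p) ^ n" for n
    unfolding mod_power_Suc_mod using assms[of n] by (metis mod_eq_dvd_iff)
  then have "Rep_adic_int (adic_lim a :: 'p adic_int) = (\<lambda>n. a n mod int CARD('p) ^ n)"
    unfolding adic_lim_def by (intro Abs_adic_int_inverse CollectI allI)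
  then show ?thesis by (simp add: adic_cong_def)
qed

definition adic_poly_lim :: "nat \<Rightarrow> (nat \<Rightarrow> int poly) \<Rightarrow> 'p::prime_card adic_int poly" where
  "adic_poly_lim D u = (\<Sum>i\<le>D. Polynomial.monom (adic_lim (\<lambda>n. Polynomial.coeff (u n) i)) i)"

lemma adic_poly_lim_cong:
  assumes "\<And>n i. int CARD('p) ^ n dvd Polynomial.coeff (u (Suc n)) i - Polynomial.coeff (u n) i"
    and deg: "\<And>n. Polynomial.degree (u n) \<le> D"
  shows "adic_cong n (Polynomial.coeff (adic_poly_lim D u :: 'p::prime_card adic_int poly) i) (Polynomial.coeff (u n) i)"
proof (cases "i \<le> D")
  case True
  then have "Polynomial.coeff (adic_poly_lim D u :: 'p adic_int poly) i = adic_lim (\<lambda>n. Polynomial.coeff (u n) i)"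
    by (simp add: adic_poly_lim_def coeff_sum)
  then show ?thesis using adic_lim_cong[of "\<lambda>n. Polynomial.coeff (u n) i", OF assms(1)] by simp
next
  case False
  then have "Polynomial.coeff (adic_poly_lim D u :: 'p adic_int poly) i = 0"
    by (auto simp: adic_poly_lim_def coeff_sum intro!: sum.neutral)
  moreover have "Polynomial.coeff (u n) i = 0" using deg[of n] False by (intro coeff_eq_0) simp
  ultimately show ?thesis by (simp add: adic_cong_0)
qed

definition poly_dvd :: "int \<Rightarrow> int poly \<Rightarrow> bool" where
  "poly_dvd c f \<longleftrightarrow> (\<exists>e. f = Polynomial.smult c e)"

lemma poly_dvd_coeff: "poly_dvd c f \<Longrightarrow> c dvd Polynomial.coeff f i"
  by (auto simp: poly_dvd_def)

lemma poly_dvdI: "c \<noteq> 0 \<Longrightarrow> (\<And>i. c dvd Polynomial.coeff f i) \<Longrightarrow> poly_dvd c f"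
  unfolding poly_dvd_def
  by (rule exI[of _ "map_poly (\<lambda>a. a div c) f"]) (rule poly_eqI, simp add: coeff_map_poly)

text \<open>The factorisation with a monic factor of degree \<open>k\<close> and a factor congruent to 1 is lifted from
  one power of the prime to the next by dividing the error by the monic factor.\<close>

lemma hensel_step:
  fixes R g h :: "int poly" and l :: int
  assumes n: "n > 0" and g: "Polynomial.lead_coeff g = 1" "Polynomial.degree g = k"
    and h: "Polynomial.degree h \<le> D - k" "poly_dvd l (h - 1)"
    and D: "Polynomial.degree R \<le> D" "k \<le> D" and l: "l \<noteq> 0"
    and R: "poly_dvd (l ^ n) (R - g * h)"
  shows "\<exists>g' h'. Polynomial.lead_coeff g' = 1 \<and> Polynomial.degree g' = k \<and> Polynomial.degree h' \<le> D - k \<and>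
    poly_dvd l (h' - 1) \<and> poly_dvd (l ^ Suc n) (R - g' * h') \<and> poly_dvd (l ^ n) (g' - g) \<and> poly_dvd (l ^ n) (h' - h)"
proof -
  obtain e where e: "R - g * h = Polynomial.smult (l ^ n) e" using R by (auto simp: poly_dvd_def)
  obtain q r where qr: "e = g * q + r" and r: "r = 0 \<or> Polynomial.degree r < Polynomial.degree g"
    using monic_division[OF g(1)] .
  obtain m where m: "h - 1 = Polynomial.smult l m" using h(2) by (auto simp: poly_dvd_def)
  obtain j where j: "n = Suc j" using n by (cases n) auto
  define g' where "g' = g + Polynomial.smult (l ^ n) r"
  define h' where "h' = h + Polynomial.smult (l ^ n) q"
  have dr: "Polynomial.degree (Polynomial.smult (l ^ n) r) < Polynomial.degree g \<or> r = 0"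
    using r by (auto intro: le_less_trans[OF degree_smult_le])
  have "Polynomial.degree g' = k \<and> Polynomial.lead_coeff g' = 1"
  proof (cases "r = 0")
    case True
    then show ?thesis using g by (simp add: g'_def)
  next
    case False
    then have d: "Polynomial.degree (Polynomial.smult (l ^ n) r) < Polynomial.degree g" using dr by simp
    then have "Polynomial.degree g' = k" unfolding g'_def using g(2) by (simp only: degree_add_eq_left)
    moreover have "Polynomial.coeff (Polynomial.smult (l ^ n) r) k = 0" using d g(2) by (intro coeff_eq_0) simp
    then have "Polynomial.coeff g' k = 1" using g by (simp add: g'_def)
    ultimately show ?thesis by simp
  qed
  moreover have "Polynomial.degree h' \<le> D - k"
  proof -
    have "Polynomial.degree (g * h) \<le> D" using degree_mult_le[of g h] g(2) h(1) D(2) by linarith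
    then have "Polynomial.degree (R - g * h) \<le> D" using D(1) by (intro degree_diff_le)
    then have "Polynomial.degree e \<le> D" unfolding e using l by simp
    moreover have "Polynomial.degree r \<le> D" using r g(2) D(2) by auto
    moreover have "g * q = e - r" using qr by simp
    ultimately have gq: "Polynomial.degree (g * q) \<le> D" by (simp only:) (intro degree_diff_le)
    have "Polynomial.degree q \<le> D - k"
    proof (cases "q = 0")
      case False
      moreover have "g \<noteq> 0" using g(1) by auto
      ultimately show ?thesis using gq g(2) by (simp add: degree_mult_eq)
    qed simp
    then show ?thesis unfolding h'_def using h(1)
      by (intro degree_add_le order_trans[OF degree_smult_le])
  qed
  moreover have "h' - 1 = Polynomial.smult l (m + Polynomial.smult (l ^ j) q)"
    using m by (simp add: h'_def j smult_add_right algebra_simps)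
  then have "poly_dvd l (h' - 1)" unfolding poly_dvd_def by blast
  moreover have "R - g' * h' = Polynomial.smult (l ^ Suc n) (- (r * m) - Polynomial.smult (l ^ j) (r * q))"
  proof -
    have "R - g' * h' = (R - g * h) - Polynomial.smult (l ^ n) (g * q + r * h + Polynomial.smult (l ^ n) (r * q))"
      by (simp add: g'_def h'_def smult_add_right algebra_simps)
    also have "\<dots> = Polynomial.smult (l ^ n) (- (r * (h - 1)) - Polynomial.smult (l ^ n) (r * q))"
      unfolding e qr by (simp add: smult_add_right smult_diff_right algebra_simps)
    also have "\<dots> = Polynomial.smult (l ^ Suc n) (- (r * m) - Polynomial.smult (l ^ j) (r * q))"
      unfolding m by (simp add: j smult_diff_right mult_ac)
    finally show ?thesis .
  qed
  then have "poly_dvd (l ^ Suc n) (R - g' * h')" unfolding poly_dvd_def by blast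
  moreover have "poly_dvd (l ^ n) (g' - g)" "poly_dvd (l ^ n) (h' - h)"
    unfolding poly_dvd_def g'_def h'_def by auto
  ultimately show ?thesis by blast
qed

text \<open>Modulo the prime, \<open>R\<close> is a monic polynomial of degree \<open>k\<close>, so it is congruent to the product of its monic
  truncation \<open>g0\<close> and 1. Lifting this factorisation step by step gives convergent sequences of factors. The bound
  \<open>D\<close> on the degrees lets the limit be taken coefficientwise.\<close>

lemma hensel_monic_factor:
  fixes R :: "int poly"
  assumes k: "[Polynomial.coeff R k = 1] (mod int CARD('p))"
    and gt: "\<And>i. i > k \<Longrightarrow> int CARD('p) dvd Polynomial.coeff R i"
  shows "\<exists>G H :: 'p::prime_card adic_int poly. Polynomial.lead_coeff G = 1 \<and> Polynomial.degree G = k \<and>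
     map_poly of_int R = G * H"
proof -
  define l where "l = int CARD('p)"
  have l: "l > 1" unfolding l_def using prime_card[where 'a = 'p] prime_gt_1_nat by simp
  define D where "D = max (Polynomial.degree R) k"
  define Inv where "Inv n gh \<longleftrightarrow> Polynomial.lead_coeff (fst gh) = 1 \<and> Polynomial.degree (fst gh) = k \<and>
     Polynomial.degree (snd gh) \<le> D - k \<and> poly_dvd l (snd gh - 1) \<and> poly_dvd (l ^ Suc n) (R - fst gh * snd gh)"
    for n :: nat and gh :: "int poly \<times> int poly"
  define Rel where "Rel n gh gh' \<longleftrightarrow> poly_dvd (l ^ Suc n) (fst gh' - fst gh) \<and> poly_dvd (l ^ Suc n) (snd gh' - snd gh)"
    for n :: nat and gh gh' :: "int poly \<times> int poly"
  define g0 where "g0 = (\<Sum>i<k. Polynomial.monom (Polynomial.coeff R i) i) + Polynomial.monom 1 k"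
  have cg: "Polynomial.coeff g0 i = (if i < k then Polynomial.coeff R i else if i = k then 1 else 0)" for i
    by (auto simp: g0_def coeff_sum)
  have dg: "Polynomial.degree g0 = k"
    by (rule antisym) (auto simp: cg intro!: degree_le le_degree)
  have "Inv 0 (g0, 1)"
  proof -
    have "poly_dvd l (R - g0)"
      by (rule poly_dvdI) (use l k gt in \<open>auto simp: cg l_def cong_iff_dvd_diff\<close>)
    moreover have "poly_dvd l 0" by (auto simp: poly_dvd_def intro: exI[of _ 0])
    ultimately show ?thesis by (simp add: Inv_def dg cg)
  qed
  moreover have "\<exists>gh'. Inv (Suc n) gh' \<and> Rel n gh gh'" if "Inv n gh" for n gh
  proof -
    have "\<exists>g' h'. Polynomial.lead_coeff g' = 1 \<and> Polynomial.degree g' = k \<and> Polynomial.degree h' \<le> D - k \<and>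
      poly_dvd l (h' - 1) \<and> poly_dvd (l ^ Suc (Suc n)) (R - g' * h') \<and> poly_dvd (l ^ Suc n) (g' - fst gh) \<and> poly_dvd (l ^ Suc n) (h' - snd gh)"
      by (rule hensel_step) (use that l in \<open>auto simp: Inv_def D_def\<close>)
    then show ?thesis unfolding Inv_def Rel_def by (metis fst_conv snd_conv)
  qed
  ultimately obtain F where F: "\<And>n. Inv n (F n)" "\<And>n. Rel n (F n) (F (Suc n))"
    using dependent_nat_choice[of Inv Rel] by blast
  define g h where "g = (\<lambda>n. fst (F n))" and "h = (\<lambda>n. snd (F n))"
  have inv: "Polynomial.coeff (g n) k = 1" "Polynomial.degree (g n) = k" "Polynomial.degree (h n) \<le> D - k"
    "poly_dvd (l ^ Suc n) (R - g n * h n)" for n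
    using F(1)[of n] by (auto simp: Inv_def g_def h_def)
  have rel: "l ^ n dvd Polynomial.coeff (g (Suc n)) i - Polynomial.coeff (g n) i"
    "l ^ n dvd Polynomial.coeff (h (Suc n)) i - Polynomial.coeff (h n) i" for n i
  proof -
    have "poly_dvd (l ^ Suc n) (g (Suc n) - g n)" "poly_dvd (l ^ Suc n) (h (Suc n) - h n)"
      using F(2)[of n] by (simp_all add: Rel_def g_def h_def)
    then have "l ^ Suc n dvd Polynomial.coeff (g (Suc n)) i - Polynomial.coeff (g n) i"
      "l ^ Suc n dvd Polynomial.coeff (h (Suc n)) i - Polynomial.coeff (h n) i"
      using poly_dvd_coeff[of _ _ i] by (metis coeff_diff)+
    then show "l ^ n dvd Polynomial.coeff (g (Suc n)) i - Polynomial.coeff (g n) i"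
      "l ^ n dvd Polynomial.coeff (h (Suc n)) i - Polynomial.coeff (h n) i"
      by (auto intro: dvd_trans[OF le_imp_power_dvd])
  qed
  define G H where "G = (adic_poly_lim k g :: 'p adic_int poly)" and "H = (adic_poly_lim (D - k) h :: 'p adic_int poly)"
  have Gc: "adic_cong n (Polynomial.coeff G i) (Polynomial.coeff (g n) i)" for n i
    unfolding G_def by (rule adic_poly_lim_cong) (use rel inv in \<open>auto simp: l_def\<close>)
  have Hc: "adic_cong n (Polynomial.coeff H i) (Polynomial.coeff (h n) i)" for n i
    unfolding H_def by (rule adic_poly_lim_cong) (use rel inv in \<open>auto simp: l_def\<close>)
  have "Polynomial.coeff G k = 1" by (rule adic_eqI) (use Gc[of _ k] inv(1) adic_cong_1 in metis)
  moreover have "Polynomial.coeff G i = 0" if "i > k" for i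
  proof (rule adic_eqI)
    fix n
    have "Polynomial.coeff (g n) i = 0" using inv(2)[of n] that by (intro coeff_eq_0) simp
    then show "\<exists>a. adic_cong n (Polynomial.coeff G i) a \<and> adic_cong n 0 a" using Gc[of n i] adic_cong_0 by metis
  qed
  ultimately have "Polynomial.degree G = k" by (intro antisym degree_le le_degree) auto
  moreover have "map_poly of_int R = G * H"
  proof (rule poly_eqI, rule adic_eqI)
    fix m n
    have "adic_cong n (Polynomial.coeff (G * H) m) (Polynomial.coeff (g n * h n) m)"
      unfolding coeff_mult by (intro adic_cong_sum adic_cong_mult Gc Hc)
    moreover have "l ^ n dvd Polynomial.coeff R m - Polynomial.coeff (g n * h n) m"
      using poly_dvd_coeff[OF inv(4)[of n], of m] by (auto intro: dvd_trans[OF le_imp_power_dvd])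
    then have "Polynomial.coeff R m mod l ^ n = Polynomial.coeff (g n * h n) m mod l ^ n" by (simp add: mod_eq_dvd_iff)
    ultimately have "adic_cong n (Polynomial.coeff (G * H) m) (Polynomial.coeff R m)"
      by (simp add: adic_cong_def l_def)
    moreover have "adic_cong n (Polynomial.coeff (map_poly of_int R) m :: 'p adic_int) (Polynomial.coeff R m)"
      by (simp add: coeff_map_poly adic_cong_of_int)
    ultimately show "\<exists>a. adic_cong n (Polynomial.coeff (map_poly of_int R) m :: 'p adic_int) a \<and> adic_cong n (Polynomial.coeff (G * H) m) a"
      by (intro exI[of _ "Polynomial.coeff R m"] conjI)
  qed
  ultimately show ?thesis using \<open>Polynomial.coeff G k = 1\<close> by metis
qed

text \<open>Let \<open>K\<close> be the largest index of a coefficient that the prime does not divide. A multiple of \<open>R\<close> is monic of degree \<open>K\<close> modulo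
  the prime, so it has a monic factor of positive degree over the adic integers, whose roots are integral.\<close>

lemma integral_root_exists:
  fixes R :: "int poly"
  assumes k: "k > 0" "\<not> int CARD('p) dvd Polynomial.coeff R k"
  shows "\<exists>b \<in> (adic_integers :: 'p::prime_card adic_closure set). ev1 R b = 0"
proof -
  define l where "l = int CARD('p)"
  have prime: "Factorial_Ring.prime l" unfolding l_def by (rule adic_prime)
  define K where "K = Max {i. \<not> l dvd Polynomial.coeff R i}"
  have fin: "finite {i. \<not> l dvd Polynomial.coeff R i}"
    by (rule finite_subset[of _ "{..Polynomial.degree R}"]) (auto intro: le_degree)
  have "K \<in> {i. \<not> l dvd Polynomial.coeff R i}" unfolding K_def by (rule Max_in[OF fin]) (use k in \<open>auto simp: l_def\<close>)
  then have K: "\<not> l dvd Polynomial.coeff R K" by simp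
  have "k \<le> K" unfolding K_def by (rule Max_ge[OF fin]) (use k in \<open>simp add: l_def\<close>)
  then have K0: "K > 0" using k by simp
  have gt: "l dvd Polynomial.coeff R i" if "i > K" for i
    using Max_ge[OF fin, of i] that unfolding K_def[symmetric] by auto
  have "coprime l (Polynomial.coeff R K)" using prime K by (simp add: prime_imp_coprime)
  then obtain c where c: "[Polynomial.coeff R K * c = 1] (mod l)" using cong_solve_coprime_int by (metis coprime_commute)
  have c0: "c \<noteq> 0"
  proof
    assume "c = 0"
    then have "l dvd 1" using c by (simp add: cong_iff_dvd_diff)
    then show False using prime not_prime_unit by blast
  qed
  obtain G H :: "'p adic_int poly" where GH: "Polynomial.lead_coeff G = 1" "Polynomial.degree G = K"
    "map_poly of_int (Polynomial.smult c R) = G * H"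
    using hensel_monic_factor[where 'p = 'p and R = "Polynomial.smult c R" and k = K] c gt by (auto simp: l_def mult.commute)
  have "Polynomial.degree (map_poly adic_embed G) = K"
    unfolding GH(2)[symmetric] by (rule degree_map_poly) (use GH(1) in auto)
  then obtain b where b: "poly (map_poly adic_embed G) b = 0" using alg_closed_imp_poly_has_root K0 by metis
  have "b \<in> adic_integers" unfolding adic_integers_def using GH(1) b by blast
  moreover have "ev1 R b = 0"
  proof -
    interpret ev: comm_ring_hom "\<lambda>f. poly (map_poly adic_embed f) b"
      by (rule poly_map_poly_hom) (rule adic_embed.comm_ring_hom_axioms)
    have "poly (map_poly adic_embed (map_poly of_int (Polynomial.smult c R))) b = 0"
      unfolding GH(3) ev.hom_mult b by simp
    moreover have "map_poly adic_embed (map_poly of_int f) = (map_poly of_int f :: 'p adic_closure poly)" for f :: "int poly"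
      by (rule poly_eqI) (simp add: coeff_map_poly adic_embed.hom_of_int)
    ultimately have "ev1 (Polynomial.smult c R) b = 0" by (simp add: ev1_def)
    moreover have "Polynomial.smult c R = of_int c * R" by (simp add: of_int_poly)
    ultimately show ?thesis using c0 by (simp add: ev1.hom_mult ev1.hom_of_int)
  qed
  ultimately show ?thesis by blast
qed

text \<open>A primitive equation of \<open>z\<close> has a coefficient of positive degree that is prime to \<open>l\<close>. Otherwise it would have the
  form \<open>a + l z U(z) = 0\<close> with \<open>a\<close> prime to \<open>l\<close>, which makes \<open>l\<close> a unit in \<open>\<int>[z]\<close>.\<close>

lemma integral_conjugate_exists:
  fixes z :: complex
  assumes R: "R \<noteq> 0" "ev1 R z = 0" and nounit: "\<And>f. of_nat CARD('p) * ev1 f z \<noteq> 1"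
  shows "\<exists>b \<in> (adic_integers :: 'p::prime_card adic_closure set). ev1 R b = 0"
proof -
  define l where "l = int CARD('p)"
  have prime: "Factorial_Ring.prime l" unfolding l_def by (rule adic_prime)
  define S where "S = primitive_part R"
  have RS: "R = Polynomial.smult (Polynomial.content R) S" by (simp add: S_def)
  have ev: "ev1 R u = of_int (Polynomial.content R) * ev1 S u" for u :: "'b::comm_ring_1"
  proof -
    have "R = of_int (Polynomial.content R) * S" by (subst RS) (simp add: of_int_poly)
    then have "ev1 R u = ev1 (of_int (Polynomial.content R) * S) u" by (rule arg_cong)
    then show ?thesis by (simp only: ev1.hom_mult ev1.hom_of_int)
  qed
  have Sz: "ev1 S z = 0" using R ev[of z] by simp
  have "\<exists>i>0. \<not> l dvd Polynomial.coeff S i"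
  proof (rule ccontr)
    assume "\<not> ?thesis"
    then have div: "l dvd Polynomial.coeff S i" if "i > 0" for i using that by blast
    obtain a T where S: "S = pCons a T" by (cases S)
    have T: "poly_dvd l T"
      by (rule poly_dvdI) (use prime div[of "Suc _"] in \<open>auto simp: S\<close>)
    then obtain U where U: "T = Polynomial.smult l U" by (auto simp: poly_dvd_def)
    have "\<not> l dvd a"
    proof
      assume "l dvd a"
      then have "[:l:] dvd S" unfolding const_poly_dvd_iff S using U by (auto simp: coeff_pCons split: nat.split)
      then have "l dvd Polynomial.content S" by (simp add: const_poly_dvd_iff_dvd_content)
      moreover have "Polynomial.content S = 1" unfolding S_def using R(1) by simp
      ultimately show False using prime not_prime_unit by auto
    qed
    then have "coprime l a" using prime by (simp add: prime_imp_coprime)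
    then obtain c d where cd: "c * l + d * a = 1" using bezout_int[of l a] by auto
    have T2: "T = of_int l * U" unfolding U by (simp add: of_int_poly)
    have "of_int a + z * (of_int l * ev1 U z) = 0"
      using Sz unfolding S T2 ev1_pCons by (simp only: ev1.hom_mult ev1.hom_of_int)
    then have a: "of_int a = - (z * (of_int l * ev1 U z))" by (simp add: eq_neg_iff_add_eq_0)
    have "(1 :: complex) = of_int (c * l + d * a)" by (simp add: cd)
    also have "\<dots> = of_int l * (of_int c - of_int d * (z * ev1 U z))" by (simp add: a algebra_simps)
    also have "of_int c - of_int d * (z * ev1 U z) = ev1 (of_int c - of_int d * ([:0, 1:] * U)) z"
      by (simp only: ev1.hom_minus ev1.hom_mult ev1.hom_of_int ev1_X)
    finally show False using nounit by (simp add: l_def)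
  qed
  then obtain i where "i > 0" "\<not> int CARD('p) dvd Polynomial.coeff S i" by (auto simp: l_def)
  from integral_root_exists[OF this] obtain b :: "'p adic_closure" where "b \<in> adic_integers" "ev1 S b = 0" by blast
  then show ?thesis using ev[of b] by auto
qed

section \<open>Algebraic points of the two families\<close>

lemma integral_root_of_unity:
  fixes \<phi> :: "'a::idom \<Rightarrow> 'b::field"
  assumes "comm_ring_hom \<phi>" "u ^ k = 1" "k > 0"
  shows "integral_over \<phi> u"
proof -
  interpret comm_ring_hom \<phi> by fact
  define f where "f = Polynomial.monom (1::'a) k + [:-1:]"
  have "Polynomial.degree f = k"
    unfolding f_def using assms(3) by (subst degree_add_eq_left) (auto simp: degree_monom_eq)
  then have "Polynomial.lead_coeff f = 1" using assms(3) by (simp add: f_def coeff_pCons split: nat.split)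
  moreover have "map_poly \<phi> f = Polynomial.monom 1 k + [:-1:]"
    by (rule poly_eqI) (auto simp: f_def coeff_map_poly hom_add hom_uminus coeff_pCons split: nat.split)
  then have "poly (map_poly \<phi> f) u = 0" using assms(2) by (simp add: poly_monom)
  ultimately show ?thesis unfolding integral_over_def by blast
qed

lemma powi_unit_torsion:
  fixes u :: "'a::field"
  assumes "u powi n = a" "a * a = 1"
  shows "u ^ (2 * nat \<bar>n\<bar>) = 1"
proof -
  have "(u powi \<bar>n\<bar>) * (u powi \<bar>n\<bar>) = 1"
  proof (cases "n \<ge> 0")
    case True
    then show ?thesis using assms by simp
  next
    case False
    then have "u powi \<bar>n\<bar> = inverse a" using assms(1) by (simp add: power_int_minus[symmetric] flip: assms(1))
    then show ?thesis using assms(2) by (simp flip: inverse_mult_distrib)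
  qed
  moreover have "u powi \<bar>n\<bar> = u ^ nat \<bar>n\<bar>" by (simp add: power_int_def)
  ultimately show ?thesis by (simp add: mult_2 power_add)
qed

lemma type_roots_torsion:
  assumes "type_roots n1 n2 m1 m2 e \<zeta> \<eta>" "e \<in> {1, -1}"
  shows "\<zeta> ^ (2 * nat \<bar>n1 - n2\<bar>) = 1" "\<eta> ^ (2 * nat \<bar>m1 - m2\<bar>) = 1"
proof -
  have "\<zeta> powi (n1 - n2) = - of_int e" "\<eta> powi (m1 - m2) = of_int e" using assms(1) by (auto simp: type_roots_def)
  moreover have "- of_int e * - of_int e = (1 :: complex)" "of_int e * of_int e = (1 :: complex)"
    using assms(2) by auto
  ultimately show "\<zeta> ^ (2 * nat \<bar>n1 - n2\<bar>) = 1" "\<eta> ^ (2 * nat \<bar>m1 - m2\<bar>) = 1"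
    using powi_unit_torsion by metis+
qed

lemma finite_type_roots:
  assumes "n1 \<noteq> n2" "m1 \<noteq> m2" "e \<in> {1, -1}"
  shows "finite {(\<zeta>, \<eta>). type_roots n1 n2 m1 m2 e \<zeta> \<eta>}"
proof (rule finite_subset)
  show "{(\<zeta>, \<eta>). type_roots n1 n2 m1 m2 e \<zeta> \<eta>} \<subseteq>
      {\<zeta>. \<zeta> ^ (2 * nat \<bar>n1 - n2\<bar>) = 1} \<times> {\<eta>. \<eta> ^ (2 * nat \<bar>m1 - m2\<bar>) = 1}"
    using type_roots_torsion[OF _ assms(3)] by auto
  show "finite ({\<zeta>::complex. \<zeta> ^ (2 * nat \<bar>n1 - n2\<bar>) = 1} \<times> {\<eta>::complex. \<eta> ^ (2 * nat \<bar>m1 - m2\<bar>) = 1})"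
    using assms by (intro finite_cartesian_product finite_roots_unity) auto
qed

lemma algebraic_diff: "algebraic u \<Longrightarrow> algebraic v \<Longrightarrow> algebraic (u - v :: complex)"
  using algebraic_add[of u "- v"] by simp

lemma algebraic_powi: "algebraic u \<Longrightarrow> algebraic (u powi n :: complex)"
  by (auto simp: power_int_def intro: algebraic_power algebraic_inverse)

lemma algebraic_root_of_unity: "u ^ k = 1 \<Longrightarrow> k > 0 \<Longrightarrow> algebraic (u :: complex)"
  unfolding algebraic_iff by (rule integral_root_of_unity[OF of_rat_comm_ring_hom])

lemma type_point_algebraic:
  assumes "type_roots n1 n2 m1 m2 e \<zeta> \<eta>" "e \<in> {1, -1}" "n1 \<noteq> n2" "m1 \<noteq> m2"
  shows "algebraic \<zeta>" "algebraic \<eta>" "algebraic (type_point n1 m1 \<zeta> \<eta> v)"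
proof -
  show z: "algebraic \<zeta>" and h: "algebraic \<eta>"
    using type_roots_torsion[OF assms(1,2)] algebraic_root_of_unity assms(3,4) by auto
  have "algebraic (z_value n1 m1 \<zeta> \<eta>)"
    unfolding z_value_def
    by (intro algebraic_add algebraic_mult algebraic_divide algebraic_diff algebraic_powi z h)
  then show "algebraic (type_point n1 m1 \<zeta> \<eta> v)"
    using z h by (cases v) (auto simp: type_point_def trace_point_simps intro: algebraic_add algebraic_inverse)
qed

lemma int_poly_nonzero_const:
  assumes "algebraic (u :: complex)" "u \<noteq> 0"
  shows "\<exists>g. Polynomial.coeff g 0 \<noteq> 0 \<and> ev1 g u = 0"
proof -
  have "\<exists>g. Polynomial.coeff g 0 \<noteq> 0 \<and> ev1 g u = 0" if "ev1 g u = 0" "g \<noteq> 0" for g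
    using that
  proof (induction g)
    case (pCons a g)
    show ?case
    proof (cases "a = 0")
      case True
      then have "u * ev1 g u = 0" "g \<noteq> 0" using pCons.prems by (auto simp: ev1_pCons)
      then show ?thesis using pCons.IH assms(2) by simp
    next
      case False
      then show ?thesis using pCons.prems by (intro exI[of _ "pCons a g"]) simp
    qed
  qed simp
  moreover obtain p where p: "\<forall>i. Polynomial.coeff p i \<in> \<int>" "p \<noteq> 0" "poly p u = 0"
    using assms(1) by (auto simp: algebraic_def)
  then obtain c where c: "\<And>i. Polynomial.coeff p i = of_int (c i)" by (auto simp: Ints_def image_iff) metis
  define q where "q = map_poly (inv_into UNIV (of_int :: int \<Rightarrow> complex)) p"
  have inv: "inv_into UNIV (of_int :: int \<Rightarrow> complex) (of_int x) = x" for x by (simp add: inj_on_def inv_f_f)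
  have "p = map_poly of_int q"
    by (rule poly_eqI) (use inv[of 0] in \<open>simp add: q_def coeff_map_poly c inv\<close>)
  then have "ev1 q u = 0" "q \<noteq> 0" using p by (auto simp: ev1_def)
  ultimately show ?thesis by blast
qed

lemma ev1_const_mem:
  assumes "is_ideal I" "f \<in> I" "ev1 g f \<in> I"
  shows "of_int (Polynomial.coeff g 0) \<in> I"
proof -
  obtain a h where g: "g = pCons a h" by (cases g)
  have "ev1 g f = of_int a + f * ev1 h f" by (simp add: g ev1_pCons)
  then have "of_int a = ev1 g f - f * ev1 h f" by simp
  then show ?thesis using assms by (simp add: g ideal_diff ideal_mult_r)
qed

text \<open>An algebraic point is closed: a polynomial that does not vanish at the point satisfies there an integer
  equation with nonzero constant term, and this term would lie in every larger prime that contains the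
  polynomial.\<close>

lemma fibre_Q_algebraic_point:
  fixes p :: "'v \<Rightarrow> complex"
  assumes "\<And>v. algebraic (p v)"
  shows "fibre_Q (ker_eval p) = {ker_eval p}"
proof (intro equalityI subsetI)
  fix Q assume Q: "Q \<in> fibre_Q (ker_eval p)"
  have "f \<in> ker_eval p" if f: "f \<in> Q" for f
  proof (rule ccontr)
    assume "f \<notin> ker_eval p"
    then have "eval p f \<noteq> 0" by (simp add: ker_eval_def)
    then obtain g where g: "Polynomial.coeff g 0 \<noteq> 0" "ev1 g (eval p f) = 0"
      using int_poly_nonzero_const[OF algebraic_eval[of p f]] assms by blast
    then have "ev1 g f \<in> ker_eval p" by (simp add: ker_eval_def eval_hom.hom_ev1)
    then have "of_int (Polynomial.coeff g 0) \<in> Q"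
      using Q f by (intro ev1_const_mem[of Q f]) (auto simp: fibre_Q_iff prime_ideal)
    then show False using Q g(1) by (auto simp: fibre_Q_iff)
  qed
  then show "Q \<in> {ker_eval p}" using Q by (auto simp: fibre_Q_iff)
next
  fix Q assume "Q \<in> {ker_eval p}"
  then show "Q \<in> fibre_Q (ker_eval p)" using ker_eval_fibre by blast
qed

text \<open>If \<open>u\<^sup>n = a u\<^sup>k\<close> with \<open>a = \<plusminus>1\<close>, the same holds for \<open>u\<^sup>-\<^sup>1\<close>; these two equations determine the coefficients of
  \<open>u\<^sup>n\<close> with respect to \<open>u\<close> and 1.\<close>

lemma type_point_eqs:
  assumes roots: "type_roots n1 n2 m1 m2 e \<zeta> \<eta>" and e: "e \<in> {1, -1}"
  shows "type_eqs n1 n2 m1 m2 e vx vy vz \<subseteq> ker_eval (type_point n1 m1 \<zeta> \<eta>)"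
proof -
  have key: "cpol n (u + inverse u) - a * cpol k (u + inverse u) = 0 \<and>
      dpol n (u + inverse u) - a * dpol k (u + inverse u) = 0"
    if "u powi (n - k) = a" "a * a = 1" "u \<notin> {0, 1, -1}" for u a :: complex and n k
  proof -
    have u: "u \<noteq> 0" using that by auto
    have 1: "u powi n = a * u powi k" using that(1) u by (simp add: power_int_diff field_simps)
    have "inverse a = a" using that(2) by (metis inverse_unique)
    then have 2: "u powi (- n) = a * u powi (- k)" by (simp add: power_int_minus 1)
    have "(cpol n (u + inverse u) - a * cpol k (u + inverse u)) * (u - inverse u) =
        cpol n (u + inverse u) * (u - inverse u) - a * (cpol k (u + inverse u) * (u - inverse u))"
      by (simp add: left_diff_distrib)
    also have "\<dots> = 0" unfolding cpol_powi[OF u] 1 2 by (simp add: right_diff_distrib)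
    finally have "(cpol n (u + inverse u) - a * cpol k (u + inverse u)) * (u - inverse u) = 0" .
    then have c: "cpol n (u + inverse u) - a * cpol k (u + inverse u) = 0"
      using root_diff_nonzero[OF that(3)] by simp
    then have c': "cpol n (u + inverse u) = a * cpol k (u + inverse u)" by simp
    have "dpol n (u + inverse u) - a * dpol k (u + inverse u) = 0"
      using powi_cd[OF u, of n] powi_cd[OF u, of k] unfolding 1 c' by (simp add: algebra_simps)
    then show ?thesis using c by simp
  qed
  have ee: "of_int e * of_int e = (1 :: complex)" using e by auto
  have 1: "\<zeta> powi (n1 - n2) = - of_int e" "\<eta> powi (m1 - m2) = of_int e"
    "\<zeta> \<notin> {0, 1, -1}" "\<eta> \<notin> {0, 1, -1}" using roots by (auto simp: type_roots_def)
  have "(- of_int e) * (- of_int e) = (1 :: complex)" using ee by simp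
  from key[OF 1(1) this 1(3)] key[OF 1(2) ee 1(4)] type_point_rel[OF roots]
  show ?thesis
    by (auto simp: type_eqs_def ker_eval_def eval_hom.hom_add eval_hom.hom_minus eval_hom.hom_mult
        eval_hom.hom_cpol eval_hom.hom_dpol eval_hom.hom_of_int eval_Var type_point_def trace_point_simps)
qed

text \<open>If for each of the finitely many points of type \<open>e\<close> some polynomial outside \<open>P\<close> vanished there, then the product of
  these polynomials would vanish at all of them. By \<open>vanishing_at_type_points\<close> it would lie in \<open>P\<close>, since the extra
  factors do not. Closedness of the points then identifies \<open>P\<close>.\<close>

theorem prime_is_type_point:
  assumes P: "P \<in> fibre_Q (type_eqs n1 n2 m1 m2 e vx vy vz)" and e: "e \<in> {1, -1}"
    and sum: "m1 + m2 \<in> {1, -1} \<or> n1 + n2 \<in> {1, -1}"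
    and ne: "e = 1 \<Longrightarrow> m1 \<noteq> m2" "e = -1 \<Longrightarrow> n1 \<noteq> n2"
  shows "n1 \<noteq> n2" "m1 \<noteq> m2"
    "\<exists>\<zeta> \<eta>. type_roots n1 n2 m1 m2 e \<zeta> \<eta> \<and> P = ker_eval (type_point n1 m1 \<zeta> \<eta>)"
proof -
  have prime: "is_prime P" and sub: "type_eqs n1 n2 m1 m2 e vx vy vz \<subseteq> P"
    and ints: "\<And>k::int. k \<noteq> 0 \<Longrightarrow> of_int k \<notin> P"
    using P by (auto simp: fibre_Q_iff)
  note I = prime_ideal[OF prime]
  note tor = type_eqs_torsion[OF I e sub] and nz = type_eqs_nonzero[OF prime sub e sum]
  have two: "2 \<notin> P" using ints[of 2] by simp
  have m2: "-2 \<notin> P" using ideal_uminus[OF I, of "-2"] two by auto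
  show st: "n1 \<noteq> n2" "m1 \<noteq> m2"
    using tor(2,4) e ne two m2 by (auto simp: dpol_0)
  have w: "(dpol (n1 - n2) vx - of_int e) * (dpol (m1 - m2) vy + of_int e) \<notin> P"
  proof
    assume "(dpol (n1 - n2) vx - of_int e) * (dpol (m1 - m2) vy + of_int e) \<in> P"
    then have "dpol (n1 - n2) vx - of_int e \<in> P \<or> dpol (m1 - m2) vy + of_int e \<in> P"
      using prime by (simp add: prime_mult)
    then have "of_int (2 * e) \<in> P"
      using ideal_diff[OF I tor(2), of "dpol (n1 - n2) vx - of_int e"]
        ideal_diff[OF I _ tor(4), of "dpol (m1 - m2) vy + of_int e"] by auto
    then show False using ints[of "2 * e"] e by auto
  qed
  define V where "V = {(\<zeta>, \<eta>). type_roots n1 n2 m1 m2 e \<zeta> \<eta>}"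
  have fin: "finite V" unfolding V_def by (rule finite_type_roots[OF st e])
  have "\<exists>(\<zeta>, \<eta>)\<in>V. ker_eval (type_point n1 m1 \<zeta> \<eta>) \<subseteq> P"
  proof (rule ccontr)
    assume "\<not> ?thesis"
    then have "\<forall>q\<in>V. \<exists>f. eval (type_point n1 m1 (fst q) (snd q)) f = 0 \<and> f \<notin> P"
      by (fastforce simp: ker_eval_def)
    then obtain F where F: "\<And>q. q \<in> V \<Longrightarrow> eval (type_point n1 m1 (fst q) (snd q)) (F q) = 0" "\<And>q. q \<in> V \<Longrightarrow> F q \<notin> P"
      by metis
    define f where "f = (\<Prod>q\<in>V. F q)"
    have "eval (type_point n1 m1 \<zeta> \<eta>) f = 0" if "type_roots n1 n2 m1 m2 e \<zeta> \<eta>" for \<zeta> \<eta>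
      using that F(1)[of "(\<zeta>, \<eta>)"] fin unfolding f_def eval_hom.hom_prod
      by (intro prod_zero) (auto simp: V_def)
    from vanishing_at_type_points[OF I _ tor(1,3) st e this] sub obtain N
      where "(cpol n1 vx * cpol m1 vy) ^ N * ((dpol (n1 - n2) vx - of_int e) * (dpol (m1 - m2) vy + of_int e)) * f \<in> P"
      by (auto simp: type_eqs_def)
    moreover have "(cpol n1 vx * cpol m1 vy) ^ N \<notin> P"
      using prime_power[OF prime, of "cpol n1 vx * cpol m1 vy" N] nz by (auto simp: prime_mult[OF prime])
    ultimately have "f \<in> P" using w by (simp only: prime_mult[OF prime] simp_thms)
    then show False using prime_prod[OF prime] F(2) unfolding f_def by blast
  qed
  then obtain \<zeta> \<eta> where r: "type_roots n1 n2 m1 m2 e \<zeta> \<eta>" and "ker_eval (type_point n1 m1 \<zeta> \<eta>) \<subseteq> P"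
    by (auto simp: V_def)
  then have "P \<in> fibre_Q (ker_eval (type_point n1 m1 \<zeta> \<eta>))" using P by (simp add: fibre_Q_iff)
  then have "P = ker_eval (type_point n1 m1 \<zeta> \<eta>)"
    using fibre_Q_algebraic_point[of "type_point n1 m1 \<zeta> \<eta>"] type_point_algebraic(3)[OF r e st] by simp
  then show "\<exists>\<zeta> \<eta>. type_roots n1 n2 m1 m2 e \<zeta> \<eta> \<and> P = ker_eval (type_point n1 m1 \<zeta> \<eta>)" using r by blast
qed

section \<open>Reducible points outside the closure of the irreducible representations\<close>

definition rep_point :: "word \<Rightarrow> (word set \<Rightarrow> 'a ^ 2 ^ 2) \<Rightarrow> matvar \<Rightarrow> 'a" where
  "rep_point r \<rho> = (\<lambda>(s, i, j). rep_mats r \<rho> s $ i $ j)"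

text \<open>The preimage of the ideal of the scheme of homomorphisms in the local ring of the affine space at
  \<open>\<rho>\<close>.\<close>

definition local_ideal :: "word \<Rightarrow> (word set \<Rightarrow> complex ^ 2 ^ 2) \<Rightarrow> matvar zpoly set" where
  "local_ideal r \<rho> = {f. \<exists>g. eval (rep_point r \<rho>) g \<noteq> 0 \<and> g * f \<in> hom_ideal r}"

lemma gen_irr_ideal_iff:
  "f \<in> gen_irr_ideal r \<longleftrightarrow> (\<forall>\<rho>\<in>irr_SL2_reps r. eval (trace_coords generic_mat) f \<in> local_ideal r \<rho>)"
  by (simp add: gen_irr_ideal_def local_ideal_def rep_point_def)

lemma (in comm_ring_hom) hom_word_mat:
  assumes "\<And>g i j. hom (M g $ i $ j) = M' g $ i $ j"
  shows "hom (word_mat M w $ i $ j) = word_mat M' w $ i $ j"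
proof (induction w arbitrary: i j)
  case Nil
  show ?case by (simp add: mat1_nth)
next
  case (Cons l w)
  obtain g e where l: "l = (g, e)" by force
  have "hom (adj2 (M g) $ i $ j) = adj2 (M' g) $ i $ j" for i j
  proof -
    have "\<forall>i j. hom (adj2 (M g) $ i $ j) = adj2 (M' g) $ i $ j"
      unfolding forall_2 by (simp add: adj2_nth hom_uminus assms)
    then show ?thesis by blast
  qed
  then show ?case by (cases e) (simp_all add: l mult2 hom_add hom_mult Cons assms)
qed

lemma generic_nth: "eval (rep_point r \<rho>) (generic_mat g $ i $ j) = rep_mats r \<rho> g $ i $ j"
  by (simp add: generic_mat_def eval_Var rep_point_def)

lemma eval_trace_coords_nth:
  "eval (rep_point r \<rho>) (trace_coords generic_mat v) = trace_coords (rep_mats r \<rho>) v"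
  by (cases v) (simp_all add: trace_coords_def trace2 mult2 generic_nth eval_hom.hom_add eval_hom.hom_mult)

lemma eval_trace_coords:
  "eval (rep_point r \<rho>) (eval (trace_coords generic_mat) f) = eval (trace_coords (rep_mats r \<rho>)) f"
  by (simp add: eval_hom.hom_eval eval_trace_coords_nth)

lemma hom_ideal_is_ideal: "is_ideal (hom_ideal r)"
  unfolding hom_ideal_def by (rule ideal_gen_is_ideal)

lemma hom_ideal_gens: "det (generic_mat g) - 1 \<in> hom_ideal r" "word_mat generic_mat r $ i $ j - mat 1 $ i $ j \<in> hom_ideal r"
proof -
  show "det (generic_mat g) - 1 \<in> hom_ideal r"
    unfolding hom_ideal_def
    by (rule subsetD[OF ideal_gen_superset], rule UnI1, rule CollectI, rule exI[of _ g], intro conjI TrueI HOL.refl)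
  show "word_mat generic_mat r $ i $ j - mat 1 $ i $ j \<in> hom_ideal r"
    unfolding hom_ideal_def
    by (rule subsetD[OF ideal_gen_superset], rule UnI2, rule CollectI, rule exI[of _ i], rule exI[of _ j], intro conjI TrueI HOL.refl)
qed

lemma hom_ideal_subset_ker:
  assumes "\<rho> \<in> hom (pres_group r) SL2"
  shows "hom_ideal r \<subseteq> ker_eval (rep_point r (\<rho> :: _ \<Rightarrow> 'a::comm_ring_1 ^ 2 ^ 2))"
proof -
  note M = hom_SL2_mats[OF assms]
  have "eval (rep_point r \<rho>) (det (generic_mat g) - 1) = 0" for g
    using M(2)[of g] by (simp add: det_2 eval_hom.hom_minus eval_hom.hom_mult generic_nth)
  moreover have "eval (rep_point r \<rho>) (word_mat generic_mat r $ i $ j - mat 1 $ i $ j) = 0" for i j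
    using eval_hom.hom_word_mat[of "rep_point r \<rho>" generic_mat "rep_mats r \<rho>" r i j, OF generic_nth] M(3)
    by (simp add: eval_hom.hom_minus mat1_nth)
  ultimately show ?thesis
    unfolding hom_ideal_def ideal_gen_subset_iff[OF ker_eval_ideal] by (auto simp: ker_eval_def)
qed

lemma local_ideal_localizes:
  assumes "\<rho> \<in> irr_SL2_reps r"
  shows "localizes (ker_eval (rep_point r \<rho>)) (local_ideal r \<rho>)"
proof -
  let ?P = "ker_eval (rep_point r \<rho>)"
  note H = hom_ideal_is_ideal[of r]
  have sub: "hom_ideal r \<subseteq> ?P" using hom_ideal_subset_ker assms by (auto simp: irr_SL2_reps_def)
  have P: "is_prime ?P" by (rule ker_eval_prime)
  have mem: "f \<in> local_ideal r \<rho> \<longleftrightarrow> (\<exists>g. g \<notin> ?P \<and> g * f \<in> hom_ideal r)" for f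
    by (simp add: local_ideal_def ker_eval_def)
  have "is_ideal (local_ideal r \<rho>)"
    unfolding is_ideal_def
  proof (intro conjI ballI allI)
    show "0 \<in> local_ideal r \<rho>" using prime_one[OF P] ideal_zero[OF H] by (auto simp: mem)
    fix a assume "a \<in> local_ideal r \<rho>"
    then obtain g where g: "g \<notin> ?P" "g * a \<in> hom_ideal r" by (auto simp: mem)
    show "c * a \<in> local_ideal r \<rho>" for c
      using g ideal_mult_l[OF H g(2), of c] by (auto simp: mem mult_ac)
    fix b assume "b \<in> local_ideal r \<rho>"
    then obtain h where h: "h \<notin> ?P" "h * b \<in> hom_ideal r" by (auto simp: mem)
    have "(g * h) * (a + b) = h * (g * a) + g * (h * b)" by (simp add: algebra_simps)
    then have "(g * h) * (a + b) \<in> hom_ideal r"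
      using ideal_add[OF H ideal_mult_l[OF H g(2)] ideal_mult_l[OF H h(2)]] by simp
    moreover have "g * h \<notin> ?P" using g h by (simp add: prime_mult[OF P])
    ultimately show "a + b \<in> local_ideal r \<rho>" unfolding mem by blast
  qed
  moreover have "local_ideal r \<rho> \<subseteq> ?P"
  proof
    fix f assume "f \<in> local_ideal r \<rho>"
    then obtain g where g: "g \<notin> ?P" "g * f \<in> hom_ideal r" by (auto simp: mem)
    then have "g * f \<in> ?P" using sub by blast
    then show "f \<in> ?P" using g(1) by (simp only: prime_mult[OF P] simp_thms)
  qed
  moreover have "f \<in> local_ideal r \<rho>" if gf: "g \<notin> ?P" "g * f \<in> local_ideal r \<rho>" for g f
  proof -
    obtain h where "h \<notin> ?P" "h * (g * f) \<in> hom_ideal r" using gf(2) by (auto simp: mem)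
    then have "h * g \<notin> ?P" "(h * g) * f \<in> hom_ideal r" using gf(1) by (simp_all add: prime_mult[OF P] mult.assoc)
    then show ?thesis unfolding mem by blast
  qed
  ultimately show ?thesis using P unfolding localizes_def by blast
qed

lemma hom_ideal_subset_local: "f \<in> hom_ideal r \<Longrightarrow> f \<in> local_ideal r \<rho>"
  by (auto simp: local_ideal_def intro!: exI[of _ 1])

lemma irr_comm2:
  assumes "\<rho> \<in> irr_SL2_reps r"
  shows "det (comm2 (rep_mats r \<rho> Ga) (rep_mats r \<rho> Gb)) \<noteq> 0"
proof -
  have "\<rho> \<in> hom (pres_group r) SL2" "irreducible_rep (pres_group r) \<rho>" using assms by (auto simp: irr_SL2_reps_def)
  then show ?thesis using irreducible_comm2[of \<rho> r, OF hom_SL2_mats(1)] by blast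
qed

lemma two_notin_ker: "2 \<notin> ker_eval (p :: 'v \<Rightarrow> 'a::field_char_0)"
  using eval_hom.hom_of_int[of p 2] by (simp add: ker_eval_def)

text \<open>\<open>relation_types\<close> for the generic matrices over the local ring at \<open>\<rho>\<close>.\<close>

lemma irr_local_type:
  assumes \<rho>: "\<rho> \<in> irr_SL2_reps (relator n1 n2 m1 m2)"
    and sum: "m1 + m2 \<in> {1, -1} \<or> n1 + n2 \<in> {1, -1}"
  shows "\<exists>e\<in>{1, -1}. type_eqs n1 n2 m1 m2 e (eval (trace_coords generic_mat) vx) (eval (trace_coords generic_mat) vy)
      (eval (trace_coords generic_mat) vz) \<subseteq> local_ideal (relator n1 n2 m1 m2) \<rho>"
proof -
  let ?r = "relator n1 n2 m1 m2"
  have "eval (rep_point ?r \<rho>) (det (comm2 (generic_mat Ga) (generic_mat Gb))) =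
      det (comm2 (rep_mats ?r \<rho> Ga) (rep_mats ?r \<rho> Gb))"
    by (simp add: comm2_def det_2 mult2 eval_hom.hom_minus eval_hom.hom_mult eval_hom.hom_add generic_nth)
  then have "det (comm2 (generic_mat Ga) (generic_mat Gb)) \<notin> ker_eval (rep_point ?r \<rho>)"
    using irr_comm2[OF \<rho>] by (simp add: ker_eval_def)
  moreover have "mcong (local_ideal ?r \<rho>) (word_mat generic_mat ?r) (mat 1)"
    unfolding mcong_def by (intro allI hom_ideal_subset_local hom_ideal_gens)
  moreover have "det (generic_mat g) - 1 \<in> local_ideal ?r \<rho>" for g
    by (intro hom_ideal_subset_local hom_ideal_gens)
  ultimately have "\<exists>e\<in>{1, -1}. type_eqs n1 n2 m1 m2 e (trace (generic_mat Ga)) (trace (generic_mat Gb))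
      (trace (generic_mat Ga ** generic_mat Gb)) \<subseteq> local_ideal ?r \<rho>"
    by (intro relation_types[OF local_ideal_localizes[OF \<rho>] two_notin_ker sum])
  then show ?thesis by (simp add: eval_Var trace_coords_def)
qed

lemma gen_irr_subset_ker:
  assumes "\<rho> \<in> irr_SL2_reps r"
  shows "gen_irr_ideal r \<subseteq> ker_eval (trace_coords (rep_mats r \<rho>))"
proof
  fix f assume "f \<in> gen_irr_ideal r"
  then have "eval (trace_coords generic_mat) f \<in> ker_eval (rep_point r \<rho>)"
    using assms localizesD(3)[OF local_ideal_localizes[OF assms]] by (simp add: gen_irr_ideal_iff)
  then show "f \<in> ker_eval (trace_coords (rep_mats r \<rho>))" by (simp add: ker_eval_def eval_trace_coords)
qed

text \<open>The separating polynomial is \<open>f = h (c\<^bsub>n1\<^esub> - e c\<^bsub>n2\<^esub>)\<close>. The second factor vanishes on representations of type \<open>-e\<close>,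
  and at points of type \<open>e\<close> it equals \<open>2 c\<^bsub>n1\<^esub> \<noteq> 0\<close>. The factor \<open>h\<close> is built to vanish at the irreducible points of
  type \<open>e\<close> and not at the reducible ones. Then \<open>red_poly * h\<close> vanishes at all points of type \<open>e\<close>, so it is zero in the
  local ring of a representation of type \<open>e\<close>, where \<open>red_poly\<close> is invertible.\<close>

theorem gen_irr_excludes_reducible:
  assumes sum: "m1 + m2 \<in> {1, -1} \<or> n1 + n2 \<in> {1, -1}" and e: "e \<in> {1, -1}"
    and st: "n1 \<noteq> n2" "m1 \<noteq> m2" and roots: "type_roots n1 n2 m1 m2 e \<zeta>0 \<eta>0"
    and sub: "gen_irr_ideal (relator n1 n2 m1 m2) \<subseteq> ker_eval (type_point n1 m1 \<zeta>0 \<eta>0)"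
  shows "eval (type_point n1 m1 \<zeta>0 \<eta>0) (red_poly vx vy vz) \<noteq> 0"
proof
  let ?r = "relator n1 n2 m1 m2" and ?tc = "trace_coords generic_mat :: xyz \<Rightarrow> matvar zpoly"
  define red where "red = red_poly vx vy vz"
  define p where "p = type_point n1 m1 \<zeta>0 \<eta>0"
  assume "eval (type_point n1 m1 \<zeta>0 \<eta>0) (red_poly vx vy vz) = 0"
  then have p0: "eval p red = 0" by (simp add: p_def red_def)
  define V where "V = {(\<zeta>, \<eta>). type_roots n1 n2 m1 m2 e \<zeta> \<eta>}"
  have fin: "finite V" unfolding V_def by (rule finite_type_roots[OF st e])
  define V' where "V' = {q \<in> V. eval (type_point n1 m1 (fst q) (snd q)) red \<noteq> 0}"
  have "\<forall>q\<in>V'. \<exists>g. Polynomial.coeff g 0 \<noteq> 0 \<and> ev1 g (eval (type_point n1 m1 (fst q) (snd q)) red) = 0"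
    by (intro ballI int_poly_nonzero_const algebraic_eval type_point_algebraic(3)[OF _ e st])
      (auto simp: V'_def V_def)
  \<comment> \<open>An integer equation of the value of \<open>red_poly\<close> at an irreducible point. Since its constant term is not
    zero, the equation separates this value from the value 0 at the reducible points.\<close>
  then obtain g where g: "\<And>q. q \<in> V' \<Longrightarrow> Polynomial.coeff (g q) 0 \<noteq> 0"
    "\<And>q. q \<in> V' \<Longrightarrow> ev1 (g q) (eval (type_point n1 m1 (fst q) (snd q)) red) = 0" by metis
  define h where "h = (\<Prod>q\<in>V'. ev1 (g q) red)"
  have ev10: "ev1 q 0 = (of_int (Polynomial.coeff q 0) :: complex)" for q
    by (cases q) (simp add: ev1_pCons)
  have fin': "finite V'" unfolding V'_def using fin by simp
  have "eval p h = (\<Prod>q\<in>V'. of_int (Polynomial.coeff (g q) 0))"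
    by (simp add: h_def eval_hom.hom_prod eval_hom.hom_ev1 p0 ev10)
  then have "eval p h \<noteq> 0" using g(1) fin' by (simp add: prod_zero_iff)
  have van: "eval (type_point n1 m1 \<zeta> \<eta>) (red * h) = 0" if "type_roots n1 n2 m1 m2 e \<zeta> \<eta>" for \<zeta> \<eta>
  proof (cases "(\<zeta>, \<eta>) \<in> V'")
    case True
    then have "eval (type_point n1 m1 \<zeta> \<eta>) h = 0"
      using g(2)[OF True] True fin' unfolding h_def eval_hom.hom_prod
      by (intro prod_zero bexI[of _ "(\<zeta>, \<eta>)"]) (simp_all add: eval_hom.hom_ev1)
    then show ?thesis by (simp add: eval_hom.hom_mult)
  next
    case False
    then show ?thesis using that by (simp add: V'_def V_def eval_hom.hom_mult)
  qed
  \<comment> \<open>\<open>h\<close> alone need not vanish on the representations of type \<open>-e\<close>.\<close>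
  define f where "f = h * (cpol n1 vx - of_int e * cpol n2 vx)"
  have "f \<in> gen_irr_ideal ?r"
    unfolding gen_irr_ideal_iff
  proof
    fix \<rho> assume \<rho>: "\<rho> \<in> irr_SL2_reps ?r"
    define I where "I = local_ideal ?r \<rho>"
    define P where "P = ker_eval (rep_point ?r \<rho>)"
    have loc: "localizes P I" unfolding P_def I_def by (rule local_ideal_localizes[OF \<rho>])
    note prime = localizesD(1)[OF loc] and id = localizesD(2)[OF loc] and IP = localizesD(3)[OF loc]
      and L = localizesD(4)[OF loc]
    note PI = prime_ideal[OF prime]
    obtain e' where e': "e' \<in> {1, -1}" and eqs: "type_eqs n1 n2 m1 m2 e' (eval ?tc vx) (eval ?tc vy) (eval ?tc vz) \<subseteq> I"
      using irr_local_type[OF \<rho> sum] unfolding I_def by blast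
    show "eval ?tc f \<in> local_ideal ?r \<rho>"
      unfolding I_def[symmetric]
    proof (cases "e' = e")
      case False
      then have "e' = - e" using e e' by auto
      then have "eval ?tc (cpol n1 vx - of_int e * cpol n2 vx) \<in> I"
        using eqs by (simp add: type_eqs_def eval_hom.hom_minus eval_hom.hom_mult eval_hom.hom_cpol eval_hom.hom_of_int)
      then show "eval ?tc f \<in> I" by (simp add: f_def eval_hom.hom_mult ideal_mult_l[OF id])
    next
      case True
      note eqs = eqs[unfolded True]
      note tor = type_eqs_torsion[OF id e eqs]
      have "type_eqs n1 n2 m1 m2 e (eval ?tc vx) (eval ?tc vy) (eval ?tc vz) \<subseteq> P" using eqs IP by blast
      note nz = type_eqs_nonzero[OF prime this e sum]
      have two: "of_int (2 * e) \<notin> P"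
      proof -
        have "eval (rep_point ?r \<rho>) (of_int (2 * e)) = of_int (2 * e)" by (rule eval_hom.hom_of_int)
        then show ?thesis using e by (auto simp: P_def ker_eval_def)
      qed
      have d1: "dpol (n1 - n2) (eval ?tc vx) - of_int e \<notin> P"
        using ideal_diff[OF PI IP[OF tor(2)], of "dpol (n1 - n2) (eval ?tc vx) - of_int e"] two by auto
      have d2: "dpol (m1 - m2) (eval ?tc vy) + of_int e \<notin> P"
        using ideal_diff[OF PI _ IP[OF tor(4)], of "dpol (m1 - m2) (eval ?tc vy) + of_int e"] two by auto
      have "eval (rep_point ?r \<rho>) (eval ?tc red) = - det (comm2 (rep_mats ?r \<rho> Ga) (rep_mats ?r \<rho> Gb))"
      proof -
        have "\<rho> \<in> hom (pres_group ?r) SL2" using \<rho> by (auto simp: irr_SL2_reps_def)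
        note dets = hom_SL2_mats(2)[OF this]
        show ?thesis
          unfolding eval_trace_coords
          by (simp add: red_def eval_hom.hom_red_poly eval_Var det_comm2 dets trace_coords_def)
      qed
      then have r0: "eval ?tc red \<notin> P" using irr_comm2[OF \<rho>] by (simp add: P_def ker_eval_def)
      have J: "is_ideal {f. eval ?tc f \<in> I}" by (rule is_ideal_vimage[OF eval_hom.comm_ring_hom_axioms id])
      have "\<exists>N. (cpol n1 vx * cpol m1 vy) ^ N * ((dpol (n1 - n2) vx - of_int e) * (dpol (m1 - m2) vy + of_int e)) * (red * h) \<in> {f. eval ?tc f \<in> I}"
        by (rule vanishing_at_type_points[OF J _ _ _ st e van])
          (use eqs tor in \<open>auto simp: type_eqs_def eval_hom.hom_rel_poly eval_hom.hom_cpol\<close>)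
      then obtain N where N: "((cpol n1 (eval ?tc vx) * cpol m1 (eval ?tc vy)) ^ N *
          ((dpol (n1 - n2) (eval ?tc vx) - of_int e) * (dpol (m1 - m2) (eval ?tc vy) + of_int e)) * eval ?tc red) * eval ?tc h \<in> I"
        by (auto simp: eval_hom.hom_mult eval_hom.hom_power eval_hom.hom_cpol eval_hom.hom_dpol eval_hom.hom_minus
            eval_hom.hom_add eval_hom.hom_of_int mult.assoc)
      have "eval ?tc h \<in> I"
        by (rule L[OF _ N]) (use d1 d2 r0 nz prime_power[OF prime, of "cpol n1 (eval ?tc vx) * cpol m1 (eval ?tc vy)" N] in \<open>auto simp: prime_mult[OF prime]\<close>)
      then show "eval ?tc f \<in> I" by (simp add: f_def eval_hom.hom_mult ideal_mult_r[OF id])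
    qed
  qed
  then have "eval p f = 0" using sub by (auto simp: p_def ker_eval_def)
  moreover have "eval p (cpol n1 vx - of_int e * cpol n2 vx) = 2 * cpol n1 (\<zeta>0 + inverse \<zeta>0)"
  proof -
    have "eval p (cpol n1 vx + of_int e * cpol n2 vx) = 0"
      using type_point_eqs[OF roots e] by (auto simp: p_def type_eqs_def ker_eval_def)
    then have "of_int e * cpol n2 (\<zeta>0 + inverse \<zeta>0) = - cpol n1 (\<zeta>0 + inverse \<zeta>0)"
      by (simp add: eval_hom.hom_add eval_hom.hom_mult eval_hom.hom_cpol eval_hom.hom_of_int eval_Var p_def
          type_point_def trace_point_simps add_eq_0_iff)
    then show ?thesis
      by (simp add: eval_hom.hom_minus eval_hom.hom_mult eval_hom.hom_cpol eval_hom.hom_of_int eval_Var p_def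
          type_point_def trace_point_simps)
  qed
  ultimately show False using \<open>eval p h \<noteq> 0\<close> roots
    by (simp add: f_def eval_hom.hom_mult type_roots_def)
qed

section \<open>Immersions given by irreducible points\<close>

lemma a_inv_type_algebra: "\<ominus>\<^bsub>ring_of_type_algebra\<^esub> a = - (a :: 'a::comm_ring_1)"
proof -
  interpret ring "ring_of_type_algebra :: 'a ring" by (rule ring_from_type_algebra)
  show ?thesis by (rule minus_equality) (auto simp: ring_of_type_algebra_def)
qed

lemma type_algebra_simps:
  "one (ring_of_type_algebra :: 'a::comm_ring_1 ring) = 1"
  "mult (ring_of_type_algebra :: 'a ring) = (*)"
  "add (ring_of_type_algebra :: 'a ring) = (+)"
  by (auto simp: ring_of_type_algebra_def)

lemma int_adjoin_props:
  shows int_adjoin_base: "a \<in> S \<Longrightarrow> a \<in> int_adjoin S" and int_adjoin_1: "1 \<in> int_adjoin S"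
    and int_adjoin_add: "a \<in> int_adjoin S \<Longrightarrow> b \<in> int_adjoin S \<Longrightarrow> a + b \<in> int_adjoin S"
    and int_adjoin_mult: "a \<in> int_adjoin S \<Longrightarrow> b \<in> int_adjoin S \<Longrightarrow> a * b \<in> int_adjoin S"
    and int_adjoin_uminus: "a \<in> int_adjoin S \<Longrightarrow> - a \<in> int_adjoin S"
  unfolding int_adjoin_def
  using generate_ring.incl[of a S "ring_of_type_algebra :: complex ring"]
    generate_ring.one[of "ring_of_type_algebra :: complex ring" S]
    generate_ring.eng_add[of a "ring_of_type_algebra :: complex ring" S b]
    generate_ring.eng_mult[of a "ring_of_type_algebra :: complex ring" S b]
    generate_ring.a_inv[of a "ring_of_type_algebra :: complex ring" S]
  unfolding a_inv_type_algebra type_algebra_simps by blast+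

lemma int_adjoin_power: "a \<in> int_adjoin S \<Longrightarrow> a ^ k \<in> int_adjoin S"
  by (induction k) (auto intro: int_adjoin_1 int_adjoin_mult)

lemma int_adjoin_minimal:
  assumes "S \<subseteq> T" "1 \<in> T" "\<And>a. a \<in> T \<Longrightarrow> - a \<in> T" "\<And>a b. a \<in> T \<Longrightarrow> b \<in> T \<Longrightarrow> a + b \<in> T"
    "\<And>a b. a \<in> T \<Longrightarrow> b \<in> T \<Longrightarrow> a * b \<in> T"
  shows "int_adjoin S \<subseteq> T"
proof
  fix a assume "a \<in> int_adjoin S"
  then show "a \<in> T" unfolding int_adjoin_def
    by (induction rule: generate_ring.induct)
      (use assms in \<open>auto simp: a_inv_type_algebra type_algebra_simps\<close>)
qed

lemma int_adjoin_of_int: "of_int k \<in> int_adjoin S"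
proof (induction k rule: int_induct[where k = 0])
  case base
  show ?case using int_adjoin_add[OF int_adjoin_1 int_adjoin_uminus[OF int_adjoin_1], of S] by simp
next
  case (step1 i)
  then show ?case using int_adjoin_add[OF _ int_adjoin_1] by simp
next
  case (step2 i)
  then show ?case using int_adjoin_add[OF _ int_adjoin_uminus[OF int_adjoin_1], of "of_int i"] by simp
qed

lemma eval_int_adjoin: "range p \<subseteq> int_adjoin S \<Longrightarrow> eval p f \<in> int_adjoin S"
  by (induction f rule: zpoly_induct)
    (auto simp: eval_hom.hom_of_int eval_Var eval_add eval_mult int_adjoin_of_int int_adjoin_add int_adjoin_mult)

lemma range_eval: "range (eval p) = int_adjoin (range p)"
proof
  show "range (eval p) \<subseteq> int_adjoin (range p)"
    using eval_int_adjoin[of p "range p"] int_adjoin_base by blast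
  have "range p \<subseteq> range (eval p)"
  proof
    fix c assume "c \<in> range p"
    then obtain v where "c = eval p (Var v)" by (auto simp: eval_Var)
    then show "c \<in> range (eval p)" by simp
  qed
  then show "int_adjoin (range p) \<subseteq> range (eval p)"
  proof (rule int_adjoin_minimal)
    show "1 \<in> range (eval p)" using eval_1[of p] by (metis rangeI)
    show "- a \<in> range (eval p)" if "a \<in> range (eval p)" for a
      using that by (auto simp flip: eval_hom.hom_uminus)
    show "a + b \<in> range (eval p)" "a * b \<in> range (eval p)" if "a \<in> range (eval p)" "b \<in> range (eval p)" for a b
      using that by (auto simp flip: eval_add eval_mult)
  qed
qed

lemma range_trace_point: "range (trace_point \<zeta> \<eta> z) = {\<zeta> + inverse \<zeta>, \<eta> + inverse \<eta>, z}"
proof -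
  have eq: "(UNIV :: xyz set) = {Vx, Vy, Vz}" by (auto intro: xyz.exhaust)
  show ?thesis by (subst eq) (simp add: trace_point_simps)
qed

text \<open>Since \<open>\<zeta>\<^sup>2 = x \<zeta> - 1\<close> and \<open>\<eta>\<^sup>2 = y \<eta> - 1\<close>, the module spanned by the four products is a ring. The inverses of the
  eigenvalues are available because they are powers of roots of unity.\<close>

lemma adjoin_eigenvalues:
  fixes \<zeta> \<eta> z :: complex
  assumes "\<zeta> ^ k = 1" "k > 0" "\<eta> ^ l = 1" "l > 0"
  defines "p \<equiv> trace_point \<zeta> \<eta> z"
  shows "range p \<subseteq> int_adjoin {\<zeta>, \<eta>, z}" "int_adjoin {\<zeta>, \<eta>, z} = hom_span (eval p) {1, \<zeta>, \<eta>, \<zeta> * \<eta>}"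
proof -
  have inv: "inverse u \<in> int_adjoin S" if "u ^ j = 1" "j > 0" "u \<in> S" for u j S
  proof -
    have "u * u ^ (j - 1) = 1" using that(1,2) by (cases j) auto
    then have "inverse u = u ^ (j - 1)" by (metis inverse_unique)
    then show ?thesis using int_adjoin_power[OF int_adjoin_base[OF that(3)]] by simp
  qed
  show sub: "range p \<subseteq> int_adjoin {\<zeta>, \<eta>, z}"
    unfolding p_def range_trace_point using inv[of \<zeta> k] inv[of \<eta> l] assms(1-4)
    by (auto intro: int_adjoin_add int_adjoin_base)
  let ?W = "{1, \<zeta>, \<eta>, \<zeta> * \<eta>}"
  have fin: "finite ?W" by simp
  have xy: "eval p vx = \<zeta> + inverse \<zeta>" "eval p vy = \<eta> + inverse \<eta>" "eval p vz = z"
    by (simp_all add: eval_Var p_def trace_point_simps)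
  have nz: "\<zeta> \<noteq> 0" "\<eta> \<noteq> 0" using assms(1-4) by (auto simp: power_0_left)
  note add = eval_hom.hom_span_add[of _ p ?W] and base = eval_hom.hom_span_base[OF fin, of _ p]
    and scale = eval_hom.hom_span_scale[of _ p ?W]
  have sq: "\<zeta> * \<zeta> = eval p vx * \<zeta> + eval p (- 1) * 1" "\<eta> * \<eta> = eval p vy * \<eta> + eval p (- 1) * 1"
    using nz by (simp_all add: xy eval_hom.hom_uminus eval_1 distrib_right)
  have Z: "\<zeta> * w \<in> hom_span (eval p) ?W" if "w \<in> ?W" for w
  proof -
    have "\<zeta> * (\<zeta> * \<eta>) = eval p vx * (\<zeta> * \<eta>) + eval p (- 1) * \<eta>"
      using sq(1) by (simp add: mult.assoc[symmetric] distrib_right)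
    moreover have "eval p vx * (\<zeta> * \<eta>) + eval p (- 1) * \<eta> \<in> hom_span (eval p) ?W"
      "eval p vx * \<zeta> + eval p (- 1) * 1 \<in> hom_span (eval p) ?W" "\<zeta> \<in> hom_span (eval p) ?W" "\<zeta> * \<eta> \<in> hom_span (eval p) ?W"
      by (intro add scale base; simp)+
    ultimately show ?thesis using that sq(1) by auto
  qed
  have E: "\<eta> * w \<in> hom_span (eval p) ?W" if "w \<in> ?W" for w
  proof -
    have "\<eta> * (\<zeta> * \<eta>) = \<zeta> * (\<eta> * \<eta>)" by (simp only: mult_ac)
    also have "\<dots> = eval p vy * (\<zeta> * \<eta>) + eval p (- 1) * \<zeta>"
      unfolding sq(2) by (simp only: distrib_left mult_ac mult_1_left mult_1_right)
    finally have a: "\<eta> * (\<zeta> * \<eta>) \<in> hom_span (eval p) ?W"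
      by (simp only:) (intro add scale base; simp)
    have b: "\<eta> * \<eta> \<in> hom_span (eval p) ?W" unfolding sq(2) by (intro add scale base; simp)
    have "\<zeta> * \<eta> \<in> hom_span (eval p) ?W" by (intro base) simp
    then have c: "\<eta> * \<zeta> \<in> hom_span (eval p) ?W" by (simp only: mult.commute)
    have "\<eta> \<in> hom_span (eval p) ?W" by (intro base) simp
    then show ?thesis using that a b c by (elim insertE emptyE) (simp_all only: mult_1_right)
  qed
  note Zs = eval_hom.hom_span_mult[OF Z] and Es = eval_hom.hom_span_mult[OF E]
  have WS: "w * u \<in> hom_span (eval p) ?W" if "w \<in> ?W" "u \<in> hom_span (eval p) ?W" for w u
    using that Zs Es by (auto simp: mult.assoc)
  have one: "1 \<in> hom_span (eval p) ?W" by (rule base) simp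
  show "int_adjoin {\<zeta>, \<eta>, z} = hom_span (eval p) ?W"
  proof
    show "int_adjoin {\<zeta>, \<eta>, z} \<subseteq> hom_span (eval p) ?W"
    proof (rule int_adjoin_minimal)
      have "eval p vz * 1 \<in> hom_span (eval p) ?W" by (rule scale[OF one])
      then show "{\<zeta>, \<eta>, z} \<subseteq> hom_span (eval p) ?W" using base by (auto simp: xy)
      show "1 \<in> hom_span (eval p) ?W" by (rule one)
      show "- a \<in> hom_span (eval p) ?W" if "a \<in> hom_span (eval p) ?W" for a
        using scale[OF that, of "- 1"] by (simp add: eval_hom.hom_uminus eval_1)
      show "a + b \<in> hom_span (eval p) ?W" if "a \<in> hom_span (eval p) ?W" "b \<in> hom_span (eval p) ?W" for a b
        using add that .
      show "a * b \<in> hom_span (eval p) ?W" if "a \<in> hom_span (eval p) ?W" "b \<in> hom_span (eval p) ?W" for a b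
        by (rule eval_hom.hom_span_mult[OF _ that(2)]) (use WS[OF _ that(1)] in \<open>simp add: mult.commute\<close>)
    qed
    have W: "?W \<subseteq> int_adjoin {\<zeta>, \<eta>, z}"
      using int_adjoin_base[of _ "{\<zeta>, \<eta>, z}"] int_adjoin_1 int_adjoin_mult by auto
    have "(\<Sum>w\<in>A. eval p (c w) * w) \<in> int_adjoin {\<zeta>, \<eta>, z}" if "A \<subseteq> ?W" for A c
      using finite_subset[OF that fin] that
      by (induction A rule: finite_induct)
        (use int_adjoin_of_int[of 0] W eval_int_adjoin[OF sub] in \<open>auto intro!: int_adjoin_add int_adjoin_mult\<close>)
    from this[OF order_refl] show "hom_span (eval p) ?W \<subseteq> int_adjoin {\<zeta>, \<eta>, z}" by (auto simp: hom_span_def)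
  qed
qed

definition type_ideal :: "int \<Rightarrow> int \<Rightarrow> int \<Rightarrow> int \<Rightarrow> int \<Rightarrow> xyz zpoly set" where
  "type_ideal n1 n2 m1 m2 e = ideal_gen (type_eqs n1 n2 m1 m2 e vx vy vz \<union> gen_irr_ideal (relator n1 n2 m1 m2))"

lemma M_circ_9: "M_circ n1 n2 m1 m2 9 = type_ideal n1 n2 m1 m2 1"
  and M_circ_10: "M_circ n1 n2 m1 m2 10 = type_ideal n1 n2 m1 m2 (-1)"
  by (simp_all add: M_circ_def type_ideal_def wp_gens_9 wp_gens_10)

lemma type_ideal_subset_iff:
  "is_ideal I \<Longrightarrow> type_ideal n1 n2 m1 m2 e \<subseteq> I \<longleftrightarrow>
     type_eqs n1 n2 m1 m2 e vx vy vz \<subseteq> I \<and> gen_irr_ideal (relator n1 n2 m1 m2) \<subseteq> I"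
  unfolding type_ideal_def by (simp add: ideal_gen_subset_iff)

lemma type_eqs_ker_eval:
  "type_eqs n1 n2 m1 m2 e vx vy vz \<subseteq> ker_eval p \<longleftrightarrow> type_eqs n1 n2 m1 m2 e (p Vx) (p Vy) (p Vz) \<subseteq> {0}"
proof -
  have "type_eqs n1 n2 m1 m2 e (p Vx) (p Vy) (p Vz) = eval p ` type_eqs n1 n2 m1 m2 e vx vy vz"
    by (simp add: eval_hom.hom_type_eqs eval_Var)
  then show ?thesis by (auto simp: ker_eval_def)
qed

text \<open>The relation holds by \<open>relation_holds\<close>, and irreducibility is \<open>irreducible_comm2\<close> with the commutator expressed by
  \<open>red_poly\<close>. This is used over the complex numbers and over the \<open>l\<close>-adic closure.\<close>

lemma tri_mats_rep:
  fixes a b z :: "'k::alg_closed_field" and n1 n2 m1 m2 :: int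
  assumes ab: "a \<noteq> 0" "b \<noteq> 0" and e: "e \<in> {1, -1}"
    and eqs: "type_eqs n1 n2 m1 m2 e (a + inverse a) (b + inverse b) z \<subseteq> {0}"
    and red: "red_poly (a + inverse a) (b + inverse b) z \<noteq> 0"
  defines "r \<equiv> relator n1 n2 m1 m2" and "M \<equiv> tri_mats a b z"
  shows "rep_of r M \<in> hom (pres_group r) SL2" "irreducible_rep (pres_group r) (rep_of r M)"
    "rep_of r M (word_class r w) = word_mat M w" "rep_mats r (rep_of r M) = M"
proof -
  note props = tri_mats_props[OF ab, of z, folded M_def]
  have rel: "word_mat M r = mat 1"
    unfolding r_def by (rule relation_holds[OF props(1) e]) (use eqs in \<open>simp add: props\<close>)
  show "rep_of r M \<in> hom (pres_group r) SL2" by (rule rep_of_hom_SL2[OF props(1) rel])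
  show w: "rep_of r M (word_class r w) = word_mat M w" for w by (rule rep_of_class[OF props(1) rel])
  show "rep_mats r (rep_of r M) = M" by (rule rep_mats_rep_of[OF props(1) rel])
  show "irreducible_rep (pres_group r) (rep_of r M)"
    using irreducible_comm2[of "rep_of r M" r M, OF w] red by (simp add: det_comm2 props)
qed

text \<open>The triangular matrices give an irreducible representation with the prescribed traces. So the point
  lies in \<open>M\<^sup>i\<^sup>r\<^sup>r\<close> and the closed subscheme contains it.\<close>

theorem irreducible_point_immersion:
  assumes roots: "type_roots n1 n2 m1 m2 e \<zeta> \<eta>" and e: "e \<in> {1, -1}" and st: "n1 \<noteq> n2" "m1 \<noteq> m2"
    and red: "eval (type_point n1 m1 \<zeta> \<eta>) (red_poly vx vy vz) \<noteq> 0"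
  shows "root_immersion (relator n1 n2 m1 m2) (type_ideal n1 n2 m1 m2 e) \<zeta> \<eta> (z_value n1 m1 \<zeta> \<eta>)"
proof -
  let ?r = "relator n1 n2 m1 m2"
  define z where "z = z_value n1 m1 \<zeta> \<eta>"
  define p where "p = trace_point \<zeta> \<eta> z"
  have p: "type_point n1 m1 \<zeta> \<eta> = p" by (simp add: p_def type_point_def z_def)
  have nz: "\<zeta> \<noteq> 0" "\<eta> \<noteq> 0" using roots by (auto simp: type_roots_def)
  have eqs: "type_eqs n1 n2 m1 m2 e vx vy vz \<subseteq> ker_eval p" using type_point_eqs[OF roots e] by (simp add: p)
  define \<rho> where "\<rho> = rep_of ?r (tri_mats \<zeta> \<eta> z)"
  have E: "type_eqs n1 n2 m1 m2 e (\<zeta> + inverse \<zeta>) (\<eta> + inverse \<eta>) z \<subseteq> {0}"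
    using eqs unfolding type_eqs_ker_eval by (simp add: p_def trace_point_simps)
  have R: "red_poly (\<zeta> + inverse \<zeta>) (\<eta> + inverse \<eta>) z \<noteq> 0"
    using red unfolding p by (simp add: eval_hom.hom_red_poly eval_Var p_def trace_point_simps)
  note rep = tri_mats_rep[OF nz e E R, folded \<rho>_def]
  have \<rho>: "\<rho> \<in> irr_SL2_reps ?r" using rep(1,2) by (simp add: irr_SL2_reps_def)
  have tc: "trace_coords (rep_mats ?r \<rho>) = p"
  proof
    fix v show "trace_coords (rep_mats ?r \<rho>) v = p v"
      using tri_mats_props[OF nz, of z] by (cases v) (simp_all add: rep(4) trace_coords_def p_def trace_point_simps)
  qed
  have I: "type_ideal n1 n2 m1 m2 e \<subseteq> ker_eval p"
    using eqs gen_irr_subset_ker[OF \<rho>] by (simp add: type_ideal_subset_iff[OF ker_eval_ideal] tc)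
  have unity: "\<zeta> ^ (2 * nat \<bar>n1 - n2\<bar>) = 1" "2 * nat \<bar>n1 - n2\<bar> > 0" "\<eta> ^ (2 * nat \<bar>m1 - m2\<bar>) = 1" "2 * nat \<bar>m1 - m2\<bar> > 0"
    using type_roots_torsion[OF roots e] st by auto
  note adj = adjoin_eigenvalues[OF unity, of z, folded p_def]
  have "Spec_finite_morphism (int_adjoin {\<zeta>, \<eta>, z}) (type_ideal n1 n2 m1 m2 e) p"
    unfolding Spec_finite_morphism_def Spec_morphism_def
  proof (intro conjI exI[of _ "{1, \<zeta>, \<eta>, \<zeta> * \<eta>}"])
    show "{1, \<zeta>, \<eta>, \<zeta> * \<eta>} \<subseteq> int_adjoin {\<zeta>, \<eta>, z}"
      using int_adjoin_base[of _ "{\<zeta>, \<eta>, z}"] int_adjoin_1 int_adjoin_mult by auto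
    show "int_adjoin {\<zeta>, \<eta>, z} = {\<Sum>s\<in>{1, \<zeta>, \<eta>, \<zeta> * \<eta>}. eval p (a s) * s |a. True}"
      using adj(2) unfolding hom_span_def .
  qed (use adj(1) I in simp_all)
  moreover have "Spec_closed_immersion (int_adjoin {\<zeta> + inverse \<zeta>, \<eta> + inverse \<eta>, z}) (type_ideal n1 n2 m1 m2 e) p"
    unfolding Spec_closed_immersion_def Spec_morphism_def range_eval
    using I int_adjoin_base by (auto simp: p_def range_trace_point)
  moreover have "fibre_Q (ker_eval p) \<subseteq> M_irr_Q ?r"
  proof -
    have "fibre_Q (ker_eval p) = {ker_eval p}"
      using fibre_Q_algebraic_point[of p] type_point_algebraic(3)[OF roots e st] unfolding p by simp
    moreover have "ker_eval p \<in> M_irr_Q ?r" unfolding M_irr_Q_def using \<rho> tc by auto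
    ultimately show ?thesis by simp
  qed
  ultimately show ?thesis unfolding root_immersion_def z_def[symmetric] p_def[symmetric] by blast
qed

lemma immersion_irreducible:
  assumes sum: "m1 + m2 \<in> {1, -1} \<or> n1 + n2 \<in> {1, -1}" and e: "e \<in> {1, -1}"
    and st: "n1 \<noteq> n2" "m1 \<noteq> m2" and roots: "type_roots n1 n2 m1 m2 e \<zeta> \<eta>"
    and imm: "root_immersion (relator n1 n2 m1 m2) (type_ideal n1 n2 m1 m2 e) \<zeta> \<eta> (z_value n1 m1 \<zeta> \<eta>)"
  shows "eval (type_point n1 m1 \<zeta> \<eta>) (red_poly vx vy vz) \<noteq> 0"
proof (rule gen_irr_excludes_reducible[OF sum e st roots])
  have "type_ideal n1 n2 m1 m2 e \<subseteq> ker_eval (type_point n1 m1 \<zeta> \<eta>)"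
    using imm by (simp add: root_immersion_def Spec_closed_immersion_def Spec_morphism_def type_point_def)
  then show "gen_irr_ideal (relator n1 n2 m1 m2) \<subseteq> ker_eval (type_point n1 m1 \<zeta> \<eta>)"
    unfolding type_ideal_subset_iff[OF ker_eval_ideal] by blast
qed

lemma red_poly_factor:
  fixes z a h b w :: "'a::comm_ring_1"
  assumes "z * a = 1" "h * b = 1"
  shows "red_poly (z + a) (h + b) w = (w - (z * h + a * b)) * (w - (z * b + a * h))"
proof -
  have "(w - (z * h + a * b)) * (w - (z * b + a * h)) =
     w * w - (z + a) * (h + b) * w + (z * z * (h * b) + (z * a) * (h * h) + (z * a) * (b * b) + a * a * (h * b))"
    by (simp add: algebra_simps)
  also have "\<dots> = (z * z + a * a + 2 * (z * a)) + (h * h + b * b + 2 * (h * b)) + w * w - (z + a) * (h + b) * w - 4"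
    by (simp add: assms)
  also have "\<dots> = red_poly (z + a) (h + b) w" by (simp add: red_poly_def algebra_simps)
  finally show ?thesis by simp
qed

text \<open>By \<open>red_poly_factor\<close>, at a reducible point \<open>z\<close> is a sum of products of roots of unity.\<close>

lemma nonintegral_irreducible:
  assumes roots: "type_roots n1 n2 m1 m2 e \<zeta> \<eta>" and e: "e \<in> {1, -1}" and st: "n1 \<noteq> n2" "m1 \<noteq> m2"
    and z: "\<not> algebraic_int (z_value n1 m1 \<zeta> \<eta>)"
  shows "eval (type_point n1 m1 \<zeta> \<eta>) (red_poly vx vy vz) \<noteq> 0"
proof
  define w where "w = z_value n1 m1 \<zeta> \<eta>"
  assume "eval (type_point n1 m1 \<zeta> \<eta>) (red_poly vx vy vz) = 0"
  then have "red_poly (\<zeta> + inverse \<zeta>) (\<eta> + inverse \<eta>) w = 0"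
    by (simp add: eval_hom.hom_red_poly eval_Var type_point_def trace_point_simps w_def)
  moreover have "\<zeta> * inverse \<zeta> = 1" "\<eta> * inverse \<eta> = 1" using roots by (auto simp: type_roots_def)
  then have "red_poly (\<zeta> + inverse \<zeta>) (\<eta> + inverse \<eta>) w =
      (w - (\<zeta> * \<eta> + inverse \<zeta> * inverse \<eta>)) * (w - (\<zeta> * inverse \<eta> + inverse \<zeta> * \<eta>))"
    by (rule red_poly_factor)
  ultimately have w: "w = \<zeta> * \<eta> + inverse \<zeta> * inverse \<eta> \<or> w = \<zeta> * inverse \<eta> + inverse \<zeta> * \<eta>" by simp
  have int: "integral_over (of_int :: int \<Rightarrow> complex) u \<and> integral_over (of_int :: int \<Rightarrow> complex) (inverse u)"
    if "u ^ k = 1" "k > 0" for u k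
    using integral_root_of_unity[OF of_int_comm_ring_hom, of u k]
      integral_root_of_unity[OF of_int_comm_ring_hom, of "inverse u" k] that by (auto simp: power_inverse)
  have "2 * nat \<bar>n1 - n2\<bar> > 0" "2 * nat \<bar>m1 - m2\<bar> > 0" using st by auto
  note i = int[OF type_roots_torsion(1)[OF roots e] this(1)] int[OF type_roots_torsion(2)[OF roots e] this(2)]
  have "algebraic_int w"
    unfolding algebraic_int_iff using w i
    by (auto intro!: integral_over_add[OF of_int_comm_ring_hom] integral_over_mult[OF of_int_comm_ring_hom])
  then show False using z by (simp add: w_def)
qed

section \<open>Integral conjugates of a point\<close>

definition evr :: "rat poly \<Rightarrow> 'a::field_char_0 \<Rightarrow> 'a" where
  "evr F w = poly (map_poly of_rat F) w"

lemma evr_hom: "comm_ring_hom (\<lambda>F. evr F w)"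
  unfolding evr_def by (rule poly_map_poly_hom[OF of_rat_comm_ring_hom])

interpretation evr: comm_ring_hom "\<lambda>F. evr F w" by (rule evr_hom)

lemma evr_const: "evr [:c:] w = of_rat c"
  unfolding evr_def by (subst poly_map_as_sum) simp_all

lemma evr_X: "evr [:0, 1:] w = w" and evr_X': "evr (pCons 0 1) w = w"
  unfolding evr_def by (subst poly_map_as_sum; simp)+

lemma minimal_polynomial_exists:
  fixes w :: complex
  assumes "algebraic w"
  obtains \<mu> :: "rat poly" where "\<mu> \<noteq> 0" "evr \<mu> w = 0" "\<And>F. evr F w = 0 \<Longrightarrow> \<mu> dvd F"
proof -
  have ex: "\<exists>F. F \<noteq> 0 \<and> evr F w = 0"
  proof -
    obtain f :: "rat poly" where "Polynomial.lead_coeff f = 1" "poly (map_poly of_rat f) w = 0"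
      using assms by (auto simp: algebraic_iff integral_over_def)
    then show ?thesis by (intro exI[of _ f]) (auto simp: evr_def)
  qed
  define Q where "Q F \<longleftrightarrow> F \<noteq> 0 \<and> evr F w = 0" for F
  obtain \<mu> where \<mu>: "Q \<mu>" "\<And>F. Q F \<Longrightarrow> Polynomial.degree \<mu> \<le> Polynomial.degree F"
    using ex_has_least_nat[of Q _ Polynomial.degree] ex unfolding Q_def by blast
  show ?thesis
  proof (rule that[of \<mu>])
    show m0: "\<mu> \<noteq> 0" "evr \<mu> w = 0" using \<mu>(1) by (auto simp: Q_def)
    fix F assume F: "evr F w = 0"
    have "F = F div \<mu> * \<mu> + F mod \<mu>" by simp
    then have "evr F w = evr (F div \<mu>) w * evr \<mu> w + evr (F mod \<mu>) w"
      by (metis evr.hom_add evr.hom_mult)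
    then have r: "evr (F mod \<mu>) w = 0" using F m0 by simp
    have "F mod \<mu> = 0"
    proof (rule ccontr)
      assume n: "F mod \<mu> \<noteq> 0"
      then have "Polynomial.degree \<mu> \<le> Polynomial.degree (F mod \<mu>)" using \<mu>(2)[of "F mod \<mu>"] r by (simp add: Q_def)
      moreover have "Polynomial.degree (F mod \<mu>) < Polynomial.degree \<mu>" using degree_mod_less[OF m0(1), of F] n by simp
      ultimately show False by simp
    qed
    then show "\<mu> dvd F" by (rule mod_0_imp_dvd)
  qed
qed

text \<open>The resultant of \<open>\<mu>(W)\<close> and \<open>H(W) - Z\<close> with respect to \<open>W\<close> is a polynomial in \<open>Z\<close> whose zeros, in every
  algebraically closed field, are the values of \<open>H\<close> at the zeros of \<open>\<mu>\<close>.\<close>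

definition value_poly :: "rat poly \<Rightarrow> rat poly \<Rightarrow> rat poly" where
  "value_poly \<mu> H = resultant (map_poly (\<lambda>c. [:c:]) \<mu>) (map_poly (\<lambda>c. [:c:]) H - [:[:0, 1:]:])"

lemma resultant_zero_iff_common_root:
  fixes f g :: "'k::{alg_closed_field, factorial_ring_gcd, semiring_gcd_mult_normalize} poly"
  assumes "f \<noteq> 0"
  shows "resultant f g = 0 \<longleftrightarrow> (\<exists>w. poly f w = 0 \<and> poly g w = 0)"
proof -
  have g0: "gcd f g \<noteq> 0" using assms by simp
  have "Polynomial.degree (gcd f g) \<noteq> 0 \<longleftrightarrow> (\<exists>w. poly (gcd f g) w = 0)"
  proof
    assume "\<exists>w. poly (gcd f g) w = 0"
    then obtain w where w: "poly (gcd f g) w = 0" by blast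
    show "Polynomial.degree (gcd f g) \<noteq> 0"
    proof
      assume "Polynomial.degree (gcd f g) = 0"
      then obtain c where "gcd f g = [:c:]" by (rule degree_eq_zeroE)
      then show False using w g0 by simp
    qed
  qed (use alg_closed_imp_poly_has_root in auto)
  moreover have "poly (gcd f g) w = 0 \<longleftrightarrow> poly f w = 0 \<and> poly g w = 0" for w
    by (simp only: poly_eq_0_iff_dvd gcd_greatest_iff)
  ultimately show ?thesis by (simp add: resultant_0_gcd)
qed

lemma value_poly_root_iff:
  fixes z :: "'k::{alg_closed_field, field_char_0, factorial_ring_gcd, semiring_gcd_mult_normalize}"
  assumes "\<mu> \<noteq> 0"
  shows "evr (value_poly \<mu> H) z = 0 \<longleftrightarrow> (\<exists>w. evr \<mu> w = 0 \<and> evr H w = z)"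
proof -
  let ?F = "map_poly (\<lambda>c. [:c:]) \<mu>" and ?G = "map_poly (\<lambda>c. [:c:]) H - [:[:0, 1:]:] :: rat poly poly"
  have F: "map_poly (\<lambda>F. evr F z) ?F = map_poly of_rat \<mu>"
    by (rule poly_eqI) (simp add: coeff_map_poly evr_const evr.hom_zero)
  have G: "map_poly (\<lambda>F. evr F z) ?G = map_poly of_rat H - [:z:]"
    by (rule poly_eqI) (simp add: coeff_map_poly evr_const evr.hom_zero evr.hom_minus evr_X evr_X' coeff_pCons split: nat.split)
  have d1: "Polynomial.degree (map_poly of_rat f :: 'k poly) = Polynomial.degree f" for f
    by (simp add: degree_map_poly)
  have dF: "Polynomial.degree ?F = Polynomial.degree \<mu>" by (simp add: degree_map_poly)
  have dG: "Polynomial.degree ?G = Polynomial.degree H"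
  proof (cases "Polynomial.degree H = 0")
    case True
    then obtain c where c: "H = [:c:]" by (rule degree_eq_zeroE)
    have "map_poly (\<lambda>c. [:c:]) H - [:[:0, 1:]:] = [:[:c:] - [:0, 1:]:]"
      unfolding c by (rule poly_eqI) (simp add: coeff_map_poly coeff_pCons split: nat.split)
    then show ?thesis by (simp add: c)
  next
    case False
    have d: "Polynomial.degree (map_poly (\<lambda>c. [:c:]) H :: rat poly poly) = Polynomial.degree H"
      by (simp add: degree_map_poly)
    have "Polynomial.degree ?G = Polynomial.degree (map_poly (\<lambda>c. [:c:]) H :: rat poly poly)"
      unfolding diff_conv_add_uminus by (rule degree_add_eq_left) (use False in \<open>simp add: d\<close>)
    then show ?thesis by (simp only: d)
  qed
  have dG': "Polynomial.degree (map_poly of_rat H - [:z:] :: 'k poly) = Polynomial.degree H"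
  proof (cases "Polynomial.degree H = 0")
    case True
    then obtain c where c: "H = [:c:]" by (rule degree_eq_zeroE)
    have "map_poly of_rat H - [:z:] = [:of_rat c - z:]"
      unfolding c by (rule poly_eqI) (simp add: coeff_map_poly coeff_pCons split: nat.split)
    then show ?thesis by (simp add: c)
  next
    case False
    have "Polynomial.degree (map_poly of_rat H - [:z:]) = Polynomial.degree (map_poly of_rat H :: 'k poly)"
      unfolding diff_conv_add_uminus by (rule degree_add_eq_left) (use False in \<open>simp add: d1\<close>)
    then show ?thesis by (simp only: d1)
  qed
  have "evr (value_poly \<mu> H) z = resultant (map_poly (\<lambda>F. evr F z) ?F) (map_poly (\<lambda>F. evr F z) ?G)"
    unfolding value_poly_def
    by (rule evr.resultant_map_poly(1)[symmetric]) (simp_all only: F G d1 dF dG dG')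
  also have "\<dots> = resultant (map_poly of_rat \<mu>) (map_poly of_rat H - [:z:])" by (simp only: F G)
  also have "\<dots> = 0 \<longleftrightarrow> (\<exists>w. poly (map_poly of_rat \<mu>) w = 0 \<and> poly (map_poly of_rat H - [:z:]) w = 0)"
    by (rule resultant_zero_iff_common_root) (use assms in simp)
  finally show ?thesis by (simp add: evr_def)
qed

lemma clear_denominators:
  fixes F :: "rat poly"
  shows "\<exists>D R. D \<noteq> 0 \<and> Polynomial.smult (of_int D) F = map_poly of_int R"
proof (induction F)
  case (pCons a F)
  then obtain D R where DR: "D \<noteq> 0" "Polynomial.smult (of_int D) F = map_poly of_int R" by blast
  obtain p q where pq: "a = of_int p / of_int q" "q > 0" by (metis quotient_of_div quotient_of_denom_pos surj_pair)
  have "Polynomial.smult (of_int (D * q)) (pCons a F) = map_poly of_int (pCons (D * p) (Polynomial.smult q R))"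
  proof -
    have "Polynomial.smult (of_int (D * q)) F = Polynomial.smult (of_int q) (map_poly of_int R)"
      by (simp add: DR(2)[symmetric] mult.commute)
    also have "\<dots> = map_poly of_int (Polynomial.smult q R)" by (rule poly_eqI) (simp add: coeff_map_poly)
    finally have eq: "Polynomial.smult (of_int (D * q)) F = map_poly of_int (Polynomial.smult q R)" .
    have "rat_of_int (D * q) * a = of_int (D * p)" using pq by simp
    then show ?thesis
      by (intro poly_eqI)
        (simp add: coeff_map_poly coeff_pCons eq[THEN arg_cong[of _ _ "\<lambda>f. Polynomial.coeff f _"], simplified, unfolded coeff_map_poly] split: nat.split)
  qed
  then show ?case using DR(1) pq(2) by (intro exI[of _ "D * q"] exI[of _ "pCons (D * p) (Polynomial.smult q R)"]) simp
qed (rule exI[of _ 1], rule exI[of _ 0], simp)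

lemma evr_clear: "Polynomial.smult (of_int D) F = map_poly of_int R \<Longrightarrow> of_int D * evr F w = ev1 R w"
proof -
  assume *: "Polynomial.smult (of_int D) F = map_poly of_int R"
  have "of_int D * evr F w = evr (Polynomial.smult (of_int D) F) w"
    using evr.hom_mult[of "[:of_int D:]" F w] by (simp add: evr_const)
  also have "\<dots> = poly (map_poly of_rat (map_poly of_int R)) w" by (simp only: * evr_def)
  also have "map_poly of_rat (map_poly of_int R :: rat poly) = map_poly of_int R"
    by (rule poly_eqI) (simp add: coeff_map_poly)
  finally show ?thesis by (simp add: ev1_def)
qed

text \<open>The ring \<open>\<rat>[w]\<close> is a field: an integer equation of \<open>a \<noteq> 0\<close> with nonzero constant term \<open>b\<close> has the form
  \<open>a h(a) = -b\<close>.\<close>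

lemma evr_field:
  fixes w :: complex
  assumes w: "algebraic w"
  defines "K \<equiv> range (\<lambda>F. evr F w)"
  shows evr_field_add: "a \<in> K \<Longrightarrow> b \<in> K \<Longrightarrow> a + b \<in> K" and evr_field_mult: "a \<in> K \<Longrightarrow> b \<in> K \<Longrightarrow> a * b \<in> K"
    and evr_field_diff: "a \<in> K \<Longrightarrow> b \<in> K \<Longrightarrow> a - b \<in> K" and evr_field_inverse: "a \<in> K \<Longrightarrow> inverse a \<in> K"
    and evr_field_power: "a \<in> K \<Longrightarrow> a ^ k \<in> K" and evr_field_self: "w \<in> K"
proof -
  have KI: "evr F w \<in> K" for F by (simp add: K_def)
  show add: "a \<in> K \<Longrightarrow> b \<in> K \<Longrightarrow> a + b \<in> K" and mult: "a \<in> K \<Longrightarrow> b \<in> K \<Longrightarrow> a * b \<in> K"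
    and "a \<in> K \<Longrightarrow> b \<in> K \<Longrightarrow> a - b \<in> K" for a b
    by (auto simp: K_def simp flip: evr.hom_add evr.hom_mult evr.hom_minus)
  show "w \<in> K" using KI[of "[:0, 1:]"] by (simp only: evr_X)
  have c: "of_rat q \<in> K" for q using KI[of "[:q:]"] by (simp only: evr_const)
  show power: "a \<in> K \<Longrightarrow> a ^ k \<in> K" for a k using c[of 1] mult by (induction k) auto
  have alg: "algebraic a" if aK: "a \<in> K" for a
  proof -
    obtain F where "a = evr F w" using aK by (auto simp: K_def)
    moreover have "algebraic (evr F w)"
      unfolding evr_def
    proof (induction F)
      case (pCons c F)
      have "algebraic (of_rat c :: complex)"
        unfolding algebraic_iff by (rule integral_over_hom[OF of_rat_comm_ring_hom])
      then show ?case using pCons w by (auto simp: map_poly_pCons intro!: algebraic_add algebraic_mult)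
    qed simp
    ultimately show ?thesis by simp
  qed
  show "inverse a \<in> K" if a: "a \<in> K" for a
  proof (cases "a = 0")
    case True
    then show ?thesis using c[of 0] by simp
  next
    case False
    then obtain g where g: "Polynomial.coeff g 0 \<noteq> 0" "ev1 g a = 0" using int_poly_nonzero_const[OF alg[OF a]] by blast
    obtain b h where gb: "g = pCons b h" by (cases g)
    have b: "b \<noteq> 0" "of_int b + a * ev1 h a = 0" using g by (simp_all add: gb ev1_pCons)
    have "ev1 h a \<in> K"
    proof (induction h)
      case 0
      then show ?case using c[of 0] by (simp add: ev1.hom_zero)
    next
      case (pCons e h)
      then show ?case using c[of "of_int e"] add mult a by (simp add: ev1_pCons)
    qed
    then have m: "of_rat (- inverse (of_int b)) * ev1 h a \<in> K" by (intro mult c)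
    have "a * (of_rat (- inverse (of_int b)) * ev1 h a) = 1"
    proof -
      have "a * ev1 h a = - of_int b" using b(2) by (metis add_eq_0_iff)
      then show ?thesis using b(1) by (simp add: of_rat_minus of_rat_inverse mult.left_commute[of a])
    qed
    then have "inverse a = of_rat (- inverse (of_int b)) * ev1 h a" by (rule inverse_unique)
    then show ?thesis using m by simp
  qed
qed

lemma evr_field_powi: "algebraic w \<Longrightarrow> a \<in> range (\<lambda>F. evr F w) \<Longrightarrow> a powi n \<in> range (\<lambda>F. evr F (w :: complex))"
  unfolding power_int_def using evr_field_power[of w] evr_field_inverse[of w] by simp

lemma common_root_of_unity:
  fixes \<zeta> \<eta> :: complex
  assumes "\<zeta> ^ k = 1" "k > 0" "\<eta> ^ m = 1" "m > 0"
  obtains w N i j where "N > 0" "w ^ N = 1" "\<zeta> = w ^ i" "\<eta> = w ^ j"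
proof -
  define N where "N = k * m"
  have N: "N \<ge> 1" using assms by (simp add: N_def)
  define w where "w = exp (2 * of_real pi * \<i> / of_nat N)"
  have pw: "w ^ j = exp (2 * of_real pi * \<i> * of_nat j / of_nat N)" for j
    unfolding w_def exp_of_nat_mult[symmetric] by (simp add: mult_ac)
  have rt: "\<exists>j. u = w ^ j" if "u ^ N = 1" for u
  proof -
    have "u \<in> {z. z ^ N = 1}" using that by simp
    then show ?thesis unfolding complex_roots_unity[OF N] pw by blast
  qed
  have "\<zeta> ^ N = (\<zeta> ^ k) ^ m" "\<eta> ^ N = (\<eta> ^ m) ^ k"
    by (simp_all only: N_def power_mult[symmetric] mult.commute)
  then have "\<zeta> ^ N = 1" "\<eta> ^ N = 1" using assms by simp_all
  then obtain i j where "\<zeta> = w ^ i" "\<eta> = w ^ j" using rt by blast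
  moreover have "w ^ N = 1" using N by (simp add: pw)
  ultimately show ?thesis using that[of N w i j] N by simp
qed

text \<open>Write \<open>\<zeta>, \<eta>, z\<close> as polynomials in a root of unity \<open>w\<close>. An integral conjugate of \<open>z\<close> is the value of the last
  polynomial at another root \<open>w'\<close> of the minimal polynomial of \<open>w\<close>. All rational equations of \<open>w\<close> hold for \<open>w'\<close>, so
  replacing \<open>w\<close> by \<open>w'\<close> in all coordinates gives the point; its first two coordinates are sums of roots
  of unity.\<close>

theorem conjugate_integral_point:
  fixes \<zeta> \<eta> z :: complex
  assumes unity: "\<zeta> ^ k = 1" "k > 0" "\<eta> ^ m = 1" "m > 0"
    and z: "\<And>w. algebraic w \<Longrightarrow> \<zeta> \<in> range (\<lambda>F. evr F w) \<Longrightarrow> \<eta> \<in> range (\<lambda>F. evr F w) \<Longrightarrow> z \<in> range (\<lambda>F. evr F w)"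
    and nounit: "\<And>f. of_nat CARD('p) * ev1 f z \<noteq> 1"
  shows "\<exists>p :: xyz \<Rightarrow> 'p::prime_card adic_closure. range p \<subseteq> adic_integers \<and> ker_eval (trace_point \<zeta> \<eta> z) \<subseteq> ker_eval p"
proof -
  from common_root_of_unity[OF unity] obtain w N i j where w: "N > 0" "w ^ N = 1" "\<zeta> = w ^ i" "\<eta> = w ^ j" by metis
  have alg: "algebraic w" by (rule algebraic_root_of_unity[OF w(2,1)])
  have "\<zeta> \<in> range (\<lambda>F. evr F w)" "\<eta> \<in> range (\<lambda>F. evr F w)"
    unfolding w(3,4) by (intro evr_field_power evr_field_self alg)+
  from z[OF alg this] obtain H where H: "z = evr H w" by auto
  obtain \<mu> where \<mu>: "\<mu> \<noteq> 0" "evr \<mu> w = 0" "\<And>F. evr F w = 0 \<Longrightarrow> \<mu> dvd F"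
    using minimal_polynomial_exists[OF alg] by blast
  define r where "r = value_poly \<mu> H"
  have rz: "evr r z = 0" unfolding r_def value_poly_root_iff[OF \<mu>(1)] using \<mu>(2) H by blast
  \<comment> \<open>The zeros of \<open>r\<close> are the values of \<open>H\<close> at finitely many points.\<close>
  have "r \<noteq> 0"
  proof
    assume r: "r = 0"
    have "finite {w :: complex. evr \<mu> w = 0}" unfolding evr_def by (rule poly_roots_finite) (use \<mu>(1) in simp)
    then have "finite ((\<lambda>w. evr H w) ` {w :: complex. evr \<mu> w = 0})" by simp
    then obtain c where "c \<notin> (\<lambda>w. evr H w) ` {w :: complex. evr \<mu> w = 0}"
      using ex_new_if_finite[OF infinite_UNIV_char_0] by blast
    moreover have "evr r c = 0" by (simp add: r evr.hom_zero)
    then have "c \<in> (\<lambda>w. evr H w) ` {w :: complex. evr \<mu> w = 0}"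
      unfolding r_def value_poly_root_iff[OF \<mu>(1)] by auto
    ultimately show False by blast
  qed
  obtain D R where DR: "D \<noteq> 0" "Polynomial.smult (of_int D) r = map_poly of_int R" using clear_denominators by blast
  have "R \<noteq> 0"
  proof
    assume "R = 0"
    then have "Polynomial.smult (of_int D) r = 0" using DR(2) by simp
    then show False using DR(1) \<open>r \<noteq> 0\<close> by simp
  qed
  moreover have "ev1 R z = 0" using evr_clear[OF DR(2), of z] rz by simp
  ultimately obtain b :: "'p adic_closure" where b: "b \<in> adic_integers" "ev1 R b = 0"
    using integral_conjugate_exists[OF _ _ nounit] by blast
  have "evr r b = 0" using evr_clear[OF DR(2), of b] b(2) DR(1) by simp
  then obtain w' where w': "evr \<mu> w' = 0" "evr H w' = b"
    unfolding r_def value_poly_root_iff[OF \<mu>(1)] by blast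
  have transfer: "evr F w' = 0" if F: "evr F w = 0" for F
  proof -
    obtain G where "F = \<mu> * G" using \<mu>(3)[OF F] by (auto elim: dvdE)
    then show ?thesis using w'(1) by (simp add: evr.hom_mult)
  qed
  let ?X = "[:0, 1:] :: rat poly"
  have pX: "evr (?X ^ n) u = u ^ n" for n and u :: "'k::field_char_0" by (simp only: evr.hom_power evr_X)
  have "evr (?X ^ N - 1) w' = 0" by (rule transfer) (simp only: evr.hom_minus pX evr.hom_one w(2) diff_self)
  then have unity': "w' ^ N = 1" by (simp only: evr.hom_minus pX evr.hom_one eq_iff_diff_eq_0[symmetric])
  then have "w' \<in> adic_integers"
    unfolding adic_integers_iff by (rule integral_root_of_unity[OF adic_embed.comm_ring_hom_axioms _ w(1)])
  then have pw: "w' ^ n \<in> adic_integers" for n by (rule adic_integral(7))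
  define P where "P v = (case v of Vx \<Rightarrow> ?X ^ i + ?X ^ (i * (N - 1)) | Vy \<Rightarrow> ?X ^ j + ?X ^ (j * (N - 1)) | Vz \<Rightarrow> H)" for v
  have inv: "inverse (w ^ n) = w ^ (n * (N - 1))" for n
  proof (rule inverse_unique)
    have "w ^ n * w ^ (n * (N - 1)) = w ^ (n * N)" using w(1) by (cases N) (simp_all add: power_add)
    also have "\<dots> = (w ^ N) ^ n" by (simp only: power_mult[symmetric] mult.commute)
    finally show "w ^ n * w ^ (n * (N - 1)) = 1" using w(2) by simp
  qed
  have P: "evr (P v) w = trace_point \<zeta> \<eta> z v" for v
    by (cases v) (simp_all add: P_def trace_point_simps evr.hom_add evr.hom_power evr_X' w(3,4) inv H)
  define p where "p = (\<lambda>v. evr (P v) w')"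
  have "range p \<subseteq> adic_integers"
  proof
    fix c assume "c \<in> range p"
    then obtain v where "c = evr (P v) w'" by (auto simp: p_def)
    then show "c \<in> adic_integers"
      using pw b(1) w'(2) by (cases v) (simp_all add: P_def evr.hom_add evr.hom_power evr_X' adic_integral(1))
  qed
  moreover have "ker_eval (trace_point \<zeta> \<eta> z) \<subseteq> ker_eval p"
  proof
    fix f assume "f \<in> ker_eval (trace_point \<zeta> \<eta> z)"
    then have "evr (eval P f) w = 0" by (simp add: evr.hom_eval P ker_eval_def)
    from transfer[OF this] show "f \<in> ker_eval p" by (simp add: evr.hom_eval p_def ker_eval_def)
  qed
  ultimately show ?thesis by blast
qed

section \<open>Integral matrices with given traces\<close>

text \<open>If the module spanned by \<open>W\<close> is stable under \<open>x\<close>, then the module spanned by \<open>W\<close> and \<open>u W\<close> is stable under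
  \<open>u\<close>.\<close>

lemma integral_quadratic:
  fixes \<phi> :: "'a::idom \<Rightarrow> 'b::field"
  assumes hom: "comm_ring_hom \<phi>" and x: "integral_over \<phi> x" and u: "u * u = x * u - 1"
  shows "integral_over \<phi> u"
proof -
  interpret comm_ring_hom \<phi> by (rule hom)
  obtain W where W: "finite W" "1 \<in> W" "\<And>w. w \<in> W \<Longrightarrow> x * w \<in> hom_span \<phi> W"
    by (rule integral_over_common_module[OF hom x x]) (rule that)
  define W' where "W' = W \<union> (\<lambda>w. u * w) ` W"
  have fin: "finite W'" using W(1) by (simp add: W'_def)
  have base: "w \<in> W \<Longrightarrow> w \<in> hom_span \<phi> W'" "w \<in> W \<Longrightarrow> u * w \<in> hom_span \<phi> W'" for w
    by (rule hom_span_base[OF fin]; auto simp: W'_def)+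
  have umult: "u * v \<in> hom_span \<phi> W'" if v: "v \<in> hom_span \<phi> W" for v
  proof -
    obtain c where "v = (\<Sum>w\<in>W. \<phi> (c w) * w)" using v by (auto simp: hom_span_def)
    then have "u * v = (\<Sum>w\<in>W. \<phi> (c w) * (u * w))" by (simp add: sum_distrib_left mult.left_commute)
    also have "\<dots> \<in> hom_span \<phi> W'" by (intro hom_span_sum hom_span_scale base)
    finally show ?thesis .
  qed
  show ?thesis
  proof (rule integral_over_module[OF hom fin])
    show "1 \<in> W'" using W(2) by (simp add: W'_def)
    fix w assume "w \<in> W'"
    then consider "w \<in> W" | v where "v \<in> W" "w = u * v" by (auto simp: W'_def)
    then show "u * w \<in> hom_span \<phi> W'"
    proof cases
      case 1
      then show ?thesis by (rule base)
    next
      case 2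
      have "u * w = u * u * v" by (simp only: 2 mult.assoc)
      also have "\<dots> = u * (x * v) + \<phi> (- 1) * v" by (simp add: u algebra_simps hom_uminus)
      also have "\<dots> \<in> hom_span \<phi> W'" by (intro hom_span_add hom_span_scale umult W(3) base(1) 2)
      finally show ?thesis .
    qed
  qed simp
qed

lemma eigenvalue_exists:
  fixes x :: "'k::alg_closed_field"
  obtains u where "u \<noteq> 0" "x = u + inverse u" "u * u = x * u - 1"
proof -
  obtain u where "poly [:1, - x, 1:] u = 0" using alg_closed_imp_poly_has_root[of "[:1, - x, 1:]"] by auto
  then have e: "u * u = x * u - 1" by (simp add: algebra_simps add_eq_0_iff)
  then have nz: "u \<noteq> 0" by auto
  have "u * (x - u) = 1" using e by (simp add: algebra_simps)
  then have "inverse u = x - u" by (rule inverse_unique)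
  then show ?thesis using that[OF nz _ e] by simp
qed

lemma adic_integers_simps:
  "(0 :: 'p::prime_card adic_closure) \<in> adic_integers" "(1 :: 'p adic_closure) \<in> adic_integers"
  using adic_integral(6)[of 0] adic_integral(6)[of 1] by simp_all

lemma adic_integral_ev1:
  fixes c :: "'p::prime_card adic_closure"
  assumes "c \<in> adic_integers"
  shows "ev1 f c \<in> adic_integers"
  by (induction f) (simp_all add: ev1.hom_zero ev1_pCons adic_integers_simps adic_integral(1,2,6) assms)

lemma word_mat_integral:
  fixes M :: "gen \<Rightarrow> 'p::prime_card adic_closure ^ 2 ^ 2"
  assumes "\<And>g i j. M g $ i $ j \<in> adic_integers"
  shows "word_mat M w $ i $ j \<in> adic_integers"
proof (induction w arbitrary: i j)
  case Nil
  then show ?case by (simp add: mat1_nth adic_integers_simps)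
next
  case (Cons a w)
  obtain g s where a: "a = (g, s)" by (cases a)
  have "adj2 (M g) $ k $ l \<in> adic_integers" for k l
    using exhaust_2[of k] exhaust_2[of l] assms by (auto simp: adj2_nth intro!: adic_integral(4))
  then show ?case using Cons assms by (auto simp: a mult2 intro!: adic_integral(1,2))
qed

lemma tri_mats_integral:
  fixes a b z :: "'p::prime_card adic_closure"
  assumes "a \<in> adic_integers" "b \<in> adic_integers" "z \<in> adic_integers" "inverse a \<in> adic_integers" "inverse b \<in> adic_integers"
  shows "tri_mats a b z g $ i $ j \<in> adic_integers"
  using exhaust_2[of i] exhaust_2[of j]
  by (cases g) (auto simp: tri_mats_def adic_integers_simps assms intro!: adic_integral(2,5))

section \<open>Rational and integral points of the two families\<close>

context
  fixes n1 n2 m1 m2 e :: int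
  assumes sum: "m1 + m2 \<in> {1, -1} \<or> n1 + n2 \<in> {1, -1}" and e: "e \<in> {1, -1}"
    and ne: "e = 1 \<Longrightarrow> m1 \<noteq> m2" "e = -1 \<Longrightarrow> n1 \<noteq> n2"
begin

text \<open>The equations leave only the points of type \<open>e\<close>, and \<open>gen_irr_excludes_reducible\<close> removes the reducible ones among
  them.\<close>

lemma type_ideal_fibre:
  "P \<in> fibre_Q (type_ideal n1 n2 m1 m2 e) \<longleftrightarrow>
    n1 \<noteq> n2 \<and> m1 \<noteq> m2 \<and>
    (\<exists>\<zeta> \<eta>. type_roots n1 n2 m1 m2 e \<zeta> \<eta> \<and> P = ker_eval (type_point n1 m1 \<zeta> \<eta>) \<and>
      root_immersion (relator n1 n2 m1 m2) (type_ideal n1 n2 m1 m2 e) \<zeta> \<eta> (z_value n1 m1 \<zeta> \<eta>))" (is "?L \<longleftrightarrow> ?R")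
proof
  assume L: ?L
  then have "P \<in> fibre_Q (type_eqs n1 n2 m1 m2 e vx vy vz)" and sub: "gen_irr_ideal (relator n1 n2 m1 m2) \<subseteq> P"
    by (auto simp: fibre_Q_iff type_ideal_subset_iff prime_ideal)
  then have P: "n1 \<noteq> n2" "m1 \<noteq> m2"
    "\<exists>\<zeta> \<eta>. type_roots n1 n2 m1 m2 e \<zeta> \<eta> \<and> P = ker_eval (type_point n1 m1 \<zeta> \<eta>)"
    using prime_is_type_point[OF _ e sum, of P] ne by blast+
  obtain \<zeta> \<eta> where r: "type_roots n1 n2 m1 m2 e \<zeta> \<eta>" "P = ker_eval (type_point n1 m1 \<zeta> \<eta>)"
    using P(3) by blast
  have "eval (type_point n1 m1 \<zeta> \<eta>) (red_poly vx vy vz) \<noteq> 0"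
    by (rule gen_irr_excludes_reducible[OF sum e P(1,2) r(1)]) (rule sub[unfolded r(2)])
  from irreducible_point_immersion[OF r(1) e P(1,2) this] show ?R using P(1,2) r by blast
next
  assume ?R
  then obtain \<zeta> \<eta> where P: "P = ker_eval (type_point n1 m1 \<zeta> \<eta>)"
    and "root_immersion (relator n1 n2 m1 m2) (type_ideal n1 n2 m1 m2 e) \<zeta> \<eta> (z_value n1 m1 \<zeta> \<eta>)" by blast
  then have "type_ideal n1 n2 m1 m2 e \<subseteq> ker_eval (type_point n1 m1 \<zeta> \<eta>)"
    by (simp add: root_immersion_def Spec_closed_immersion_def Spec_morphism_def type_point_def)
  then show ?L unfolding P by (rule ker_eval_fibre)
qed

lemma type_point_fibre:
  assumes "type_roots n1 n2 m1 m2 e \<zeta> \<eta>" "n1 \<noteq> n2" "m1 \<noteq> m2"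
  shows "fibre_Q (ker_eval (type_point n1 m1 \<zeta> \<eta>)) = {ker_eval (type_point n1 m1 \<zeta> \<eta>)}"
  using fibre_Q_algebraic_point[of "type_point n1 m1 \<zeta> \<eta>"] type_point_algebraic(3)[OF assms(1) e assms(2,3)] by simp

lemma roots_distinct: "type_roots n1 n2 m1 m2 e \<zeta> \<eta> \<Longrightarrow> n1 \<noteq> n2 \<and> m1 \<noteq> m2"
  using e ne by (auto simp: type_roots_def)

lemma type_ideal_fibre_Un:
  "fibre_Q (type_ideal n1 n2 m1 m2 e) =
    (\<Union>(\<zeta>, \<eta>)\<in>{(\<zeta>, \<eta>). type_roots n1 n2 m1 m2 e \<zeta> \<eta> \<and>
       root_immersion (relator n1 n2 m1 m2) (type_ideal n1 n2 m1 m2 e) \<zeta> \<eta> (z_value n1 m1 \<zeta> \<eta>)}.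
     fibre_Q (ker_eval (type_point n1 m1 \<zeta> \<eta>)))" (is "_ = ?R")
proof (intro equalityI subsetI)
  fix P assume "P \<in> fibre_Q (type_ideal n1 n2 m1 m2 e)"
  then show "P \<in> ?R" unfolding type_ideal_fibre using type_point_fibre by fastforce
next
  fix P assume "P \<in> ?R"
  then obtain \<zeta> \<eta> where r: "type_roots n1 n2 m1 m2 e \<zeta> \<eta>"
    "root_immersion (relator n1 n2 m1 m2) (type_ideal n1 n2 m1 m2 e) \<zeta> \<eta> (z_value n1 m1 \<zeta> \<eta>)"
    "P \<in> fibre_Q (ker_eval (type_point n1 m1 \<zeta> \<eta>))" by auto
  have st: "n1 \<noteq> n2" "m1 \<noteq> m2" using roots_distinct[OF r(1)] by auto
  have "P = ker_eval (type_point n1 m1 \<zeta> \<eta>)" using r(3) type_point_fibre[OF r(1) st] by simp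
  then show "P \<in> fibre_Q (type_ideal n1 n2 m1 m2 e)" unfolding type_ideal_fibre using st r by blast
qed

lemma type_ideal_dim: "dim_Q (type_ideal n1 n2 m1 m2 e) \<le> 0"
  unfolding dim_Q_def
proof (rule Sup_least)
  fix d assume "d \<in> {ereal (real n) |n. \<exists>C. (\<forall>i\<le>n. C i \<in> fibre_Q (type_ideal n1 n2 m1 m2 e)) \<and> (\<forall>i<n. C i \<subset> C (Suc i))}"
  then obtain n C where d: "d = ereal (real n)" and C: "\<And>i. i \<le> n \<Longrightarrow> C i \<in> fibre_Q (type_ideal n1 n2 m1 m2 e)"
    "\<And>i. i < n \<Longrightarrow> C i \<subset> C (Suc i)" by blast
  have "n = 0"
  proof (rule ccontr)
    assume "n \<noteq> 0"
    then have c: "C 0 \<in> fibre_Q (type_ideal n1 n2 m1 m2 e)" "C 1 \<in> fibre_Q (type_ideal n1 n2 m1 m2 e)" "C 0 \<subset> C 1"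
      using C(1)[of 0] C(1)[of 1] C(2)[of 0] by auto
    obtain \<zeta> \<eta> where r: "type_roots n1 n2 m1 m2 e \<zeta> \<eta>" "C 0 = ker_eval (type_point n1 m1 \<zeta> \<eta>)"
      and st: "n1 \<noteq> n2" "m1 \<noteq> m2" using c(1) unfolding type_ideal_fibre by blast
    have "C 1 \<in> fibre_Q (ker_eval (type_point n1 m1 \<zeta> \<eta>))" using c(2,3) r(2) by (auto simp: fibre_Q_iff)
    then show False using type_point_fibre[OF r(1) st] c(3) r(2) by auto
  qed
  then show "d \<le> 0" by (simp add: d)
qed

text \<open>An integral point \<open>p\<close> has the same kernel as one of the points of type \<open>e\<close>. If \<open>l\<close> were a unit in \<open>\<int>[z]\<close>, then the same
  equation would make \<open>1/l\<close> a polynomial in the last coordinate of \<open>p\<close>, hence integral. The converse is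
  \<open>conjugate_integral_point\<close>.\<close>

theorem adic_points_iff:
  "has_adic_integral_point TYPE('p::prime_card) (type_ideal n1 n2 m1 m2 e) \<longleftrightarrow>
    (\<exists>\<zeta> \<eta>. type_roots n1 n2 m1 m2 e \<zeta> \<eta> \<and>
       root_immersion (relator n1 n2 m1 m2) (type_ideal n1 n2 m1 m2 e) \<zeta> \<eta> (z_value n1 m1 \<zeta> \<eta>) \<and>
       (\<exists>v. adic_valuation CARD('p) v \<and> v (z_value n1 m1 \<zeta> \<eta>) \<ge> 0))" (is "?L \<longleftrightarrow> ?R")
proof
  assume ?L
  then obtain p :: "xyz \<Rightarrow> 'p adic_closure" where p: "range p \<subseteq> adic_integers"
    and sub: "type_ideal n1 n2 m1 m2 e \<subseteq> ker_eval p" by (auto simp: has_adic_integral_point_def)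
  have "ker_eval p \<in> fibre_Q (type_ideal n1 n2 m1 m2 e)" by (rule ker_eval_fibre[OF sub])
  then obtain \<zeta> \<eta> where r: "type_roots n1 n2 m1 m2 e \<zeta> \<eta>" "ker_eval p = ker_eval (type_point n1 m1 \<zeta> \<eta>)"
    "root_immersion (relator n1 n2 m1 m2) (type_ideal n1 n2 m1 m2 e) \<zeta> \<eta> (z_value n1 m1 \<zeta> \<eta>)"
    and st: "n1 \<noteq> n2" "m1 \<noteq> m2"
    unfolding type_ideal_fibre by blast
  let ?z = "z_value n1 m1 \<zeta> \<eta>"
  have z: "type_point n1 m1 \<zeta> \<eta> Vz = ?z" by (simp add: type_point_def trace_point_simps)
  have alg: "algebraic ?z" using type_point_algebraic(3)[OF r(1) e st, of Vz] by (simp add: z)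
  have "of_nat CARD('p) * ev1 f ?z \<noteq> 1" for f
  proof
    define h where "h = of_nat CARD('p) * ev1 f vz - 1"
    have h: "eval q h = of_nat CARD('p) * ev1 f (q Vz) - 1" for q :: "xyz \<Rightarrow> 'b::comm_ring_1"
      by (simp add: h_def eval_hom.hom_minus eval_hom.hom_mult eval_hom.hom_of_nat eval_hom.hom_ev1 eval_Var eval_1)
    assume "of_nat CARD('p) * ev1 f ?z = 1"
    then have "h \<in> ker_eval (type_point n1 m1 \<zeta> \<eta>)" by (simp add: ker_eval_def h z)
    then have "h \<in> ker_eval p" by (simp only: r(2))
    then have "of_nat CARD('p) * ev1 f (p Vz) = 1" by (simp add: ker_eval_def h)
    then have "ev1 f (p Vz) \<notin> adic_integers" by (rule inverse_prime_not_integral)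
    moreover have "p Vz \<in> adic_integers" using p by blast
    ultimately show False using adic_integral_ev1 by blast
  qed
  then have "\<exists>v. adic_valuation CARD('p) v \<and> v ?z \<ge> 0"
    using adic_valuation_iff[OF prime_card[where 'a = 'p] alg] by blast
  then show ?R using r(1,3) by blast
next
  assume ?R
  then obtain \<zeta> \<eta> where r: "type_roots n1 n2 m1 m2 e \<zeta> \<eta>"
    "root_immersion (relator n1 n2 m1 m2) (type_ideal n1 n2 m1 m2 e) \<zeta> \<eta> (z_value n1 m1 \<zeta> \<eta>)"
    "\<exists>v. adic_valuation CARD('p) v \<and> v (z_value n1 m1 \<zeta> \<eta>) \<ge> 0" by blast
  have st: "n1 \<noteq> n2" "m1 \<noteq> m2" using roots_distinct[OF r(1)] by auto
  let ?z = "z_value n1 m1 \<zeta> \<eta>"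
  have alg: "algebraic ?z" using type_point_algebraic(3)[OF r(1) e st, of Vz] by (simp add: type_point_def trace_point_simps)
  have nounit: "of_nat CARD('p) * ev1 f ?z \<noteq> 1" for f
    using adic_valuation_iff[OF prime_card[where 'a = 'p] alg] r(3) by blast
  have z: "?z \<in> range (\<lambda>F. evr F w)"
    if w: "algebraic w" and \<zeta>: "\<zeta> \<in> range (\<lambda>F. evr F w)" and \<eta>: "\<eta> \<in> range (\<lambda>F. evr F w)" for w
    unfolding z_value_def divide_inverse
    by (intro evr_field_add[OF w] evr_field_mult[OF w] evr_field_diff[OF w] evr_field_inverse[OF w] evr_field_powi[OF w] \<zeta> \<eta>)
  obtain p :: "xyz \<Rightarrow> 'p adic_closure" where p: "range p \<subseteq> adic_integers"
    "ker_eval (trace_point \<zeta> \<eta> ?z) \<subseteq> ker_eval p"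
    using conjugate_integral_point[OF type_roots_torsion(1)[OF r(1) e] _ type_roots_torsion(2)[OF r(1) e] _ z nounit] st
    by auto
  moreover have "type_ideal n1 n2 m1 m2 e \<subseteq> ker_eval (trace_point \<zeta> \<eta> ?z)"
    using r(2) by (simp add: root_immersion_def Spec_closed_immersion_def Spec_morphism_def)
  ultimately show ?L unfolding has_adic_integral_point_def by blast
qed

text \<open>The point has the same kernel as an irreducible complex point, so \<open>red_poly\<close> does not vanish at it. The
  triangular matrices with eigenvalues \<open>a\<close> and \<open>b\<close> are integral, because \<open>a\<close> is a root of \<open>X\<^sup>2 - x X + 1\<close> and
  \<open>1/a = x - a\<close>, and likewise for \<open>b\<close>.\<close>

lemma integral_point_rep:
  assumes "has_adic_integral_point TYPE('p::prime_card) (type_ideal n1 n2 m1 m2 e)"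
  shows "weakly_integral_2_1 TYPE('p) (pres_group (relator n1 n2 m1 m2))"
proof -
  let ?r = "relator n1 n2 m1 m2"
  obtain p :: "xyz \<Rightarrow> 'p adic_closure" where p: "range p \<subseteq> adic_integers"
    and sub: "type_ideal n1 n2 m1 m2 e \<subseteq> ker_eval p" using assms by (auto simp: has_adic_integral_point_def)
  have pI: "p v \<in> adic_integers" for v using p by blast
  have "ker_eval p \<in> fibre_Q (type_ideal n1 n2 m1 m2 e)" by (rule ker_eval_fibre[OF sub])
  then obtain \<zeta> \<eta> where r: "type_roots n1 n2 m1 m2 e \<zeta> \<eta>" "ker_eval p = ker_eval (type_point n1 m1 \<zeta> \<eta>)"
    "root_immersion ?r (type_ideal n1 n2 m1 m2 e) \<zeta> \<eta> (z_value n1 m1 \<zeta> \<eta>)"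
    and st: "n1 \<noteq> n2" "m1 \<noteq> m2"
    unfolding type_ideal_fibre by blast
  have "red_poly vx vy vz \<notin> ker_eval (type_point n1 m1 \<zeta> \<eta>)"
    using immersion_irreducible[OF sum e st r(1,3)] by (simp add: ker_eval_def)
  then have "red_poly vx vy vz \<notin> ker_eval p" unfolding r(2) .
  then have red: "red_poly (p Vx) (p Vy) (p Vz) \<noteq> 0" by (simp add: ker_eval_def eval_hom.hom_red_poly eval_Var)
  have "type_eqs n1 n2 m1 m2 e vx vy vz \<subseteq> ker_eval p" using sub by (simp add: type_ideal_subset_iff[OF ker_eval_ideal])
  then have eqs: "type_eqs n1 n2 m1 m2 e (p Vx) (p Vy) (p Vz) \<subseteq> {0}" by (simp only: type_eqs_ker_eval)
  obtain a where a: "a \<noteq> 0" "p Vx = a + inverse a" "a * a = p Vx * a - 1" by (rule eigenvalue_exists)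
  obtain b where b: "b \<noteq> 0" "p Vy = b + inverse b" "b * b = p Vy * b - 1" by (rule eigenvalue_exists)
  have ab: "a \<in> adic_integers" "b \<in> adic_integers"
    using integral_quadratic[OF adic_embed.comm_ring_hom_axioms _ a(3)]
      integral_quadratic[OF adic_embed.comm_ring_hom_axioms _ b(3)] pI[of Vx] pI[of Vy]
    by (simp_all only: adic_integers_iff)
  have inv: "inverse a = p Vx - a" "inverse b = p Vy - b" using a(2) b(2) by simp_all
  have ab': "inverse a \<in> adic_integers" "inverse b \<in> adic_integers"
    unfolding inv by (intro adic_integral(5) pI ab)+
  define M where "M = tri_mats a b (p Vz)"
  define \<rho> where "\<rho> = rep_of ?r M"
  note rep = tri_mats_rep[OF a(1) b(1) e eqs[unfolded a(2) b(2)] red[unfolded a(2) b(2)], folded M_def, folded \<rho>_def]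
  have M: "M g $ i $ j \<in> adic_integers" for g i j unfolding M_def by (rule tri_mats_integral[OF ab pI ab'])
  have det: "det (\<rho> S) = 1" if "S \<in> carrier (pres_group ?r)" for S
    using rep(1) that by (auto simp: hom_def SL2_def)
  have "\<rho> S \<in> carrier (GL2_over adic_integers)" if S: "S \<in> carrier (pres_group ?r)" for S
  proof -
    obtain w where "S = word_class ?r w" using S by (auto simp: pres_group_carrier)
    then have "\<rho> S $ i $ j \<in> adic_integers" for i j by (simp only: rep(3) word_mat_integral[OF M])
    then show ?thesis using det[OF S] adic_integers_simps(2) by (auto simp: GL2_over_def intro!: bexI[of _ 1])
  qed
  then have "\<rho> \<in> hom (pres_group ?r) (GL2_over adic_integers)"
    using rep(1) by (auto simp: hom_def SL2_def GL2_over_def)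
  then show ?thesis using det rep(2) unfolding weakly_integral_2_1_def by blast
qed

end

section \<open>Weak integrality of the one-relator group\<close>

text \<open>The traces of an integral irreducible representation form an integral point of one of the two types by
  \<open>relation_types\<close>. It lies in the closure of the irreducible representations over the rationals, because it
  has the same kernel as an irreducible complex point.\<close>

theorem weakly_integral_iff:
  assumes sum: "m1 + m2 \<in> {1, -1} \<or> n1 + n2 \<in> {1, -1}" and st: "n1 \<noteq> n2" "m1 \<noteq> m2"
  shows "weakly_integral_2_1 TYPE('p::prime_card) (pres_group (relator n1 n2 m1 m2)) \<longleftrightarrow>
    has_adic_integral_point TYPE('p) (type_ideal n1 n2 m1 m2 1) \<or>
    has_adic_integral_point TYPE('p) (type_ideal n1 n2 m1 m2 (-1))" (is "?L \<longleftrightarrow> ?R")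
proof
  let ?r = "relator n1 n2 m1 m2"
  assume ?L
  then obtain \<rho> :: "word set \<Rightarrow> 'p adic_closure ^ 2 ^ 2" where hom: "\<rho> \<in> hom (pres_group ?r) (GL2_over adic_integers)"
    and det: "\<And>g. g \<in> carrier (pres_group ?r) \<Longrightarrow> det (\<rho> g) = 1" and irr: "irreducible_rep (pres_group ?r) \<rho>"
    unfolding weakly_integral_2_1_def by blast
  have mult: "\<rho> (S \<otimes>\<^bsub>pres_group ?r\<^esub> T) = \<rho> S ** \<rho> T"
    if "S \<in> carrier (pres_group ?r)" "T \<in> carrier (pres_group ?r)" for S T
    using hom that by (auto simp: hom_def GL2_over_def)
  note rep = rep_mats_word[of ?r \<rho>, OF mult det]
  define M where "M = rep_mats ?r \<rho>"
  have "M g $ i $ j \<in> adic_integers" for g i j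
    using hom by (auto simp: M_def rep_mats_def hom_def GL2_over_def pres_group_carrier)
  then have int: "trace_coords M v \<in> adic_integers" for v
    by (cases v) (auto simp: trace_coords_def trace2 mult2 intro!: adic_integral(1,2))
  have detM: "det (M g) = 1" for g using rep(2) by (simp add: M_def)
  have comm: "det (comm2 (M Ga) (M Gb)) \<noteq> 0"
    using irreducible_comm2[of \<rho> ?r M] rep(1) irr by (simp add: M_def)
  have "\<exists>e\<in>{1, -1}. type_eqs n1 n2 m1 m2 e (trace (M Ga)) (trace (M Gb)) (trace (M Ga ** M Gb)) \<subseteq> {0}"
    by (rule relation_types[OF localizes_0 _ sum])
      (use comm rep(3)[folded M_def] in \<open>simp_all add: detM mcong_def\<close>)
  then obtain e where e: "e \<in> {1, -1}" and eqs: "type_eqs n1 n2 m1 m2 e vx vy vz \<subseteq> ker_eval (trace_coords M)"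
    unfolding type_eqs_ker_eval by (auto simp: trace_coords_def)
  have ne: "e = 1 \<Longrightarrow> m1 \<noteq> m2" "e = -1 \<Longrightarrow> n1 \<noteq> n2" using st by simp_all
  obtain \<zeta> \<eta> where r: "type_roots n1 n2 m1 m2 e \<zeta> \<eta>" "ker_eval (trace_coords M) = ker_eval (type_point n1 m1 \<zeta> \<eta>)"
    using prime_is_type_point(3)[OF ker_eval_fibre[OF eqs] e sum ne] by blast
  have "red_poly (trace (M Ga)) (trace (M Gb)) (trace (M Ga ** M Gb)) \<noteq> 0"
    using comm det_comm2[OF detM detM, of Ga Gb] by simp
  then have "red_poly vx vy vz \<notin> ker_eval (trace_coords M)"
    by (simp add: ker_eval_def eval_hom.hom_red_poly eval_Var trace_coords_def)
  then have "eval (type_point n1 m1 \<zeta> \<eta>) (red_poly vx vy vz) \<noteq> 0" unfolding r(2) by (simp add: ker_eval_def)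
  then have "root_immersion ?r (type_ideal n1 n2 m1 m2 e) \<zeta> \<eta> (z_value n1 m1 \<zeta> \<eta>)"
    by (rule irreducible_point_immersion[OF r(1) e st])
  then have "type_ideal n1 n2 m1 m2 e \<subseteq> ker_eval (trace_coords M)"
    unfolding r(2) type_point_def by (simp add: root_immersion_def Spec_closed_immersion_def Spec_morphism_def)
  then have "has_adic_integral_point TYPE('p) (type_ideal n1 n2 m1 m2 e)"
    using int unfolding has_adic_integral_point_def by blast
  then show ?R using e by auto
next
  assume ?R
  then show ?L
  proof
    assume "has_adic_integral_point TYPE('p) (type_ideal n1 n2 m1 m2 1)"
    then show ?L by (rule integral_point_rep[OF sum, rotated 3]) (use st in simp_all)
  next
    assume "has_adic_integral_point TYPE('p) (type_ideal n1 n2 m1 m2 (-1))"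
    then show ?L by (rule integral_point_rep[OF sum, rotated 3]) (use st in simp_all)
  qed
qed

theorem theorem3:
  fixes n1 n2 m1 m2 :: int
  assumes "n1 \<noteq> 0" "n2 \<noteq> 0" "m1 \<noteq> 0" "m2 \<noteq> 0"
    and "m1 + m2 \<in> {1, -1} \<or> n1 + n2 \<in> {1, -1}"
  shows
    "(\<forall>i\<in>{1..8}. fibre_Q (M_circ n1 n2 m1 m2 i) = {})
   \<and> (m1 \<noteq> m2 \<longrightarrow>
        dim_Q (M_circ n1 n2 m1 m2 9) \<le> 0
      \<and> (\<forall>\<zeta> \<eta>. root_choice n1 n2 m1 m2 \<zeta> \<eta> \<and> \<not> algebraic_int (z_value n1 m1 \<zeta> \<eta>) \<longrightarrow>
           root_immersion (relator n1 n2 m1 m2) (M_circ n1 n2 m1 m2 9) \<zeta> \<eta> (z_value n1 m1 \<zeta> \<eta>))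
      \<and> fibre_Q (M_circ n1 n2 m1 m2 9) =
          (\<Union>(\<zeta>, \<eta>)\<in>immersions_9 n1 n2 m1 m2. fibre_Q (ker_eval (trace_point \<zeta> \<eta> (z_value n1 m1 \<zeta> \<eta>))))
      \<and> (has_adic_integral_point TYPE('p::prime_card) (M_circ n1 n2 m1 m2 9) \<longleftrightarrow>
           (\<exists>(\<zeta>, \<eta>)\<in>immersions_9 n1 n2 m1 m2. \<exists>v. adic_valuation CARD('p) v \<and> v (z_value n1 m1 \<zeta> \<eta>) \<ge> 0)))
   \<and> (n1 \<noteq> n2 \<longrightarrow>
        dim_Q (M_circ n1 n2 m1 m2 10) \<le> 0
      \<and> (\<forall>\<zeta> \<eta>. root_choice m1 m2 n1 n2 \<eta> \<zeta> \<and> \<not> algebraic_int (z_value m1 n1 \<eta> \<zeta>) \<longrightarrow>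
           root_immersion (relator n1 n2 m1 m2) (M_circ n1 n2 m1 m2 10) \<zeta> \<eta> (z_value m1 n1 \<eta> \<zeta>))
      \<and> fibre_Q (M_circ n1 n2 m1 m2 10) =
          (\<Union>(\<zeta>, \<eta>)\<in>immersions_10 n1 n2 m1 m2. fibre_Q (ker_eval (trace_point \<zeta> \<eta> (z_value m1 n1 \<eta> \<zeta>))))
      \<and> (has_adic_integral_point TYPE('p) (M_circ n1 n2 m1 m2 10) \<longleftrightarrow>
           (\<exists>(\<zeta>, \<eta>)\<in>immersions_10 n1 n2 m1 m2. \<exists>v. adic_valuation CARD('p) v \<and> v (z_value m1 n1 \<eta> \<zeta>) \<ge> 0)))
   \<and> (n1 \<noteq> n2 \<and> m1 \<noteq> m2 \<longrightarrow>
        (weakly_integral_2_1 TYPE('p) (pres_group (relator n1 n2 m1 m2)) \<longleftrightarrow>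
           (\<exists>(\<zeta>, \<eta>)\<in>immersions_9 n1 n2 m1 m2. \<exists>v. adic_valuation CARD('p) v \<and> v (z_value n1 m1 \<zeta> \<eta>) \<ge> 0)
         \<or> (\<exists>(\<zeta>, \<eta>)\<in>immersions_10 n1 n2 m1 m2. \<exists>v. adic_valuation CARD('p) v \<and> v (z_value m1 n1 \<eta> \<zeta>) \<ge> 0)))"
proof -
  note sum = assms(5)
  let ?r = "relator n1 n2 m1 m2" and ?I = "type_ideal n1 n2 m1 m2"
  let ?imm = "\<lambda>e \<zeta> \<eta>. type_roots n1 n2 m1 m2 e \<zeta> \<eta> \<and> root_immersion ?r (?I e) \<zeta> \<eta> (z_value n1 m1 \<zeta> \<eta>)"
  have rc: "root_choice n1 n2 m1 m2 \<zeta> \<eta> \<longleftrightarrow> type_roots n1 n2 m1 m2 1 \<zeta> \<eta>"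
    "root_choice m1 m2 n1 n2 \<eta> \<zeta> \<longleftrightarrow> type_roots n1 n2 m1 m2 (-1) \<zeta> \<eta>" for \<zeta> \<eta>
    using root_choice_iff_9[OF assms(3)] root_choice_iff_10[OF assms(1)] by blast+
  have z: "z_value m1 n1 \<eta> \<zeta> = z_value n1 m1 \<zeta> \<eta>" for \<zeta> \<eta> by (rule z_value_swap)
  have imm: "immersions_9 n1 n2 m1 m2 = {(\<zeta>, \<eta>). ?imm 1 \<zeta> \<eta>}"
    "immersions_10 n1 n2 m1 m2 = {(\<zeta>, \<eta>). ?imm (-1) \<zeta> \<eta>}"
    unfolding immersions_9_def immersions_10_def rc z M_circ_9 M_circ_10 by (rule HOL.refl)+
  let ?claim = "\<lambda>e. dim_Q (?I e) \<le> 0 \<and>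
      (\<forall>\<zeta> \<eta>. type_roots n1 n2 m1 m2 e \<zeta> \<eta> \<and> \<not> algebraic_int (z_value n1 m1 \<zeta> \<eta>) \<longrightarrow>
         root_immersion ?r (?I e) \<zeta> \<eta> (z_value n1 m1 \<zeta> \<eta>)) \<and>
      fibre_Q (?I e) = (\<Union>(\<zeta>, \<eta>)\<in>{(\<zeta>, \<eta>). ?imm e \<zeta> \<eta>}. fibre_Q (ker_eval (trace_point \<zeta> \<eta> (z_value n1 m1 \<zeta> \<eta>)))) \<and>
      (has_adic_integral_point TYPE('p) (?I e) \<longleftrightarrow>
         (\<exists>(\<zeta>, \<eta>)\<in>{(\<zeta>, \<eta>). ?imm e \<zeta> \<eta>}. \<exists>v. adic_valuation CARD('p) v \<and> v (z_value n1 m1 \<zeta> \<eta>) \<ge> 0))"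
  have main: "?claim e"
    if e: "e \<in> {1, -1}" and ne: "e = 1 \<Longrightarrow> m1 \<noteq> m2" "e = -1 \<Longrightarrow> n1 \<noteq> n2" for e :: int
  proof (intro conjI allI impI)
    show "dim_Q (?I e) \<le> 0" by (rule type_ideal_dim[OF sum e ne])
    show "root_immersion ?r (?I e) \<zeta> \<eta> (z_value n1 m1 \<zeta> \<eta>)"
      if "type_roots n1 n2 m1 m2 e \<zeta> \<eta> \<and> \<not> algebraic_int (z_value n1 m1 \<zeta> \<eta>)" for \<zeta> \<eta>
    proof -
      note r = conjunct1[OF that] and ni = conjunct2[OF that]
      have st: "n1 \<noteq> n2" "m1 \<noteq> m2" using roots_distinct[OF sum e ne r] by auto
      show ?thesis by (rule irreducible_point_immersion[OF r e st nonintegral_irreducible[OF r e st ni]])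
    qed
    show "fibre_Q (?I e) = (\<Union>(\<zeta>, \<eta>)\<in>{(\<zeta>, \<eta>). ?imm e \<zeta> \<eta>}. fibre_Q (ker_eval (trace_point \<zeta> \<eta> (z_value n1 m1 \<zeta> \<eta>))))"
      unfolding type_point_def[symmetric] by (rule type_ideal_fibre_Un[OF sum e ne])
    show "has_adic_integral_point TYPE('p) (?I e) \<longleftrightarrow>
         (\<exists>(\<zeta>, \<eta>)\<in>{(\<zeta>, \<eta>). ?imm e \<zeta> \<eta>}. \<exists>v. adic_valuation CARD('p) v \<and> v (z_value n1 m1 \<zeta> \<eta>) \<ge> 0)"
      by (subst adic_points_iff[OF sum e ne]) simp_all
  qed
  show ?thesis
    unfolding imm M_circ_9 M_circ_10 rc z
  proof (rule conjI[OF _ conjI[OF _ conjI]])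
    show "\<forall>i\<in>{1..8}. fibre_Q (M_circ n1 n2 m1 m2 i) = {}" using fibre_1_to_8_empty[OF sum] by blast
    show "m1 \<noteq> m2 \<longrightarrow> ?claim 1" by (rule impI, rule main) simp_all
    show "n1 \<noteq> n2 \<longrightarrow> ?claim (-1)" by (rule impI, rule main) simp_all
    show "n1 \<noteq> n2 \<and> m1 \<noteq> m2 \<longrightarrow>
        (weakly_integral_2_1 TYPE('p) (pres_group ?r) \<longleftrightarrow>
           (\<exists>(\<zeta>, \<eta>)\<in>{(\<zeta>, \<eta>). ?imm 1 \<zeta> \<eta>}. \<exists>v. adic_valuation CARD('p) v \<and> v (z_value n1 m1 \<zeta> \<eta>) \<ge> 0)
         \<or> (\<exists>(\<zeta>, \<eta>)\<in>{(\<zeta>, \<eta>). ?imm (-1) \<zeta> \<eta>}. \<exists>v. adic_valuation CARD('p) v \<and> v (z_value n1 m1 \<zeta> \<eta>) \<ge> 0))"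
    proof
      assume st: "n1 \<noteq> n2 \<and> m1 \<noteq> m2"
      have "?claim 1" "?claim (-1)" by (rule main; simp add: st)+
      then show "weakly_integral_2_1 TYPE('p) (pres_group ?r) \<longleftrightarrow>
           (\<exists>(\<zeta>, \<eta>)\<in>{(\<zeta>, \<eta>). ?imm 1 \<zeta> \<eta>}. \<exists>v. adic_valuation CARD('p) v \<and> v (z_value n1 m1 \<zeta> \<eta>) \<ge> 0)
         \<or> (\<exists>(\<zeta>, \<eta>)\<in>{(\<zeta>, \<eta>). ?imm (-1) \<zeta> \<eta>}. \<exists>v. adic_valuation CARD('p) v \<and> v (z_value n1 m1 \<zeta> \<eta>) \<ge> 0)"
        unfolding weakly_integral_iff[OF sum conjunct1[OF st] conjunct2[OF st], where 'p = 'p] by (simp only:)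
    qed
  qed
qed

end
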